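(* Consider the linearized two-class Aw-Rascle (AR) system on $x\in[0,L]$, $t\ge 0$, for the perturbations $z=(\tilde\rho_1,\tilde v_1,\tilde\rho_2,\tilde v_2)^T$, $$J_t\, z_t+J_x\, z_x+J\, z=0,$$ with boundary conditions $$\tilde\rho_1(0,t)=0,\qquad \tilde\rho_2(0,t)=0,$$ $$v_1^*\tilde\rho_1(0,t)+\rho_1^*\tilde v_1(0,t)+v_2^*\tilde\rho_2(0,t)+\rho_2^*\tilde v_2(0,t)=0,$$ $$v_1^*\tilde\rho_1(L,t)+\rho_1^*\tilde v_1(L,t)+v_2^*\tilde\rho_2(L,t)+\rho_2^*\tilde v_2(L,t)=U(t),$$ and initial profiles $\tilde\rho_1(\cdot,0),\tilde v_1(\cdot,0),\tilde\rho_2(\cdot,0),\tilde v_2(\cdot,0)\in\mathcal L^\infty([0,L])$, where the matrices and parameters are those defined in the context (congested regime). Suppose the full-state feedback law $$U(t)=\kappa_4 e^{\frac{\hat J_{44}}{\lambda_4}L}\left(-\bar R_1T_u^{-1}(L)z(L,t)+\int_0^L K(L,\xi)T_u^{-1}(\xi)z(\xi,t)\,d\xi+\int_0^L L_{11}(L,\xi)T_l^{-1}(\xi)z(\xi,t)\,d\xi\right)$$ is applied, where the kernel $K=(k_{11},k_{12},k_{13})$ is the solution on $\mathcal T=\{0\le\xi\le x\le L\}$ of $$0=\lambda_4K_x(x,\xi)+K_\xi(x,\xi)\Lambda^++K(x,\xi)\Sigma^{++}(\xi)-\frac1{\lambda_4}K(x-\xi,0)\Lambda^+\bar Q_0\Sigma^{-+}(\xi)+\left(\int_0^{-\xi/\lambda_4}K(\lambda_4\nu+x,\lambda_4\nu+\xi)\Sigma^{+-}(\lambda_4\nu+\xi)\,d\nu\right)\Sigma^{-+}(\xi),$$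 $$0=K(x,x)\Lambda^++\Lambda^-K(x,x)+\Sigma^{-+}(x),$$ and $L_{11}$ is then given by $$L_{11}(x,\xi)=-\frac1{\lambda_4}K(x-\xi,0)\Lambda^+\bar Q_0+\int_0^{-\xi/\lambda_4}K(\lambda_4\nu+x,\lambda_4\nu+\xi)\Sigma^{+-}(\lambda_4\nu+\xi)\,d\nu .$$ Then the perturbations $(\tilde\rho_1,\tilde v_1,\tilde\rho_2,\tilde v_2)$ converge to the zero equilibrium $\tilde\rho_{e,1}\equiv\tilde v_{e,1}\equiv\tilde\rho_{e,2}\equiv\tilde v_{e,2}\equiv0$ in the finite time $$t_F=\frac{L}{v_2^*}+\frac{L}{-\lambda_4},$$ i.e. they vanish on $[0,L]$ for all $t\ge t_F$.
   Context: **Model parameters.** $L,W>0$ (track length, width); for $i=1,2$: $a_i,V_i,\tau_i>0$, $\gamma_i>1$, $0<\overline{AO}_i\le1$; constant equilibrium densities $\rho_1^*,\rho_2^*>0$. Area occupancy $AO(\rho_1,\rho_2)=\frac{a_1\rho_1+a_2\rho_2}{W}$; pressures $p_i(AO)=V_i(AO/\overline{AO}_i)^{\gamma_i}$; equilibrium speeds $V_{e,i}(AO)=V_i\left(1-(AO/\overline{AO}_i)^{\gamma_i}\right)$. Equilibrium velocities are $v_i^*=V_{e,i}(AO(\rho_1^*,\rho_2^* ))$. Physical variables are $\rho_i=\rho_i^*+\tilde\rho_i$ (density) and $v_i=v_i^*+\tilde v_i$ (velocity). Put $\beta_{ij}=\partial p_i(AO(\rho_1,\rho_2))/\partial\rho_j$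 evaluated at $(\rho_1^*,\rho_2^* )$ and $\alpha_i=\beta_{ii}$. **Matrices.** $$J_t=\begin{pmatrix}1&0&0&0\\ \beta_{11}&1&\beta_{12}&0\\0&0&1&0\\ \beta_{21}&0&\beta_{22}&1\end{pmatrix},\quad J_x=\begin{pmatrix}v_1^*&\rho_1^*&0&0\\ v_1^*\beta_{11}&v_1^*&v_1^*\beta_{12}&0\\0&0&v_2^*&\rho_2^*\\ v_2^*\beta_{21}&0&v_2^*\beta_{22}&v_2^*\end{pmatrix},\quad J=\begin{pmatrix}0&0&0&0\\ \frac{\beta_{11}}{\tau_1}&\frac1{\tau_1}&\frac{\beta_{12}}{\tau_1}&0\\0&0&0&0\\ \frac{\beta_{21}}{\tau_2}&0&\frac{\beta_{22}}{\tau_2}&\frac1{\tau_2}\end{pmatrix}.$$ Set $\tilde J_x=J_t^{-1}J_x$ and $\tilde J=-J_t^{-1}J$, i.e. $$\tilde J_x=\begin{pmatrix}v_1^*&\rho_1^*&0&0\\0&v_1^*-\beta_{11}\rho_1^*&\beta_{12}(v_1^*-v_2^* )&-\beta_{12}\rho_2^*\\0&0&v_2^*&\rho_2^*\\ \beta_{21}(v_2^*-v_1^* )&-\beta_{21}\rho_1^*&0&v_2^*-\beta_{22}\rho_2^*\end{pmatrix},\quad \tilde J=-J.$$ The eigenvalues of $\tilde J_x$ (characteristic speeds) are $\lambda_1=v_1^*$, $\lambda_2=v_2^*$, $\lambda_{3}=\frac12(v_1^*+v_2^*-\alpha_1\rho_1^*-\alpha_2\rho_2^*+\Delta)$, $\lambda_{4}=\frac12(v_1^*+v_2^*-\alpha_1\rho_1^*-\alpha_2\rho_2^*-\Delta)$,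 with $\Delta=\sqrt{(\alpha_2\rho_2^*-\alpha_1\rho_1^*+v_1^*-v_2^* )^2+4\alpha_1\alpha_2\rho_1^*\rho_2^*}$. **Standing assumptions.** $v_1^*>v_2^*>0$ (so $\lambda_2<\lambda_3<\lambda_1$), and the congested regime: $\lambda_1,\lambda_2,\lambda_3>0$, $\lambda_4<0$. **Diagonalization.** $V=(v_{ij})_{1\le i,j\le4}$ is a constant invertible matrix with $V^{-1}\tilde J_xV=\mathrm{diag}(\lambda_1,\lambda_2,\lambda_3,\lambda_4)$; $\hat J=(\hat J_{ij})=V^{-1}\tilde JV$; $\kappa_i=v_1^*v_{1i}+\rho_1^*v_{2i}+v_2^*v_{3i}+\rho_2^*v_{4i}$, $i=1,\dots,4$. Set $$\hat Q_0=-\begin{pmatrix}v_{11}&v_{12}&v_{13}\\ v_{31}&v_{32}&v_{33}\\ \kappa_1&\kappa_2&\kappa_3\end{pmatrix}^{-1}\begin{pmatrix}v_{14}\\ v_{34}\\ \kappa_4\end{pmatrix},\qquad \hat R_1=-\frac1{\kappa_4}(\kappa_1,\kappa_2,\kappa_3)$$ (the inverse is assumed to exist and $\kappa_4\ne0$). Write $\theta_i=\hat J_{ii}/\lambda_i$, $i=1,\dots,4$, and $$\bar Q_0=\begin{pmatrix}0&0&1\\1&0&0\\0&1&0\end{pmatrix}^{-1}\hat Q_0,\qquad \bar R_1=\hat R_1\begin{pmatrix}0&0&e^{(\theta_1-\theta_4)L}\\ e^{(\theta_2-\theta_4)L}&0&0\\0&e^{(\theta_3-\theta_4)L}&0\end{pmatrix}.$$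 **Coefficients.** $\Lambda^+=\mathrm{diag}(v_2^*,\lambda_3,v_1^* )$, $\Lambda^-=-\lambda_4>0$, $$\Sigma^{++}=\begin{pmatrix}0&\bar J_{12}&\bar J_{13}\\ \bar J_{21}&0&\bar J_{23}\\ \bar J_{31}&\bar J_{32}&0\end{pmatrix},\quad \Sigma^{+-}=(\bar J_{14},\bar J_{24},\bar J_{34})^T,\quad \Sigma^{-+}=(\bar J_{41},\bar J_{42},\bar J_{43}),$$ where, as functions of $x$: $\bar J_{12}=\hat J_{23}e^{(\theta_3-\theta_2)x}$, $\bar J_{13}=\hat J_{21}e^{(\theta_1-\theta_2)x}$, $\bar J_{14}=\hat J_{24}e^{(\theta_4-\theta_2)x}$, $\bar J_{21}=\hat J_{32}e^{(\theta_2-\theta_3)x}$, $\bar J_{23}=\hat J_{31}e^{(\theta_1-\theta_3)x}$, $\bar J_{24}=\hat J_{34}e^{(\theta_4-\theta_3)x}$, $\bar J_{31}=\hat J_{12}e^{(\theta_2-\theta_1)x}$, $\bar J_{32}=\hat J_{13}e^{(\theta_3-\theta_1)x}$, $\bar J_{34}=\hat J_{14}e^{(\theta_4-\theta_1)x}$, $\bar J_{41}=\hat J_{42}e^{(\theta_2-\theta_4)x}$, $\bar J_{42}=\hat J_{43}e^{(\theta_3-\theta_4)x}$, $\bar J_{43}=\hat J_{41}e^{(\theta_1-\theta_4)x}$. **Transformation.** $$T^{-1}(x)=\begin{pmatrix}0&e^{-\theta_2x}&0&0\\0&0&e^{-\theta_3x}&0\\ e^{-\theta_1x}&0&0&0\\0&0&0&e^{-\theta_4x}\end{pmatrix}V^{-1};$$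 $T_u^{-1}(x)\in\mathbb R^{3\times4}$ denotes its first three rows and $T_l^{-1}(x)\in\mathbb R^{1\times4}$ its last row. $K$ is a $1\times3$ row-vector-valued and $L_{11}$ a scalar function in $L^\infty(\mathcal T)$; the kernel equations are understood along characteristics. Since initial data are only $L^\infty$, solutions of the PDE system are understood in the weak sense (along characteristics). *)

theory Defs
  imports "HOL-Analysis.Analysis"
begin

section \<open>Bounded functions and differentiation along characteristics\<close>

text \<open>\<open>L\<^sup>\<infinity>(S)\<close>, on Borel representatives; values outside \<open>S\<close> are irrelevant.\<close>

definition Linf_on :: "'a::euclidean_space set \<Rightarrow> ('a \<Rightarrow> 'b::euclidean_space) \<Rightarrow> bool" where
  "Linf_on S f \<longleftrightarrow> set_borel_measurable lborel S f \<and>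
     (\<exists>C. AE p in lborel. p \<in> S \<longrightarrow> norm (f p) \<le> C)"

text \<open>
  \<open>c f\<^sub>x + d f\<^sub>y = g\<close> on \<open>D\<close> along almost every line of direction \<open>(c, d)\<close>, \<open>d \<noteq> 0\<close>: on such a line \<open>f\<close>
  is locally absolutely continuous, up to the boundary of \<open>D\<close>, with derivative \<open>g\<close>. (\<open>D\<close> is convex in
  all uses.) If \<open>g\<close> is bounded, every bounded weak solution has such a representative. It determines
  the trace of \<open>f\<close>, up to null sets, on every line transversal to \<open>(c, d)\<close>, in particular on the
  boundary and on each time slice. Values of \<open>f\<close> on such lines below are these
  traces.
\<close>

definition deriv_along ::
  "real \<Rightarrow> real \<Rightarrow> (real \<times> real) set \<Rightarrow> (real \<Rightarrow> real \<Rightarrow> real) \<Rightarrow> (real \<Rightarrow> real \<Rightarrow> real) \<Rightarrow> bool" where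
  "deriv_along c d D f g \<longleftrightarrow>
     (AE y in lborel. \<forall>r s. r \<le> s \<and> (y + c * r, d * r) \<in> D \<and> (y + c * s, d * s) \<in> D \<longrightarrow>
        set_integrable lborel {r..s} (\<lambda>\<sigma>. g (y + c * \<sigma>) (d * \<sigma>)) \<and>
        f (y + c * s) (d * s) - f (y + c * r) (d * r) =
          (LINT \<sigma>:{r..s}|lborel. g (y + c * \<sigma>) (d * \<sigma>)))"

text \<open>
  Solutions along characteristics of \<open>A z\<^sub>t + B z\<^sub>x + C z = 0\<close> on \<open>[0, len] \<times> [0, \<infinity>)\<close>, with \<open>z x t\<close> the
  state at position \<open>x\<close> and time \<open>t\<close>. If \<open>l B = c l A\<close>, multiplying the system from the left by the row
  vector \<open>l\<close> gives \<open>(\<partial>\<^sub>t + c \<partial>\<^sub>x) (l A z) = - l C z\<close>. When \<open>A\<^sup>-\<^sup>1 B\<close> is diagonalizable over the reals,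
  these \<open>l A\<close> span the space of row vectors, so this is the whole system in characteristic form.
\<close>

definition char_solution ::
  "real \<Rightarrow> real^'n^'n \<Rightarrow> real^'n^'n \<Rightarrow> real^'n^'n \<Rightarrow> (real \<Rightarrow> real \<Rightarrow> real^'n) \<Rightarrow> bool" where
  "char_solution len A B C z \<longleftrightarrow>
     (\<forall>T>0. Linf_on ({0..len} \<times> {0..T}) (\<lambda>(x, t). z x t)) \<and>
     (\<forall>l c. l v* B = c *\<^sub>R (l v* A) \<longrightarrow>
        deriv_along c 1 ({0..len} \<times> {0..})
          (\<lambda>x t. (l v* A) \<bullet> z x t) (\<lambda>x t. - ((l v* C) \<bullet> z x t)))"

definition diag :: "real^'n \<Rightarrow> real^'n^'n" where
  "diag d = (\<chi> i j. if i = j then d $ i else 0)"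


section \<open>The two-class Aw-Rascle model\<close>

record AR_params =
  len :: real
  width :: real
  area :: "real^2"      \<comment> \<open>\<open>a\<^sub>i\<close>\<close>
  vfree :: "real^2"     \<comment> \<open>\<open>V\<^sub>i\<close>\<close>
  relax :: "real^2"     \<comment> \<open>\<open>\<tau>\<^sub>i\<close>\<close>
  expo :: "real^2"      \<comment> \<open>\<open>\<gamma>\<^sub>i\<close>\<close>
  AOmax :: "real^2"     \<comment> \<open>\<open>AO\<^sub>i\<close> with overline\<close>
  rho_eq :: "real^2"    \<comment> \<open>\<open>\<rho>\<^sub>i\<close> at equilibrium\<close>

definition valid_params :: "AR_params \<Rightarrow> bool" where
  "valid_params P \<longleftrightarrow> 0 < len P \<and> 0 < width P \<and>
     (\<forall>i. 0 < area P $ i \<and> 0 < vfree P $ i \<and> 0 < relax P $ i \<and> 1 < expo P $ i \<and>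
          0 < AOmax P $ i \<and> AOmax P $ i \<le> 1 \<and> 0 < rho_eq P $ i)"

definition AO :: "AR_params \<Rightarrow> real^2 \<Rightarrow> real" where
  "AO P \<rho> = (area P $ 1 * \<rho> $ 1 + area P $ 2 * \<rho> $ 2) / width P"

definition pressure :: "AR_params \<Rightarrow> 2 \<Rightarrow> real \<Rightarrow> real" where
  "pressure P i ao = vfree P $ i * (ao / AOmax P $ i) powr (expo P $ i)"

definition eq_speed :: "AR_params \<Rightarrow> 2 \<Rightarrow> real \<Rightarrow> real" where
  "eq_speed P i ao = vfree P $ i * (1 - (ao / AOmax P $ i) powr (expo P $ i))"

definition v_eq :: "AR_params \<Rightarrow> real^2" where
  "v_eq P = (\<chi> i. eq_speed P i (AO P (rho_eq P)))"

definition beta :: "AR_params \<Rightarrow> 2 \<Rightarrow> 2 \<Rightarrow> real" where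
  "beta P i j =
     deriv (\<lambda>r. pressure P i (AO P (\<chi> k. if k = j then r else rho_eq P $ k))) (rho_eq P $ j)"

definition Jt :: "AR_params \<Rightarrow> real^4^4" where
  "Jt P = vector
    [vector [1, 0, 0, 0],
     vector [beta P 1 1, 1, beta P 1 2, 0],
     vector [0, 0, 1, 0],
     vector [beta P 2 1, 0, beta P 2 2, 1]]"

definition Jx :: "AR_params \<Rightarrow> real^4^4" where
  "Jx P = (let v1 = v_eq P $ 1; v2 = v_eq P $ 2; r1 = rho_eq P $ 1; r2 = rho_eq P $ 2 in vector
    [vector [v1, r1, 0, 0],
     vector [v1 * beta P 1 1, v1, v1 * beta P 1 2, 0],
     vector [0, 0, v2, r2],
     vector [v2 * beta P 2 1, 0, v2 * beta P 2 2, v2]])"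

definition Js :: "AR_params \<Rightarrow> real^4^4" where
  "Js P = (let t1 = relax P $ 1; t2 = relax P $ 2 in vector
    [vector [0, 0, 0, 0],
     vector [beta P 1 1 / t1, 1 / t1, beta P 1 2 / t1, 0],
     vector [0, 0, 0, 0],
     vector [beta P 2 1 / t2, 0, beta P 2 2 / t2, 1 / t2]])"

definition Jx_tilde :: "AR_params \<Rightarrow> real^4^4" where
  "Jx_tilde P = matrix_inv (Jt P) ** Jx P"

definition J_tilde :: "AR_params \<Rightarrow> real^4^4" where
  "J_tilde P = - (matrix_inv (Jt P) ** Js P)"

definition Delta :: "AR_params \<Rightarrow> real" where
  "Delta P = sqrt ((beta P 2 2 * rho_eq P $ 2 - beta P 1 1 * rho_eq P $ 1
                     + v_eq P $ 1 - v_eq P $ 2)\<^sup>2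
                   + 4 * beta P 1 1 * beta P 2 2 * rho_eq P $ 1 * rho_eq P $ 2)"

definition lam :: "AR_params \<Rightarrow> real^4" where
  "lam P = (let v1 = v_eq P $ 1; v2 = v_eq P $ 2;
                m = v1 + v2 - beta P 1 1 * rho_eq P $ 1 - beta P 2 2 * rho_eq P $ 2 in vector
     [v1, v2, (m + Delta P) / 2, (m - Delta P) / 2])"

definition congested :: "AR_params \<Rightarrow> bool" where
  "congested P \<longleftrightarrow> v_eq P $ 2 < v_eq P $ 1 \<and> 0 < v_eq P $ 2 \<and>
     0 < lam P $ 1 \<and> 0 < lam P $ 2 \<and> 0 < lam P $ 3 \<and> lam P $ 4 < 0"

text \<open>Linearized total flow; \<open>w\<close> lists the perturbations of \<open>\<rho>\<^sub>1, v\<^sub>1, \<rho>\<^sub>2, v\<^sub>2\<close> in this order.\<close>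

definition flow :: "AR_params \<Rightarrow> real^4 \<Rightarrow> real" where
  "flow P w = v_eq P $ 1 * w $ 1 + rho_eq P $ 1 * w $ 2 + v_eq P $ 2 * w $ 3 + rho_eq P $ 2 * w $ 4"


section \<open>Diagonalization\<close>

text \<open>\<open>V\<close> is the matrix of eigenvectors of \<^term>\<open>Jx_tilde P\<close>.\<close>

definition diagonalizes :: "AR_params \<Rightarrow> real^4^4 \<Rightarrow> bool" where
  "diagonalizes P V \<longleftrightarrow> invertible V \<and> matrix_inv V ** Jx_tilde P ** V = diag (lam P)"

definition Jhat :: "AR_params \<Rightarrow> real^4^4 \<Rightarrow> real^4^4" where
  "Jhat P V = matrix_inv V ** J_tilde P ** V"

definition kappa :: "AR_params \<Rightarrow> real^4^4 \<Rightarrow> 4 \<Rightarrow> real" where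
  "kappa P V i = v_eq P $ 1 * V $ 1 $ i + rho_eq P $ 1 * V $ 2 $ i
               + v_eq P $ 2 * V $ 3 $ i + rho_eq P $ 2 * V $ 4 $ i"

definition inlet_matrix :: "AR_params \<Rightarrow> real^4^4 \<Rightarrow> real^3^3" where
  "inlet_matrix P V = vector
    [vector [V $ 1 $ 1, V $ 1 $ 2, V $ 1 $ 3],
     vector [V $ 3 $ 1, V $ 3 $ 2, V $ 3 $ 3],
     vector [kappa P V 1, kappa P V 2, kappa P V 3]]"

definition Q0_hat :: "AR_params \<Rightarrow> real^4^4 \<Rightarrow> real^3" where
  "Q0_hat P V = - (matrix_inv (inlet_matrix P V) *v vector [V $ 1 $ 4, V $ 3 $ 4, kappa P V 4])"

definition R1_hat :: "AR_params \<Rightarrow> real^4^4 \<Rightarrow> real^3" where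
  "R1_hat P V = - (1 / kappa P V 4) *\<^sub>R vector [kappa P V 1, kappa P V 2, kappa P V 3]"

definition theta :: "AR_params \<Rightarrow> real^4^4 \<Rightarrow> 4 \<Rightarrow> real" where
  "theta P V i = Jhat P V $ i $ i / lam P $ i"

definition Q0_bar :: "AR_params \<Rightarrow> real^4^4 \<Rightarrow> real^3" where
  "Q0_bar P V = matrix_inv (vector
    [vector [0, 0, 1],
     vector [1, 0, 0],
     vector [0, 1, 0]] :: real^3^3) *v Q0_hat P V"

definition R1_bar :: "AR_params \<Rightarrow> real^4^4 \<Rightarrow> real^3" where
  "R1_bar P V = (let e = (\<lambda>i. exp ((theta P V i - theta P V 4) * len P)) in
     R1_hat P V v* (vector
    [vector [0, 0, e 1],
     vector [e 2, 0, 0],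
     vector [0, e 3, 0]] :: real^3^3))"

definition Lam_plus :: "AR_params \<Rightarrow> real^3^3" where
  "Lam_plus P = diag (vector [v_eq P $ 2, lam P $ 3, v_eq P $ 1])"

definition Lam_minus :: "AR_params \<Rightarrow> real" where
  "Lam_minus P = - lam P $ 4"

text \<open>
  The transport directions are listed in the order \<open>2, 3, 1, 4\<close>; the indices of \<open>coupling\<close> are those
  of \<^term>\<open>Jhat P V\<close>, before this reordering.
\<close>

definition coupling :: "AR_params \<Rightarrow> real^4^4 \<Rightarrow> real \<Rightarrow> 4 \<Rightarrow> 4 \<Rightarrow> real" where
  "coupling P V x i k = Jhat P V $ i $ k * exp ((theta P V k - theta P V i) * x)"

definition Sig_pp :: "AR_params \<Rightarrow> real^4^4 \<Rightarrow> real \<Rightarrow> real^3^3" where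
  "Sig_pp P V x = (let c = coupling P V x in vector
    [vector [0, c 2 3, c 2 1],
     vector [c 3 2, 0, c 3 1],
     vector [c 1 2, c 1 3, 0]])"

definition Sig_pm :: "AR_params \<Rightarrow> real^4^4 \<Rightarrow> real \<Rightarrow> real^3" where
  "Sig_pm P V x = (let c = coupling P V x in vector [c 2 4, c 3 4, c 1 4])"

definition Sig_mp :: "AR_params \<Rightarrow> real^4^4 \<Rightarrow> real \<Rightarrow> real^3" where
  "Sig_mp P V x = (let c = coupling P V x in vector [c 4 2, c 4 3, c 4 1])"

definition T_inv :: "AR_params \<Rightarrow> real^4^4 \<Rightarrow> real \<Rightarrow> real^4^4" where
  "T_inv P V x = (let e = (\<lambda>i. exp (- theta P V i * x)) in (vector
    [vector [0, e 2, 0, 0],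
     vector [0, 0, e 3, 0],
     vector [e 1, 0, 0, 0],
     vector [0, 0, 0, e 4]] :: real^4^4) ** matrix_inv V)"

definition Tu_inv :: "AR_params \<Rightarrow> real^4^4 \<Rightarrow> real \<Rightarrow> real^4^3" where
  "Tu_inv P V x = vector [T_inv P V x $ 1, T_inv P V x $ 2, T_inv P V x $ 3]"

definition Tl_inv :: "AR_params \<Rightarrow> real^4^4 \<Rightarrow> real \<Rightarrow> real^4" where
  "Tl_inv P V x = T_inv P V x $ 4"


section \<open>Kernels and feedback law\<close>

definition tri_domain :: "AR_params \<Rightarrow> (real \<times> real) set" where
  "tri_domain P = {(x, \<xi>). 0 \<le> \<xi> \<and> \<xi> \<le> x \<and> x \<le> len P}"

text \<open>
  Row vectors are elements of \<^typ>\<open>real^3\<close>. The \<open>j\<close>-th component of the differential equation for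
  \<open>K\<close> is a transport equation for \<open>k\<^sub>1\<^sub>j\<close> in the direction \<open>(\<lambda>\<^sub>4, \<Lambda>\<^sup>+\<^sub>j\<^sub>j)\<close>; the terms without derivatives
  are moved to its right-hand side.
\<close>

definition kernel_solution ::
  "AR_params \<Rightarrow> real^4^4 \<Rightarrow> (real \<Rightarrow> real \<Rightarrow> real^3) \<Rightarrow> bool" where
  "kernel_solution P V K \<longleftrightarrow>
     Linf_on (tri_domain P) (\<lambda>(x, \<xi>). K x \<xi>) \<and>
     (\<forall>j. deriv_along (lam P $ 4) (Lam_plus P $ j $ j) (tri_domain P)
        (\<lambda>x \<xi>. K x \<xi> $ j)
        (\<lambda>x \<xi>. - (K x \<xi> v* Sig_pp P V \<xi>
                  - ((1 / lam P $ 4) * ((K (x - \<xi>) 0 v* Lam_plus P) \<bullet> Q0_bar P V)) *\<^sub>R Sig_mp P V \<xi>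
                  + (LINT \<nu>:{0..- \<xi> / lam P $ 4}|lborel.
                       K (lam P $ 4 * \<nu> + x) (lam P $ 4 * \<nu> + \<xi>) \<bullet> Sig_pm P V (lam P $ 4 * \<nu> + \<xi>))
                    *\<^sub>R Sig_mp P V \<xi>) $ j)) \<and>
     (AE x in lborel. x \<in> {0..len P} \<longrightarrow>
        K x x v* Lam_plus P + Lam_minus P *\<^sub>R K x x + Sig_mp P V x = 0)"

definition kernel_L11 ::
  "AR_params \<Rightarrow> real^4^4 \<Rightarrow> (real \<Rightarrow> real \<Rightarrow> real^3) \<Rightarrow> real \<Rightarrow> real \<Rightarrow> real" where
  "kernel_L11 P V K x \<xi> =
     - (1 / lam P $ 4) * ((K (x - \<xi>) 0 v* Lam_plus P) \<bullet> Q0_bar P V)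
     + (LINT \<nu>:{0..- \<xi> / lam P $ 4}|lborel.
          K (lam P $ 4 * \<nu> + x) (lam P $ 4 * \<nu> + \<xi>) \<bullet> Sig_pm P V (lam P $ 4 * \<nu> + \<xi>))"

definition feedback ::
  "AR_params \<Rightarrow> real^4^4 \<Rightarrow> (real \<Rightarrow> real \<Rightarrow> real^3) \<Rightarrow> (real \<Rightarrow> real \<Rightarrow> real) \<Rightarrow>
   (real \<Rightarrow> real^4) \<Rightarrow> real" where
  "feedback P V K L11 w =
     kappa P V 4 * exp (Jhat P V $ 4 $ 4 / lam P $ 4 * len P) *
       (- (R1_bar P V \<bullet> (Tu_inv P V (len P) *v w (len P)))
        + (LINT \<xi>:{0..len P}|lborel. K (len P) \<xi> \<bullet> (Tu_inv P V \<xi> *v w \<xi>))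
        + (LINT \<xi>:{0..len P}|lborel. L11 (len P) \<xi> * (Tl_inv P V \<xi> \<bullet> w \<xi>)))"

end

theory Submission
  imports Defs
begin

text \<open>
  In the coordinates given by the left eigenvectors, rescaled by \<open>exp (- \<theta>\<^sub>i x)\<close>, the system consists of
  three components \<open>w\<close> transported to the right and one component \<open>u\<close> transported to the left, coupled
  by \<open>\<Sigma>\<close>. Let \<open>F(x, t) = \<integral>\<^sub>0\<^sup>x (K(x, \<xi>) w(\<xi>, t) + L\<^sub>1\<^sub>1(x, \<xi>) u(\<xi>, t)) d\<xi>\<close>; the feedback says \<open>u = F\<close> at \<open>x = L\<close>.
  Nothing is differentiable in the classical sense, so \<open>u - F\<close> is followed along a line \<open>x(s) = x\<^sub>0 + \<lambda>\<^sub>4 s\<close>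
  with the divergence theorem: in the \<open>(\<xi>, s)\<close>-plane both \<open>K\<^sub>j(x(s), \<xi>)\<close> and \<open>w\<^sub>j(\<xi>, s)\<close> are absolutely
  continuous in the direction \<open>(\<Lambda>\<^sup>+\<^sub>j\<^sub>j, 1)\<close>, and both \<open>L\<^sub>1\<^sub>1(x(s), \<xi>)\<close> and \<open>u(\<xi>, s)\<close> are so in the direction
  \<open>(\<lambda>\<^sub>4, 1)\<close>. By the kernel equations the interior terms cancel, and the boundary terms account exactly
  for the change of \<open>u\<close>. Hence \<open>u = F\<close> after time \<open>L / (- \<lambda>\<^sub>4)\<close>; in particular \<open>u\<close>, and then \<open>w\<close>, vanishes
  at the inlet. The remaining Volterra system, with all speeds of \<open>w\<close> at least \<open>v\<^sub>2\<close>, forces \<open>w\<close> and \<open>u\<close> to vanish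
  where \<open>t \<ge> L / (- \<lambda>\<^sub>4) + x / v\<^sub>2\<close>: an integral over this region with weight \<open>exp (- M x)\<close> is at most half
  of itself for large \<open>M\<close>.
\<close>

section \<open>Almost every characteristic line\<close>

text \<open>The obstacle is that the data hold "almost everywhere" in three senses: bounds in the
  plane, equations on almost every line of a given direction, boundary conditions at almost every
  boundary point. Shears and Fubini pass between these senses across transversal directions, and
  continuity along characteristics carries bounds to the boundary. The line
  \<open>x0 + l * s\<close> is chosen because \<open>K j\<close> is transported in direction
  \<open>(l, c j)\<close>: if \<open>x\<close> moves with speed \<open>l\<close>, then in the
  \<open>(\<xi>, s)\<close>-plane the kernel follows \<open>(c j, 1)\<close>, exactly like
  \<open>w j\<close>. So a product rule along one common direction suffices, although neither factor
  has partial derivatives. The same choice makes the moving end point a characteristic of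
  \<open>u\<close>, so that \<open>L * u\<close> has no flux through it. The weight depends on
  \<open>x\<close> alone because both final estimates are of Volterra type in \<open>x\<close>:
  \<open>w j\<close> is integrated along its characteristic from the inlet, \<open>u = F\<close>
  over \<open>[0, x]\<close> at fixed time. Each integration gains a factor of order
  \<open>1 / M\<close>.\<close>

lemma AE_lborel_affine:
  fixes c t :: real
  assumes "AE x in lborel. Q x" "c \<noteq> 0"
  shows "AE x in lborel. Q (t + c * x)"
proof -
  obtain N where N: "{x. \<not> Q x} \<subseteq> N" "N \<in> null_sets lborel"
    using assms(1) by (auto simp: eventually_ae_filter)
  have [measurable]: "N \<in> sets borel" using N(2) by auto
  have "AE x in lborel. x \<notin> N" using N(2) by (rule AE_not_in)
  then have "AE x in lborel. t + c * x \<notin> N"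
    by (intro AE_borel_affine assms) measurable
  then show ?thesis by eventually_elim (use N(1) in auto)
qed

text \<open>At height \<open>r\<close> the shear only translates the section, by
  \<open>c * r\<close>, and translations preserve length. The coordinates \<open>(y, r)\<close> of
  the point \<open>(y + c * r, r)\<close> are those of \<open>deriv_along\<close>, so this gives
  Fubini along characteristics.\<close>

lemma emeasure_shear:
  fixes c :: real
  assumes [measurable]: "A \<in> sets borel"
  shows "emeasure lborel ((\<lambda>(y, r). (y + c * r, r)) -` A) = emeasure lborel (A :: (real \<times> real) set)"
proof -
  have A: "A \<in> sets (lborel \<Otimes>\<^sub>M lborel)" using assms by (simp only: lborel_prod sets_lborel)
  have m: "(\<lambda>(y, r). (y + c * r, r)) \<in> borel \<rightarrow>\<^sub>M (borel :: (real \<times> real) measure)"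
    unfolding borel_prod[symmetric] by measurable
  have B: "(\<lambda>(y, r). (y + c * r, r)) -` A \<in> sets (lborel \<Otimes>\<^sub>M lborel)"
    using measurable_sets[OF m assms] by (simp only: lborel_prod sets_lborel space_borel Int_UNIV_right)
  have "emeasure (lborel \<Otimes>\<^sub>M lborel) ((\<lambda>(y, r). (y + c * r, r)) -` A) =
    (\<integral>\<^sup>+r. emeasure lborel ((\<lambda>y. (y, r)) -` ((\<lambda>(y, r). (y + c * r, r)) -` A)) \<partial>lborel)"
    by (rule lborel_pair.emeasure_pair_measure_alt2[OF B])
  also have "\<dots> = (\<integral>\<^sup>+r. emeasure lborel ((\<lambda>y. (y, r)) -` A) \<partial>lborel)"
  proof (intro nn_integral_cong)
    fix r :: real
    have [measurable]: "(\<lambda>y. (y, r)) -` A \<in> sets borel"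
      using measurable_sets[of "\<lambda>y. (y, r)" borel borel A] by simp
    have "emeasure lborel ((\<lambda>y. (y, r)) -` A) = emeasure (distr lborel borel ((+) (c * r))) ((\<lambda>y. (y, r)) -` A)"
      by (simp only: lborel_distr_plus)
    also have "\<dots> = emeasure lborel ((\<lambda>y. (y, r)) -` ((\<lambda>(y, r). (y + c * r, r)) -` A))"
      by (subst emeasure_distr) (auto intro!: arg_cong[where f = "emeasure lborel"] simp: algebra_simps)
    finally show "emeasure lborel ((\<lambda>y. (y, r)) -` ((\<lambda>(y, r). (y + c * r, r)) -` A)) = emeasure lborel ((\<lambda>y. (y, r)) -` A)" ..
  qed
  also have "\<dots> = emeasure (lborel \<Otimes>\<^sub>M lborel) A"
    by (rule lborel_pair.emeasure_pair_measure_alt2[OF A, symmetric])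
  finally show ?thesis by (simp only: lborel_prod)
qed

lemma measurable_shear [measurable]:
  "(\<lambda>p. (fst p + c * snd p, snd p)) \<in> borel \<rightarrow>\<^sub>M (borel :: (real \<times> real) measure)" for c :: real
  unfolding borel_prod[symmetric] by measurable

lemma distr_shear:
  fixes c :: real
  shows "distr lborel lborel (\<lambda>p. (fst p + c * snd p, snd p)) = (lborel :: (real \<times> real) measure)"
proof (rule measure_eqI)
  fix A :: "(real \<times> real) set"
  assume "A \<in> sets (distr lborel lborel (\<lambda>p. (fst p + c * snd p, snd p)))"
  then have A: "A \<in> sets borel" by simp
  show "emeasure (distr lborel lborel (\<lambda>p. (fst p + c * snd p, snd p))) A = emeasure lborel A"
    using emeasure_shear[OF A, of c] A
    by (subst emeasure_distr) (simp_all add: case_prod_unfold)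
qed simp

lemma AE_shear:
  fixes c :: real
  assumes "AE p in lborel. Q (fst p) (snd p)"
  shows "AE p in lborel. Q (fst p + c * snd p) (snd p :: real)"
proof -
  have "AE p in distr lborel lborel (\<lambda>p. (fst p + c * snd p, snd p)). Q (fst p) (snd p)"
    using assms by (simp only: distr_shear)
  from AE_distrD[OF _ this] show ?thesis by simp
qed

text \<open>\<open>Q\<close> may fail to be measurable, so the exceptional set is enclosed in a
  Borel null set \<open>N\<close> and Fubini is applied to \<open>N\<close>.\<close>

lemma AE_product_sections:
  assumes "AE p in (lborel :: (real \<times> real) measure). Q (fst p) (snd p)"
  shows "AE x in lborel. AE y in lborel. Q x y" "AE y in lborel. AE x in lborel. Q x y"
proof -
  obtain N where N: "{p. \<not> Q (fst p) (snd p)} \<subseteq> N" "N \<in> null_sets lborel"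
    using assms by (auto simp: eventually_ae_filter)
  have "AE p in lborel. p \<notin> N" using N(2) by (rule AE_not_in)
  then have *: "AE p in lborel \<Otimes>\<^sub>M lborel. (fst p, snd p) \<notin> N" by (simp only: lborel_prod prod.collapse)
  have "N \<in> sets (lborel \<Otimes>\<^sub>M lborel)" using N(2) by (simp only: lborel_prod null_setsD2)
  have 1: "AE x in lborel. AE y in lborel. (x, y) \<notin> N"
    using lborel_pair.AE_pair[OF *] by simp
  moreover have "AE y in lborel. AE x in lborel. (x, y) \<notin> N"
  proof (rule lborel_pair.AE_commute[THEN iffD1, OF _ 1])
    have "{p \<in> space (lborel \<Otimes>\<^sub>M lborel). (fst p, snd p) \<notin> N} = space (lborel \<Otimes>\<^sub>M lborel) - N"
      by auto
    also have "\<dots> \<in> sets (lborel \<Otimes>\<^sub>M lborel)" using \<open>N \<in> sets _\<close> by (intro sets.Diff sets.top)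
    finally show "{p \<in> space (lborel \<Otimes>\<^sub>M lborel). (fst p, snd p) \<notin> N} \<in> sets (lborel \<Otimes>\<^sub>M lborel)" .
  qed
  moreover have imp: "(x, y) \<notin> N \<Longrightarrow> Q x y" for x y using subsetD[OF N(1), of "(x, y)"] by auto
  ultimately show "AE x in lborel. AE y in lborel. Q x y" "AE y in lborel. AE x in lborel. Q x y"
    by - (erule eventually_mono, erule eventually_mono, rule imp, assumption)+
qed

text \<open>Rescaling the parameter by \<open>d\<close> reduces the direction \<open>(c, d)\<close>
  to \<open>(c / d, 1)\<close>, that is, to a shear. This is how a bound in the plane reaches the
  lines that \<open>deriv_along\<close> speaks of.\<close>

lemma AE_lines:
  fixes c d :: real
  assumes "AE p in lborel. Q (fst p) (snd p)" "d \<noteq> 0"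
  shows "AE y in lborel. AE r in lborel. Q (y + c * r) (d * r)"
proof -
  have "AE y in lborel. AE r in lborel. Q (y + c / d * r) r"
    using AE_product_sections(1)[OF AE_shear[OF assms(1), of "c / d"]] by simp
  then show ?thesis
  proof eventually_elim
    case (elim y)
    from AE_lborel_affine[OF elim, of d 0] show ?case using assms(2) by simp
  qed
qed

text \<open>The opposite passage to \<open>AE_lines\<close>: \<open>fst p + c * snd p\<close> labels
  the line through \<open>p\<close>. It serves with \<open>c = 0\<close> for conditions on the
  position alone and with \<open>c = - l\<close> for conditions on the characteristic of
  \<open>u\<close> through \<open>p\<close>.\<close>

lemma AE_line_plane:
  fixes c :: real
  assumes "AE y in lborel. Q y"
  shows "AE p in lborel. Q (fst p + c * snd p)"
proof -
  obtain N where N: "{x. \<not> Q x} \<subseteq> N" "N \<in> null_sets lborel"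
    using assms by (auto simp: eventually_ae_filter)
  have [measurable]: "N \<in> sets borel" using N(2) by auto
  have "AE x in lborel. x \<notin> N" using N(2) by (rule AE_not_in)
  moreover have "{p \<in> space (lborel \<Otimes>\<^sub>M (lborel :: real measure)). fst p \<notin> N} \<in> sets (lborel \<Otimes>\<^sub>M lborel)"
    by measurable
  ultimately have "AE p in lborel \<Otimes>\<^sub>M (lborel :: real measure). fst p \<notin> N"
    by (intro lborel_pair.AE_pair_measure) auto
  then have "AE p in (lborel :: (real \<times> real) measure). fst p \<notin> N" by (simp only: lborel_prod)
  then have "AE p in lborel. fst p + c * snd p \<notin> N" by (rule AE_shear)
  then show ?thesis by eventually_elim (use N(1) in auto)
qed

lemma nn_integral_shear:
  fixes c :: real and f :: "real \<Rightarrow> real \<Rightarrow> ennreal"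
  assumes [measurable]: "case_prod f \<in> borel_measurable borel"
  shows "(\<integral>\<^sup>+y. \<integral>\<^sup>+r. f (y + c * r) r \<partial>lborel \<partial>lborel) = (\<integral>\<^sup>+p. f (fst p) (snd p) \<partial>lborel)"
proof -
  have [measurable]: "(\<lambda>p. f (fst p) (snd p)) \<in> borel_measurable borel"
    using assms by (simp only: case_prod_unfold)
  have m: "(\<lambda>p. f (fst p + c * snd p) (snd p)) \<in> borel_measurable (lborel \<Otimes>\<^sub>M lborel)"
    using measurable_compose[OF measurable_shear[of c] assms]
    by (simp only: lborel_prod case_prod_unfold fst_conv snd_conv measurable_lborel2)
  have "(\<integral>\<^sup>+p. f (fst p) (snd p) \<partial>lborel) =
      (\<integral>\<^sup>+p. f (fst p) (snd p) \<partial>distr lborel lborel (\<lambda>p. (fst p + c * snd p, snd p)))"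
    by (simp only: distr_shear)
  also have "\<dots> = (\<integral>\<^sup>+p. f (fst p + c * snd p) (snd p) \<partial>lborel)"
    by (subst nn_integral_distr) auto
  also have "\<dots> = (\<integral>\<^sup>+p. f (fst p + c * snd p) (snd p) \<partial>(lborel \<Otimes>\<^sub>M lborel))"
    by (simp only: lborel_prod)
  also have "\<dots> = (\<integral>\<^sup>+y. \<integral>\<^sup>+r. f (y + c * r) r \<partial>lborel \<partial>lborel)"
    using lborel.nn_integral_fst[OF m] by simp
  finally show ?thesis ..
qed

lemma integral_shear:
  fixes c :: real and f :: "real \<Rightarrow> real \<Rightarrow> real"
  assumes f: "integrable lborel (case_prod f)"
  shows "integrable lborel (\<lambda>y. LINT r|lborel. f (y + c * r) r)"
    and "(LINT y|lborel. LINT r|lborel. f (y + c * r) r) = (LINT p|lborel. case_prod f p)"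
proof -
  have [measurable]: "case_prod f \<in> borel_measurable borel" using f by simp
  have f': "integrable (distr lborel lborel (\<lambda>p. (fst p + c * snd p, snd p))) (case_prod f)"
    using f by (simp only: distr_shear)
  have i: "integrable lborel (\<lambda>p. f (fst p + c * snd p) (snd p))"
    using f' by (subst (asm) integrable_distr_eq) auto
  then have i': "integrable (lborel \<Otimes>\<^sub>M lborel) (\<lambda>(y, r). f (y + c * r) r)"
    by (simp only: lborel_prod case_prod_unfold)
  have "(LINT p|lborel. case_prod f p) =
      (LINT p|distr lborel lborel (\<lambda>p. (fst p + c * snd p, snd p)). case_prod f p)"
    by (simp only: distr_shear)
  also have "\<dots> = (LINT p|lborel. f (fst p + c * snd p) (snd p))"
    by (subst integral_distr) auto
  also have "\<dots> = (LINT p|(lborel \<Otimes>\<^sub>M lborel). (\<lambda>(y, r). f (y + c * r) r) p)"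
    by (simp only: lborel_prod case_prod_unfold)
  finally show "(LINT y|lborel. LINT r|lborel. f (y + c * r) r) = (LINT p|lborel. case_prod f p)"
    using lborel_pair.integral_fst'[OF i'] by simp
  show "integrable lborel (\<lambda>y. LINT r|lborel. f (y + c * r) r)"
    using lborel_pair.integrable_fst'[OF i'] by simp
qed

section \<open>Differentiation along characteristics\<close>

lemma convex_line:
  fixes c d y :: real
  assumes "convex D" "(y + c * r, d * r) \<in> D" "(y + c * s, d * s) \<in> D" "\<sigma> \<in> {r..s}"
  shows "(y + c * \<sigma>, d * \<sigma>) \<in> D"
proof -
  have "(y + c * \<sigma>, d * \<sigma>) \<in> closed_segment (y + c * r, d * r) (y + c * s, d * s)"
  proof (cases "r = s")
    case False
    define u where "u = (\<sigma> - r) / (s - r)"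
    have s: "\<sigma> = r + u * (s - r)" using False by (simp add: u_def)
    have "0 \<le> u" "u \<le> 1" using assms(4) False by (auto simp: u_def divide_simps)
    then show ?thesis
      unfolding in_segment by (intro exI[of _ u]) (simp add: s algebra_simps)
  qed (use assms(4) in auto)
  then show ?thesis
    using convex_contains_segment[THEN iffD1, OF \<open>convex D\<close>] assms(2,3) by blast
qed

text \<open>Convexity keeps the segment between two points of \<open>D\<close> inside
  \<open>D\<close>, so the integrand is only ever evaluated where \<open>g\<close> and
  \<open>g'\<close> agree.\<close>

lemma deriv_along_cong:
  assumes D: "deriv_along c d D f g" and "convex D"
    and f: "\<And>x y. (x, y) \<in> D \<Longrightarrow> f x y = f' x y" and g: "\<And>x y. (x, y) \<in> D \<Longrightarrow> g x y = g' x y"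
  shows "deriv_along c d D f' g'"
  unfolding deriv_along_def
  using D[unfolded deriv_along_def]
proof eventually_elim
  case (elim y)
  show ?case
  proof (intro allI impI)
    fix r s :: real
    assume *: "r \<le> s \<and> (y + c * r, d * r) \<in> D \<and> (y + c * s, d * s) \<in> D"
    have in_D: "(y + c * \<sigma>, d * \<sigma>) \<in> D" if "\<sigma> \<in> {r..s}" for \<sigma>
      using convex_line[OF \<open>convex D\<close>] * that by blast
    have "set_integrable lborel {r..s} (\<lambda>\<sigma>. g' (y + c * \<sigma>) (d * \<sigma>)) \<longleftrightarrow>
          set_integrable lborel {r..s} (\<lambda>\<sigma>. g (y + c * \<sigma>) (d * \<sigma>))"
      by (rule set_integrable_cong) (auto simp: g in_D)
    moreover have "(LINT \<sigma>:{r..s}|lborel. g' (y + c * \<sigma>) (d * \<sigma>)) =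
          (LINT \<sigma>:{r..s}|lborel. g (y + c * \<sigma>) (d * \<sigma>))"
      by (rule set_lebesgue_integral_cong) (auto simp: g in_D)
    ultimately show "set_integrable lborel {r..s} (\<lambda>\<sigma>. g' (y + c * \<sigma>) (d * \<sigma>)) \<and>
        f' (y + c * s) (d * s) - f' (y + c * r) (d * r) =
        (LINT \<sigma>:{r..s}|lborel. g' (y + c * \<sigma>) (d * \<sigma>))"
      using elim * f by auto
  qed
qed

lemma deriv_along_subset:
  assumes "deriv_along c d D f g" "D' \<subseteq> D"
  shows "deriv_along c d D' f g"
  using assms(1) unfolding deriv_along_def by eventually_elim (use assms(2) in blast)

text \<open>The set where the bound fails is open and null inside the open interval, hence empty
  there, and closedness of \<open>S\<close> adds the end points, where the traces sit.
  \<open>r < s\<close> excludes a single point, about which a bound almost everywhere says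
  nothing.\<close>

lemma continuous_AE_bound:
  fixes \<phi> :: "real \<Rightarrow> real"
  assumes "continuous_on {r..s} \<phi>" "AE \<sigma> in lborel. \<sigma> \<in> {r..s} \<longrightarrow> \<bar>\<phi> \<sigma>\<bar> \<le> C" "r < s" "\<sigma> \<in> {r..s}"
  shows "\<bar>\<phi> \<sigma>\<bar> \<le> C"
proof -
  define S where "S = {r..s} \<inter> (\<lambda>\<sigma>. \<bar>\<phi> \<sigma>\<bar>) -` {..C}"
  have cl: "closed S" unfolding S_def
    by (intro continuous_closed_preimage continuous_intros assms closed_atMost closed_atLeastAtMost)
  have "AE \<sigma> in lborel. \<sigma> \<notin> {r<..<s} - S"
    using assms(2) by eventually_elim (auto simp: S_def)
  then have "AE \<sigma> in lebesgue. \<sigma> \<notin> {r<..<s} - S" by (rule AE_completion)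
  then have "negligible ({r<..<s} - S)"
    unfolding negligible_iff_null_sets
    by (subst AE_iff_null_sets) (auto intro!: sets.Diff sets_completionI_sets borel_closed cl)
  moreover have "open ({r<..<s} - S)" using cl by (intro open_Diff) auto
  ultimately have "{r<..<s} \<subseteq> S" using open_not_negligible by blast
  then have "closure {r<..<s} \<subseteq> S" using cl by (rule closure_minimal)
  then show ?thesis using assms(3,4) by (auto simp: S_def)
qed

lemma continuous_on_indefinite:
  fixes \<phi> \<psi> :: "real \<Rightarrow> real"
  assumes "set_integrable lborel {r..s} \<psi>"
    and "\<And>\<sigma>. \<sigma> \<in> {r..s} \<Longrightarrow> \<phi> \<sigma> - \<phi> r = (LINT \<tau>:{r..\<sigma>}|lborel. \<psi> \<tau>)"
  shows "continuous_on {r..s} \<phi>"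
proof -
  have "continuous_on {r..s} (\<lambda>\<sigma>. \<phi> r + integral {r..\<sigma>} \<psi>)"
    by (intro continuous_intros indefinite_integral_continuous_1 set_borel_integral_eq_integral assms)
  moreover have "\<phi> r + integral {r..\<sigma>} \<psi> = \<phi> \<sigma>" if "\<sigma> \<in> {r..s}" for \<sigma>
  proof -
    have "set_integrable lborel {r..\<sigma>} \<psi>"
      using set_integrable_subset[OF assms(1), of "{r..\<sigma>}"] that by auto
    then show ?thesis
      using assms(2)[OF that] set_borel_integral_eq_integral(2)[of "{r..\<sigma>}" \<psi>] by simp
  qed
  ultimately show ?thesis
    using continuous_on_cong[OF refl, of "{r..s}" "\<lambda>\<sigma>. \<phi> r + integral {r..\<sigma>} \<psi>" \<phi>] by blast
qed

text \<open>The bound passes to the traces because \<open>f\<close> is continuous along characteristics.\<close>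

lemma deriv_along_bound:
  assumes D: "deriv_along c d D f g" and "d \<noteq> 0" "R \<subseteq> D"
    and b: "AE p in lborel. p \<in> R \<longrightarrow> \<bar>f (fst p) (snd p)\<bar> \<le> C"
  shows "AE y in lborel. \<forall>r s. r < s \<and> (\<forall>\<sigma>\<in>{r..s}. (y + c * \<sigma>, d * \<sigma>) \<in> R) \<longrightarrow>
    (\<forall>\<sigma>\<in>{r..s}. \<bar>f (y + c * \<sigma>) (d * \<sigma>)\<bar> \<le> C)"
proof -
  have "AE p in lborel. (fst p, snd p) \<in> R \<longrightarrow> \<bar>f (fst p) (snd p)\<bar> \<le> C" using b by simp
  from AE_lines[OF this \<open>d \<noteq> 0\<close>, of c]
  have "AE y in lborel. AE r in lborel. (y + c * r, d * r) \<in> R \<longrightarrow> \<bar>f (y + c * r) (d * r)\<bar> \<le> C" .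
  then show ?thesis using D[unfolded deriv_along_def]
  proof eventually_elim
    case (elim y)
    show ?case
    proof (intro allI impI ballI)
      fix r s \<sigma>
      assume *: "r < s \<and> (\<forall>\<sigma>\<in>{r..s}. (y + c * \<sigma>, d * \<sigma>) \<in> R)" and \<sigma>: "\<sigma> \<in> {r..s}"
      have "continuous_on {r..s} (\<lambda>\<sigma>. f (y + c * \<sigma>) (d * \<sigma>))"
      proof (rule continuous_on_indefinite[where \<psi> = "\<lambda>\<sigma>. g (y + c * \<sigma>) (d * \<sigma>)"])
        have in_D: "(y + c * \<tau>, d * \<tau>) \<in> D" if "\<tau> \<in> {r..s}" for \<tau>
          using * \<open>R \<subseteq> D\<close> that by blast
        show "set_integrable lborel {r..s} (\<lambda>\<sigma>. g (y + c * \<sigma>) (d * \<sigma>))"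
          using elim(2)[rule_format, of r s] in_D[of r] in_D[of s] * by auto
        show "f (y + c * \<tau>) (d * \<tau>) - f (y + c * r) (d * r) = (LINT \<tau>:{r..\<tau>}|lborel. g (y + c * \<tau>) (d * \<tau>))"
          if "\<tau> \<in> {r..s}" for \<tau>
          using elim(2)[rule_format, of r \<tau>] in_D[of r] in_D[of \<tau>] * that by auto
      qed
      moreover have "AE \<sigma> in lborel. \<sigma> \<in> {r..s} \<longrightarrow> \<bar>f (y + c * \<sigma>) (d * \<sigma>)\<bar> \<le> C"
        using elim(1) by eventually_elim (use * in auto)
      ultimately show "\<bar>f (y + c * \<sigma>) (d * \<sigma>)\<bar> \<le> C"
        using continuous_AE_bound * \<sigma> by blast
    qed
  qed
qed

section \<open>Product rule along characteristics\<close>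

text \<open>Integration by parts as Fubini: the integral of
  \<open>\<psi>1 \<sigma> * \<psi>2 \<tau>\<close> over the plane is split along the diagonal into
  the parts \<open>A\<close> and \<open>B\<close>.\<close>

lemma indefinite_integral_product:
  fixes \<psi>1 \<psi>2 :: "real \<Rightarrow> real"
  assumes "integrable lborel \<psi>1" "integrable lborel \<psi>2"
  shows "(LINT \<sigma>|lborel. \<psi>1 \<sigma> * (LINT \<tau>:{..\<sigma>}|lborel. \<psi>2 \<tau>)) + (LINT \<tau>|lborel. (LINT \<sigma>:{..\<tau>}|lborel. \<psi>1 \<sigma>) * \<psi>2 \<tau>)
    = (LINT \<sigma>|lborel. \<psi>1 \<sigma>) * (LINT \<tau>|lborel. \<psi>2 \<tau>)"
proof -
  have [measurable]: "\<psi>1 \<in> borel_measurable borel" "\<psi>2 \<in> borel_measurable borel" using assms by auto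
  let ?P = "\<lambda>p. \<psi>1 (fst p) * \<psi>2 (snd p)"
  have P: "integrable (lborel \<Otimes>\<^sub>M lborel) ?P"
  proof (rule lborel_pair.Fubini_integrable)
    show "?P \<in> borel_measurable (lborel \<Otimes>\<^sub>M lborel)" by measurable
    show "integrable lborel (\<lambda>x. LINT y|lborel. norm (?P (x, y)))"
      using assms by (simp add: abs_mult)
    show "AE x in lborel. integrable lborel (\<lambda>y. ?P (x, y))" using assms by simp
  qed
  define A where "A = (\<lambda>p. indicator {p. snd p \<le> fst p} p * ?P p)"
  define B where "B = (\<lambda>p. indicator {p. fst p < snd p} p * ?P p)"
  have A: "integrable (lborel \<Otimes>\<^sub>M lborel) A" unfolding A_def
    by (rule Bochner_Integration.integrable_bound[OF P]) (auto simp: indicator_def, measurable)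
  have B: "integrable (lborel \<Otimes>\<^sub>M lborel) B" unfolding B_def
    by (rule Bochner_Integration.integrable_bound[OF P]) (auto simp: indicator_def, measurable)
  have "(LINT \<sigma>|lborel. \<psi>1 \<sigma>) * (LINT \<tau>|lborel. \<psi>2 \<tau>) = (LINT \<sigma>|lborel. LINT \<tau>|lborel. ?P (\<sigma>, \<tau>))"
    by simp
  also have "\<dots> = (LINT p|(lborel \<Otimes>\<^sub>M lborel). ?P p)" using lborel_pair.integral_fst'[OF P] by simp
  also have "\<dots> = (LINT p|(lborel \<Otimes>\<^sub>M lborel). A p + B p)"
    by (intro Bochner_Integration.integral_cong refl) (auto simp: A_def B_def indicator_def)
  also have "\<dots> = (LINT p|(lborel \<Otimes>\<^sub>M lborel). A p) + (LINT p|(lborel \<Otimes>\<^sub>M lborel). B p)"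
    using A B by simp
  also have "(LINT p|(lborel \<Otimes>\<^sub>M lborel). A p) = (LINT \<sigma>|lborel. \<psi>1 \<sigma> * (LINT \<tau>:{..\<sigma>}|lborel. \<psi>2 \<tau>))"
  proof -
    have "(LINT p|(lborel \<Otimes>\<^sub>M lborel). A p) = (LINT \<sigma>|lborel. LINT \<tau>|lborel. A (\<sigma>, \<tau>))"
      using lborel_pair.integral_fst'[OF A] by simp
    also have "\<dots> = (LINT \<sigma>|lborel. \<psi>1 \<sigma> * (LINT \<tau>:{..\<sigma>}|lborel. \<psi>2 \<tau>))"
      unfolding set_lebesgue_integral_def integral_mult_right_zero[symmetric]
      by (intro Bochner_Integration.integral_cong refl) (auto simp: A_def indicator_def)
    finally show ?thesis .
  qed
  also have "(LINT p|(lborel \<Otimes>\<^sub>M lborel). B p) = (LINT \<tau>|lborel. (LINT \<sigma>:{..\<tau>}|lborel. \<psi>1 \<sigma>) * \<psi>2 \<tau>)"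
  proof -
    have "(LINT p|(lborel \<Otimes>\<^sub>M lborel). B p) = (LINT \<tau>|lborel. LINT \<sigma>|lborel. B (\<sigma>, \<tau>))"
      using lborel_pair.integral_snd[of "\<lambda>\<sigma> \<tau>. B (\<sigma>, \<tau>)"] B by simp
    also have "\<dots> = (LINT \<tau>|lborel. (LINT \<sigma>:{..\<tau>}|lborel. \<psi>1 \<sigma>) * \<psi>2 \<tau>)"
      unfolding set_lebesgue_integral_def integral_mult_left_zero[symmetric]
    proof (rule Bochner_Integration.integral_cong[OF refl], rule integral_cong_AE)
      fix \<tau> :: real
      \<comment> \<open>The two sides can differ only at \<open>\<sigma> = \<tau>\<close>, since
        \<open>B\<close> is cut with a strict inequality and \<open>{..\<tau>}\<close> is
        closed.\<close>
      show "AE \<sigma> in lborel. B (\<sigma>, \<tau>) = indicator {..\<tau>} \<sigma> *\<^sub>R \<psi>1 \<sigma> * \<psi>2 \<tau>"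
        using AE_lborel_singleton[of \<tau>] by eventually_elim (auto simp: B_def indicator_def)
    qed (simp_all add: B_def)
    finally show ?thesis .
  qed
  finally show ?thesis ..
qed

lemma set_integrable_continuous_mult:
  fixes \<phi> \<psi> :: "real \<Rightarrow> real"
  assumes "set_integrable lborel {r..s} \<psi>" "continuous_on {r..s} \<phi>"
  shows "set_integrable lborel {r..s} (\<lambda>\<sigma>. \<psi> \<sigma> * \<phi> \<sigma>)"
proof -
  have "compact (\<phi> ` {r..s})" using assms by (intro compact_continuous_image) auto
  then obtain M where "\<forall>x\<in>\<phi> ` {r..s}. norm x \<le> M"
    using compact_imp_bounded bounded_iff by metis
  then have M: "\<bar>\<phi> \<sigma>\<bar> \<le> M" if "\<sigma> \<in> {r..s}" for \<sigma> using that by simp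
  have m: "(\<lambda>\<sigma>. indicator {r..s} \<sigma> * \<phi> \<sigma>) \<in> borel_measurable borel"
    using borel_measurable_continuous_on_indicator[OF _ assms(2)] by simp
  have "integrable lborel (\<lambda>\<sigma>. (indicator {r..s} \<sigma> * \<psi> \<sigma>) * (indicator {r..s} \<sigma> * \<phi> \<sigma>))"
  proof (rule Bochner_Integration.integrable_bound[where f = "\<lambda>\<sigma>. M * (indicator {r..s} \<sigma> * \<psi> \<sigma>)"])
    show "integrable lborel (\<lambda>\<sigma>. M * (indicator {r..s} \<sigma> * \<psi> \<sigma>))"
      using assms(1) by (simp add: set_integrable_def)
    show "(\<lambda>\<sigma>. (indicator {r..s} \<sigma> * \<psi> \<sigma>) * (indicator {r..s} \<sigma> * \<phi> \<sigma>)) \<in> borel_measurable lborel"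
      using borel_measurable_times[OF borel_measurable_integrable[OF assms(1)[unfolded set_integrable_def]] m[folded measurable_lborel2]]
      by simp
    show "AE \<sigma> in lborel. norm ((indicator {r..s} \<sigma> * \<psi> \<sigma>) * (indicator {r..s} \<sigma> * \<phi> \<sigma>))
        \<le> norm (M * (indicator {r..s} \<sigma> * \<psi> \<sigma>))"
    proof (rule AE_I2)
      fix \<sigma>
      show "norm ((indicator {r..s} \<sigma> * \<psi> \<sigma>) * (indicator {r..s} \<sigma> * \<phi> \<sigma>)) \<le> norm (M * (indicator {r..s} \<sigma> * \<psi> \<sigma>))"
        using M[of \<sigma>] mult_left_mono[of "\<bar>\<phi> \<sigma>\<bar>" "\<bar>M\<bar>" "\<bar>\<psi> \<sigma>\<bar>"]
        by (auto simp: indicator_def abs_mult mult.commute)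
    qed
  qed
  then show ?thesis
    unfolding set_integrable_def
    by (rule Bochner_Integration.integrable_cong[THEN iffD1, rotated 2]) (auto simp: indicator_def)
qed

text \<open>Integration by parts for the densities \<open>G1\<close>, \<open>G2\<close>, cut off
  outside \<open>{r..s}\<close> so that their integrals over \<open>{..\<sigma>}\<close> are the
  increments of \<open>f1\<close>, \<open>f2\<close> from \<open>r\<close>. The integral
  representations replace derivatives throughout.\<close>

lemma product_rule_indefinite:
  fixes f1 f2 g1 g2 :: "real \<Rightarrow> real"
  assumes "r \<le> s" "set_integrable lborel {r..s} g1" "set_integrable lborel {r..s} g2"
    and f1: "\<And>\<sigma>. \<sigma> \<in> {r..s} \<Longrightarrow> f1 \<sigma> - f1 r = (LINT \<tau>:{r..\<sigma>}|lborel. g1 \<tau>)"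
    and f2: "\<And>\<sigma>. \<sigma> \<in> {r..s} \<Longrightarrow> f2 \<sigma> - f2 r = (LINT \<tau>:{r..\<sigma>}|lborel. g2 \<tau>)"
  shows "set_integrable lborel {r..s} (\<lambda>\<sigma>. g1 \<sigma> * f2 \<sigma> + f1 \<sigma> * g2 \<sigma>)"
    and "f1 s * f2 s - f1 r * f2 r = (LINT \<sigma>:{r..s}|lborel. g1 \<sigma> * f2 \<sigma> + f1 \<sigma> * g2 \<sigma>)"
proof -
  have c: "continuous_on {r..s} f1" "continuous_on {r..s} f2"
    using continuous_on_indefinite[OF assms(2) f1] continuous_on_indefinite[OF assms(3) f2] by auto
  have i1: "set_integrable lborel {r..s} (\<lambda>\<sigma>. g1 \<sigma> * f2 \<sigma>)"
    by (rule set_integrable_continuous_mult[OF assms(2) c(2)])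
  have i2: "set_integrable lborel {r..s} (\<lambda>\<sigma>. f1 \<sigma> * g2 \<sigma>)"
    using set_integrable_continuous_mult[OF assms(3) c(1)] by (simp add: mult.commute)
  show "set_integrable lborel {r..s} (\<lambda>\<sigma>. g1 \<sigma> * f2 \<sigma> + f1 \<sigma> * g2 \<sigma>)"
    using set_integral_add(1)[OF i1 i2] .
  define G1 where "G1 = (\<lambda>\<sigma>. indicator {r..s} \<sigma> * g1 \<sigma>)"
  define G2 where "G2 = (\<lambda>\<sigma>. indicator {r..s} \<sigma> * g2 \<sigma>)"
  have G: "integrable lborel G1" "integrable lborel G2"
    using assms(2,3) by (simp_all add: set_integrable_def G1_def G2_def)
  have I1: "(LINT \<tau>:{..\<sigma>}|lborel. G1 \<tau>) = f1 \<sigma> - f1 r" if "\<sigma> \<in> {r..s}" for \<sigma>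
    unfolding f1[OF that] set_lebesgue_integral_def
    by (intro Bochner_Integration.integral_cong refl) (use that in \<open>auto simp: G1_def indicator_def\<close>)
  have I2: "(LINT \<tau>:{..\<sigma>}|lborel. G2 \<tau>) = f2 \<sigma> - f2 r" if "\<sigma> \<in> {r..s}" for \<sigma>
    unfolding f2[OF that] set_lebesgue_integral_def
    by (intro Bochner_Integration.integral_cong refl) (use that in \<open>auto simp: G2_def indicator_def\<close>)
  have T1: "(LINT \<sigma>|lborel. G1 \<sigma>) = f1 s - f1 r" "(LINT \<sigma>|lborel. G2 \<sigma>) = f2 s - f2 r"
    using f1[of s] f2[of s] \<open>r \<le> s\<close> by (simp_all add: G1_def G2_def set_lebesgue_integral_def)
  have e1: "(LINT \<sigma>|lborel. G1 \<sigma> * (LINT \<tau>:{..\<sigma>}|lborel. G2 \<tau>)) = (LINT \<sigma>:{r..s}|lborel. g1 \<sigma> * f2 \<sigma> - f2 r * g1 \<sigma>)"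
    unfolding set_lebesgue_integral_def[of _ "{r..s}"]
    by (intro Bochner_Integration.integral_cong refl)
      (auto simp: G1_def I2 indicator_def algebra_simps)
  have e2: "(LINT \<tau>|lborel. (LINT \<sigma>:{..\<tau>}|lborel. G1 \<sigma>) * G2 \<tau>) = (LINT \<sigma>:{r..s}|lborel. f1 \<sigma> * g2 \<sigma> - f1 r * g2 \<sigma>)"
    unfolding set_lebesgue_integral_def[of _ "{r..s}"]
    by (intro Bochner_Integration.integral_cong refl)
      (auto simp: G2_def I1 indicator_def algebra_simps)
  have e1': "(LINT \<sigma>:{r..s}|lborel. g1 \<sigma> * f2 \<sigma> - f2 r * g1 \<sigma>) =
      (LINT \<sigma>:{r..s}|lborel. g1 \<sigma> * f2 \<sigma>) - f2 r * (f1 s - f1 r)"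
    using f1[of s] \<open>r \<le> s\<close> assms(2) i1 by (subst set_integral_diff) auto
  have e2': "(LINT \<sigma>:{r..s}|lborel. f1 \<sigma> * g2 \<sigma> - f1 r * g2 \<sigma>) =
      (LINT \<sigma>:{r..s}|lborel. f1 \<sigma> * g2 \<sigma>) - f1 r * (f2 s - f2 r)"
    using f2[of s] \<open>r \<le> s\<close> assms(3) i2 by (subst set_integral_diff) auto
  have "(LINT \<sigma>:{r..s}|lborel. g1 \<sigma> * f2 \<sigma> + f1 \<sigma> * g2 \<sigma>) =
      (LINT \<sigma>:{r..s}|lborel. g1 \<sigma> * f2 \<sigma>) + (LINT \<sigma>:{r..s}|lborel. f1 \<sigma> * g2 \<sigma>)"
    using i1 i2 by (rule set_integral_add)
  with indefinite_integral_product[OF G, unfolded e1 e2 e1' e2' T1]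
  show "f1 s * f2 s - f1 r * f2 r = (LINT \<sigma>:{r..s}|lborel. g1 \<sigma> * f2 \<sigma> + f1 \<sigma> * g2 \<sigma>)"
    by (simp add: algebra_simps)
qed

lemma deriv_along_mult:
  assumes "deriv_along c d D f1 g1" "deriv_along c d D f2 g2" "convex D"
  shows "deriv_along c d D (\<lambda>x y. f1 x y * f2 x y) (\<lambda>x y. g1 x y * f2 x y + f1 x y * g2 x y)"
  unfolding deriv_along_def
  using assms(1,2)[unfolded deriv_along_def]
proof eventually_elim
  case (elim y)
  show ?case
  proof (intro allI impI)
    fix r s
    assume *: "r \<le> s \<and> (y + c * r, d * r) \<in> D \<and> (y + c * s, d * s) \<in> D"
    have in_D: "(y + c * \<sigma>, d * \<sigma>) \<in> D" if "\<sigma> \<in> {r..s}" for \<sigma>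
      using convex_line[OF \<open>convex D\<close>] * that by blast
    show "set_integrable lborel {r..s}
          (\<lambda>\<sigma>. g1 (y + c * \<sigma>) (d * \<sigma>) * f2 (y + c * \<sigma>) (d * \<sigma>) + f1 (y + c * \<sigma>) (d * \<sigma>) * g2 (y + c * \<sigma>) (d * \<sigma>)) \<and>
         f1 (y + c * s) (d * s) * f2 (y + c * s) (d * s) - f1 (y + c * r) (d * r) * f2 (y + c * r) (d * r) =
         (LINT \<sigma>:{r..s}|lborel. g1 (y + c * \<sigma>) (d * \<sigma>) * f2 (y + c * \<sigma>) (d * \<sigma>) +
           f1 (y + c * \<sigma>) (d * \<sigma>) * g2 (y + c * \<sigma>) (d * \<sigma>))"
      using product_rule_indefinite[of r s "\<lambda>\<sigma>. g1 (y + c * \<sigma>) (d * \<sigma>)" "\<lambda>\<sigma>. g2 (y + c * \<sigma>) (d * \<sigma>)"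
          "\<lambda>\<sigma>. f1 (y + c * \<sigma>) (d * \<sigma>)" "\<lambda>\<sigma>. f2 (y + c * \<sigma>) (d * \<sigma>)"] elim * in_D by auto
  qed
qed

section \<open>The divergence theorem for one direction\<close>

lemma set_integral_affine:
  fixes f :: "real \<Rightarrow> real" and k t :: real
  assumes "k \<noteq> 0"
  shows "(LINT y:S|lborel. f y) = \<bar>k\<bar> * (LINT s:((\<lambda>s. t + k * s) -` S)|lborel. f (t + k * s))"
    and "set_integrable lborel S f \<longleftrightarrow> set_integrable lborel ((\<lambda>s. t + k * s) -` S) (\<lambda>s. f (t + k * s))"
proof -
  have i: "indicator ((\<lambda>s. t + k * s) -` S) s = (indicator S (t + k * s) :: real)" for s
    by (auto simp: indicator_def)
  show "(LINT y:S|lborel. f y) = \<bar>k\<bar> * (LINT s:((\<lambda>s. t + k * s) -` S)|lborel. f (t + k * s))"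
    unfolding set_lebesgue_integral_def i
    by (subst lborel_integral_real_affine[OF assms, of _ t]) simp
  show "set_integrable lborel S f \<longleftrightarrow> set_integrable lborel ((\<lambda>s. t + k * s) -` S) (\<lambda>s. f (t + k * s))"
    unfolding set_integrable_def i
    using lborel_integrable_real_affine_iff[OF assms, of "\<lambda>y. indicator S y *\<^sub>R f y" t] by simp
qed

lemma set_integral_split:
  fixes f :: "real \<Rightarrow> real"
  assumes "set_integrable lborel {a..b} f" "a \<le> m" "m \<le> b"
  shows "(LINT y:{a..b}|lborel. f y) = (LINT y:{a..m}|lborel. f y) + (LINT y:{m..b}|lborel. f y)"
proof -
  have "set_integrable lborel {a..m} f" "set_integrable lborel {m..b} f"
    using assms set_integrable_subset[OF assms(1)] by auto
  then show ?thesis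
    using assms Henstock_Kurzweil_Integration.integral_combine[of a m b f]
      set_borel_integral_eq_integral[of _ f] by auto
qed

lemma set_integrable_AE_bounded:
  fixes f :: "'a::euclidean_space \<Rightarrow> real"
  assumes [measurable]: "f \<in> borel_measurable borel" "S \<in> sets borel"
    and "bounded S" "AE x in lborel. x \<in> S \<longrightarrow> \<bar>f x\<bar> \<le> C"
  shows "set_integrable lborel S f"
  unfolding set_integrable_def
proof (rule Bochner_Integration.integrable_bound[where f = "\<lambda>x. C * indicator S x"])
  have "emeasure lborel S < \<infinity>" using \<open>bounded S\<close> by (rule emeasure_bounded_finite)
  then show "integrable lborel (\<lambda>x. C * indicator S x)"
    by (intro integrable_mult_right) (auto intro!: integrable_real_indicator)
  show "AE x in lborel. norm (indicator S x *\<^sub>R f x) \<le> norm (C * indicator S x)"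
    using assms(4) by eventually_elim (auto simp: indicator_def)
qed simp

text \<open>In the coordinates \<open>(y, s)\<close> of the point \<open>(y + c * s, s)\<close> the
  region consists of segments \<open>\<alpha> y \<le> s \<le> \<omega> y\<close> of characteristics.
  Integrating the increments of \<open>h\<close> over \<open>y\<close> gives the boundary terms,
  with the intercept as boundary parameter, and the shear turns the double integral of
  \<open>G\<close> into one over \<open>D\<close>. The strict inequality
  \<open>\<alpha> y < \<omega> y\<close> lets \<open>deriv_along_bound\<close> control the boundary
  values, whence their integrability.\<close>

lemma divergence_along:
  fixes c a b C C' :: real and h G :: "real \<Rightarrow> real \<Rightarrow> real"
  assumes D: "deriv_along c 1 D h G"
    and h [measurable]: "(\<lambda>p. h (fst p) (snd p)) \<in> borel_measurable borel"
    and G [measurable]: "(\<lambda>p. G (fst p) (snd p)) \<in> borel_measurable borel"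
    and Dm [measurable]: "D \<in> sets borel" and "bounded D"
    and bh: "AE p in lborel. p \<in> D \<longrightarrow> \<bar>h (fst p) (snd p)\<bar> \<le> C"
    and bG: "AE p in lborel. p \<in> D \<longrightarrow> \<bar>G (fst p) (snd p)\<bar> \<le> C'"
    and \<alpha>\<omega>': "\<forall>y\<in>{a<..<b}. \<alpha> y < \<omega> y"
    and D_eq': "\<forall>y\<in>{a<..<b}. \<forall>s. (y + c * s, s) \<in> D \<longleftrightarrow> \<alpha> y \<le> s \<and> s \<le> \<omega> y"
    and D_out': "\<forall>y s. (y + c * s, s) \<in> D \<longrightarrow> y \<in> {a..b}"
    and [measurable]: "\<alpha> \<in> borel_measurable borel" "\<omega> \<in> borel_measurable borel"
  shows "set_integrable lborel {a..b} (\<lambda>y. h (y + c * \<alpha> y) (\<alpha> y))"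
    and "set_integrable lborel {a..b} (\<lambda>y. h (y + c * \<omega> y) (\<omega> y))"
    and "set_integrable lborel D (\<lambda>p. G (fst p) (snd p))"
    and "(LINT y:{a..b}|lborel. h (y + c * \<omega> y) (\<omega> y)) - (LINT y:{a..b}|lborel. h (y + c * \<alpha> y) (\<alpha> y)) =
      (LINT p:D|lborel. G (fst p) (snd p))"
proof -
  have \<alpha>\<omega>: "\<alpha> y < \<omega> y" and D_eq: "\<And>s. (y + c * s, s) \<in> D \<longleftrightarrow> \<alpha> y \<le> s \<and> s \<le> \<omega> y"
    if "a < y" "y < b" for y
    using \<alpha>\<omega>' D_eq' that by auto
  have D_out: "(y + c * s, s) \<in> D \<Longrightarrow> a \<le> y \<and> y \<le> b" for y s
    using D_out' by auto
  have ends: "AE y in lborel. y \<noteq> a \<and> y \<noteq> b"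
    using AE_lborel_singleton[of a] AE_lborel_singleton[of b] by eventually_elim simp
  have "AE y in lborel. \<forall>r s. r < s \<and> (\<forall>\<sigma>\<in>{r..s}. (y + c * \<sigma>, 1 * \<sigma>) \<in> D) \<longrightarrow>
      (\<forall>\<sigma>\<in>{r..s}. \<bar>h (y + c * \<sigma>) (1 * \<sigma>)\<bar> \<le> C)"
    using deriv_along_bound[OF D _ order_refl bh] by simp
  with ends have bd: "AE y in lborel. y \<in> {a..b} \<longrightarrow>
      \<bar>h (y + c * \<alpha> y) (\<alpha> y)\<bar> \<le> C \<and> \<bar>h (y + c * \<omega> y) (\<omega> y)\<bar> \<le> C"
  proof eventually_elim
    case (elim y)
    show ?case
    proof
      assume y: "y \<in> {a..b}"
      with elim(1) have y': "a < y" "y < b" by auto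
      have "\<forall>\<sigma>\<in>{\<alpha> y..\<omega> y}. \<bar>h (y + c * \<sigma>) (1 * \<sigma>)\<bar> \<le> C"
        using elim(2)[rule_format, of "\<alpha> y" "\<omega> y"] \<alpha>\<omega>[OF y'] D_eq[OF y'] by auto
      then show "\<bar>h (y + c * \<alpha> y) (\<alpha> y)\<bar> \<le> C \<and> \<bar>h (y + c * \<omega> y) (\<omega> y)\<bar> \<le> C"
        using \<alpha>\<omega>[OF y'] by auto
    qed
  qed
  have trace: "(\<lambda>y. h (y + c * \<beta> y) (\<beta> y)) \<in> borel_measurable borel"
    if [measurable]: "\<beta> \<in> borel_measurable borel" for \<beta> :: "real \<Rightarrow> real"
  proof -
    have "(\<lambda>y. (y + c * \<beta> y, \<beta> y)) \<in> borel \<rightarrow>\<^sub>M (borel :: (real \<times> real) measure)"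
      unfolding borel_prod[symmetric] by measurable
    from measurable_compose[OF this h] show ?thesis by simp
  qed
  show i\<alpha>: "set_integrable lborel {a..b} (\<lambda>y. h (y + c * \<alpha> y) (\<alpha> y))"
    by (rule set_integrable_AE_bounded[where C = C]) (use bd in \<open>auto intro!: trace elim!: eventually_mono\<close>)
  show i\<omega>: "set_integrable lborel {a..b} (\<lambda>y. h (y + c * \<omega> y) (\<omega> y))"
    by (rule set_integrable_AE_bounded[where C = C]) (use bd in \<open>auto intro!: trace elim!: eventually_mono\<close>)
  show iG: "set_integrable lborel D (\<lambda>p. G (fst p) (snd p))"
    by (rule set_integrable_AE_bounded[where C = C']) (use bG \<open>bounded D\<close> in auto)
  define F where "F = (\<lambda>x t. indicator D (x, t) * G x t)"
  have F: "integrable lborel (case_prod F)"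
    using iG by (simp add: set_integrable_def F_def case_prod_unfold)
  have line: "AE y in lborel. (LINT r|lborel. F (y + c * r) r) =
      indicator {a..b} y * (h (y + c * \<omega> y) (\<omega> y) - h (y + c * \<alpha> y) (\<alpha> y))"
    using ends D[unfolded deriv_along_def]
  proof eventually_elim
    case (elim y)
    show ?case
    proof (cases "y \<in> {a..b}")
      case True
      with elim(1) have y: "a < y" "y < b" by auto
      have "(LINT r|lborel. F (y + c * r) r) = (LINT r:{\<alpha> y..\<omega> y}|lborel. G (y + c * r) r)"
        unfolding set_lebesgue_integral_def
        by (intro Bochner_Integration.integral_cong refl) (auto simp: F_def indicator_def D_eq[OF y])
      then show ?thesis
        using elim(2)[rule_format, of "\<alpha> y" "\<omega> y"] \<alpha>\<omega>[OF y] D_eq[OF y] True by auto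
    next
      case False
      have "F (y + c * r) r = 0" for r
        using False D_out[of y r] by (auto simp: F_def indicator_def)
      with False show ?thesis by simp
    qed
  qed
  have "(LINT p:D|lborel. G (fst p) (snd p)) = (LINT p|lborel. case_prod F p)"
    by (simp add: set_lebesgue_integral_def F_def case_prod_unfold)
  also have "\<dots> = (LINT y|lborel. LINT r|lborel. F (y + c * r) r)"
    using integral_shear(2)[OF F] by simp
  also have "\<dots> = (LINT y|lborel. indicator {a..b} y * (h (y + c * \<omega> y) (\<omega> y) - h (y + c * \<alpha> y) (\<alpha> y)))"
    by (rule integral_cong_AE[OF _ _ line])
      (use integral_shear(1)[OF F] trace in \<open>auto intro!: borel_measurable_times borel_measurable_diff\<close>)
  also have "\<dots> = (LINT y:{a..b}|lborel. h (y + c * \<omega> y) (\<omega> y) - h (y + c * \<alpha> y) (\<alpha> y))"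
    by (simp add: set_lebesgue_integral_def)
  also have "\<dots> = (LINT y:{a..b}|lborel. h (y + c * \<omega> y) (\<omega> y)) - (LINT y:{a..b}|lborel. h (y + c * \<alpha> y) (\<alpha> y))"
    by (rule set_integral_diff(2)[OF i\<omega> i\<alpha>])
  finally show "(LINT y:{a..b}|lborel. h (y + c * \<omega> y) (\<omega> y)) - (LINT y:{a..b}|lborel. h (y + c * \<alpha> y) (\<alpha> y)) =
      (LINT p:D|lborel. G (fst p) (snd p))" ..
qed

text \<open>The set swept out by the interval \<open>[0, x0 + l * s]\<close>, the range of the
  backstepping integral, while its right end moves with speed \<open>l\<close>.\<close>

definition trapezoid :: "real \<Rightarrow> real \<Rightarrow> real \<Rightarrow> real \<Rightarrow> (real \<times> real) set" where
  "trapezoid x0 l s1 s2 = {(\<xi>, s). s1 \<le> s \<and> s \<le> s2 \<and> 0 \<le> \<xi> \<and> \<xi> \<le> x0 + l * s}"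

lemma trapezoid_props:
  shows "trapezoid x0 l s1 s2 \<in> sets borel" "convex (trapezoid x0 l s1 s2)"
    and "bounded (trapezoid x0 l s1 s2)"
proof -
  have eq: "trapezoid x0 l s1 s2 = {p. s1 \<le> snd p} \<inter> {p. snd p \<le> s2} \<inter> {p. 0 \<le> fst p} \<inter> {p. fst p \<le> x0 + l * snd p}"
    by (auto simp: trapezoid_def)
  have "closed (trapezoid x0 l s1 s2)"
    unfolding eq by (intro closed_Int closed_Collect_le continuous_intros)
  then show "trapezoid x0 l s1 s2 \<in> sets borel" by simp
  show "convex (trapezoid x0 l s1 s2)"
  proof (rule convexI)
    fix p q :: "real \<times> real" and u v :: real
    assume "p \<in> trapezoid x0 l s1 s2" "q \<in> trapezoid x0 l s1 s2" and uv: "0 \<le> u" "0 \<le> v" "u + v = 1"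
    then have p: "s1 \<le> snd p" "snd p \<le> s2" "0 \<le> fst p" "fst p \<le> x0 + l * snd p"
      and q: "s1 \<le> snd q" "snd q \<le> s2" "0 \<le> fst q" "fst q \<le> x0 + l * snd q"
      by (auto simp: trapezoid_def)
    have v: "v = 1 - u" using uv by simp
    have "s1 = u * s1 + v * s1" "s2 = u * s2 + v * s2" by (simp_all add: v algebra_simps)
    moreover have "u * s1 + v * s1 \<le> u * snd p + v * snd q" "u * snd p + v * snd q \<le> u * s2 + v * s2"
      "0 \<le> u * fst p + v * fst q"
      using p q uv by (auto intro!: add_mono mult_left_mono add_nonneg_nonneg mult_nonneg_nonneg)
    moreover have "u * fst p + v * fst q \<le> u * (x0 + l * snd p) + v * (x0 + l * snd q)"
      using p q uv by (intro add_mono mult_left_mono)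
    moreover have "u * (x0 + l * snd p) + v * (x0 + l * snd q) = x0 + l * (u * snd p + v * snd q)"
      by (simp add: v algebra_simps)
    ultimately show "u *\<^sub>R p + v *\<^sub>R q \<in> trapezoid x0 l s1 s2"
      unfolding trapezoid_def by (auto simp: case_prod_unfold)
  qed
  have "l * s \<le> \<bar>l\<bar> * (\<bar>s1\<bar> + \<bar>s2\<bar>)" if "s1 \<le> s" "s \<le> s2" for s
  proof -
    have "l * s \<le> \<bar>l * s\<bar>" by simp
    also have "\<dots> \<le> \<bar>l\<bar> * (\<bar>s1\<bar> + \<bar>s2\<bar>)" unfolding abs_mult using that by (intro mult_left_mono) auto
    finally show ?thesis .
  qed
  then have "trapezoid x0 l s1 s2 \<subseteq> cbox (0, s1) (x0 + \<bar>l\<bar> * (\<bar>s1\<bar> + \<bar>s2\<bar>), s2)"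
    by (force simp: trapezoid_def cbox_Pair_eq)
  then show "bounded (trapezoid x0 l s1 s2)" using bounded_cbox bounded_subset by blast
qed

lemma set_integral_affine_interval:
  fixes f g :: "real \<Rightarrow> real" and k t :: real
  assumes "k \<noteq> 0" "\<And>s. t + k * s \<in> {p..q} \<longleftrightarrow> s \<in> {p'..q'}"
    and "\<forall>s\<in>{p'..q'}. f (t + k * s) = g s"
  shows "(LINT y:{p..q}|lborel. f y) = \<bar>k\<bar> * (LINT s:{p'..q'}|lborel. g s)"
    and "set_integrable lborel {p..q} f \<longleftrightarrow> set_integrable lborel {p'..q'} g"
proof -
  have v: "(\<lambda>s. t + k * s) -` {p..q} = {p'..q'}" using assms(2) by auto
  have "(LINT s:{p'..q'}|lborel. f (t + k * s)) = (LINT s:{p'..q'}|lborel. g s)"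
    using assms(3) by (intro set_lebesgue_integral_cong) auto
  then show "(LINT y:{p..q}|lborel. f y) = \<bar>k\<bar> * (LINT s:{p'..q'}|lborel. g s)"
    using set_integral_affine(1)[OF assms(1), of "{p..q}" f t] v by simp
  have "set_integrable lborel {p'..q'} (\<lambda>s. f (t + k * s)) \<longleftrightarrow> set_integrable lborel {p'..q'} g"
    using assms(3) by (intro set_integrable_cong) auto
  then show "set_integrable lborel {p..q} f \<longleftrightarrow> set_integrable lborel {p'..q'} g"
    using set_integral_affine(2)[OF assms(1), of "{p..q}" f t] v by simp
qed

text \<open>A line of speed \<open>c > 0\<close> enters through the bottom or through
  \<open>\<xi> = 0\<close> and leaves through the top or the slanted side. The intercept is
  \<open>- c * s\<close> on \<open>\<xi> = 0\<close> and \<open>x0 + (l - c) * s\<close> on the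
  slanted side, which explains the factors \<open>c\<close> and \<open>c - l\<close>.\<close>

lemma divergence_trapezoid_right:
  fixes c l x0 s1 s2 C C' :: real and h G :: "real \<Rightarrow> real \<Rightarrow> real"
  assumes cl: "0 < c" "l < 0" and s: "s1 < s2" "0 \<le> x0 + l * s2"
    and D: "deriv_along c 1 (trapezoid x0 l s1 s2) h G"
    and h: "(\<lambda>p. h (fst p) (snd p)) \<in> borel_measurable borel"
    and G: "(\<lambda>p. G (fst p) (snd p)) \<in> borel_measurable borel"
    and bh: "AE p in lborel. p \<in> trapezoid x0 l s1 s2 \<longrightarrow> \<bar>h (fst p) (snd p)\<bar> \<le> C"
    and bG: "AE p in lborel. p \<in> trapezoid x0 l s1 s2 \<longrightarrow> \<bar>G (fst p) (snd p)\<bar> \<le> C'"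
  shows "set_integrable lborel {0..x0 + l * s1} (\<lambda>\<xi>. h \<xi> s1)" "set_integrable lborel {0..x0 + l * s2} (\<lambda>\<xi>. h \<xi> s2)"
    and "set_integrable lborel {s1..s2} (\<lambda>s. h 0 s)" "set_integrable lborel {s1..s2} (\<lambda>s. h (x0 + l * s) s)"
    and "set_integrable lborel (trapezoid x0 l s1 s2) (\<lambda>p. G (fst p) (snd p))"
    and "(LINT \<xi>:{0..x0 + l * s2}|lborel. h \<xi> s2) - (LINT \<xi>:{0..x0 + l * s1}|lborel. h \<xi> s1) =
      (LINT p:trapezoid x0 l s1 s2|lborel. G (fst p) (snd p)) + c * (LINT s:{s1..s2}|lborel. h 0 s)
      - (c - l) * (LINT s:{s1..s2}|lborel. h (x0 + l * s) s)"
proof -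
  define \<alpha> where "\<alpha> = (\<lambda>y. max s1 (- y / c))"
  define \<omega> where "\<omega> = (\<lambda>y. min s2 ((x0 - y) / (c - l)))"
  define a where "a = - c * s2"
  define b where "b = x0 + (l - c) * s1"
  have ls: "l * s2 \<le> l * s" if "s \<le> s2" for s using that cl by simp
  have iff_\<alpha>: "- y / c \<le> s \<longleftrightarrow> 0 \<le> y + c * s" for y s using cl by (auto simp: field_simps)
  have iff_\<omega>: "s \<le> (x0 - y) / (c - l) \<longleftrightarrow> y + c * s \<le> x0 + l * s" for y s
    using cl by (auto simp: pos_le_divide_eq algebra_simps)
  have 1: "\<alpha> y < \<omega> y" if y: "a < y" "y < b" for y
  proof -
    have "- y / c < s2" using y cl by (auto simp: a_def field_simps)
    moreover have "s1 < (x0 - y) / (c - l)" using y cl by (auto simp: b_def pos_less_divide_eq algebra_simps)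
    \<comment> \<open>The line meets \<open>\<xi> = 0\<close> before the slanted side. Here
      \<open>0 \<le> x0 + l * s2\<close> enters: these two sides do not cross before time
      \<open>s2\<close>.\<close>
    moreover have "- y / c < (x0 - y) / (c - l)"
    proof -
      have "l * y < l * (- c * s2)" using y cl mult_strict_left_mono_neg[of "- c * s2" y l] by (simp add: a_def)
      also have "\<dots> \<le> c * x0" using s cl mult_left_mono[of 0 "x0 + l * s2" c] by (simp add: algebra_simps)
      finally have "(- y) * (c - l) < (x0 - y) * c" by (simp add: algebra_simps)
      then show ?thesis using cl by (simp add: divide_simps)
    qed
    ultimately show ?thesis using s by (simp add: \<alpha>_def \<omega>_def)
  qed
  have 2: "(y + c * s, s) \<in> trapezoid x0 l s1 s2 \<longleftrightarrow> \<alpha> y \<le> s \<and> s \<le> \<omega> y" for y s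
    using iff_\<alpha>[of y s] iff_\<omega>[of s y] by (auto simp: trapezoid_def \<alpha>_def \<omega>_def)
  have 3: "a \<le> y \<and> y \<le> b" if "(y + c * s, s) \<in> trapezoid x0 l s1 s2" for y s
  proof -
    from that have "s1 \<le> s" "s \<le> s2" "0 \<le> y + c * s" "y + c * s \<le> x0 + l * s" by (auto simp: trapezoid_def)
    moreover from this have "c * s \<le> c * s2" "(l - c) * s \<le> (l - c) * s1" using cl by auto
    ultimately show ?thesis by (simp add: a_def b_def algebra_simps)
  qed
  have m: "\<alpha> \<in> borel_measurable borel" "\<omega> \<in> borel_measurable borel"
    unfolding \<alpha>_def \<omega>_def by measurable
  have b1: "\<forall>y\<in>{a<..<b}. \<alpha> y < \<omega> y"
    and b2: "\<forall>y\<in>{a<..<b}. \<forall>s. (y + c * s, s) \<in> trapezoid x0 l s1 s2 \<longleftrightarrow> \<alpha> y \<le> s \<and> s \<le> \<omega> y"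
    and b3: "\<forall>y s. (y + c * s, s) \<in> trapezoid x0 l s1 s2 \<longrightarrow> y \<in> {a..b}"
    using 1 2 3 by auto
  note div = divergence_along[OF D h G trapezoid_props(1,3) bh bG b1 b2 b3 m]
  show iG: "set_integrable lborel (trapezoid x0 l s1 s2) (\<lambda>p. G (fst p) (snd p))" by (rule div(3))
  have c2: "c * s1 < c * s2" using cl s by simp
  have l2: "(l - c) * s2 < (l - c) * s1" using cl s by simp
  \<comment> \<open>The two inner values are the intercepts of the corners \<open>(0, s1)\<close>
    and \<open>(x0 + l * s2, s2)\<close>. At the first the entry side changes from left to bottom,
    at the second the exit side from top to slanted.\<close>
  have o: "a \<le> - c * s1" "- c * s1 \<le> b" "a \<le> x0 + (l - c) * s2" "x0 + (l - c) * s2 \<le> b"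
    using c2 l2 s ls[of s1] by (auto simp: a_def b_def algebra_simps)
  have left: "0 + - c * s \<in> {a..- c * s1} \<longleftrightarrow> s \<in> {s1..s2}"
    "s \<in> {s1..s2} \<Longrightarrow> h (0 + - c * s + c * \<alpha> (0 + - c * s)) (\<alpha> (0 + - c * s)) = h 0 s" for s
    using cl by (auto simp: a_def \<alpha>_def max_def)
  have bottom: "- c * s1 + 1 * \<xi> \<in> {- c * s1..b} \<longleftrightarrow> \<xi> \<in> {0..x0 + l * s1}"
    "\<xi> \<in> {0..x0 + l * s1} \<Longrightarrow>
      h (- c * s1 + 1 * \<xi> + c * \<alpha> (- c * s1 + 1 * \<xi>)) (\<alpha> (- c * s1 + 1 * \<xi>)) = h \<xi> s1" for \<xi>
  proof -
    show "- c * s1 + 1 * \<xi> \<in> {- c * s1..b} \<longleftrightarrow> \<xi> \<in> {0..x0 + l * s1}"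
      by (auto simp: b_def algebra_simps)
    assume "\<xi> \<in> {0..x0 + l * s1}"
    then have "- (- c * s1 + 1 * \<xi>) / c \<le> s1" by (subst iff_\<alpha>) simp
    then have "\<alpha> (- c * s1 + 1 * \<xi>) = s1" unfolding \<alpha>_def by (rule max_absorb1)
    then show "h (- c * s1 + 1 * \<xi> + c * \<alpha> (- c * s1 + 1 * \<xi>)) (\<alpha> (- c * s1 + 1 * \<xi>)) = h \<xi> s1" by simp
  qed
  have top: "- c * s2 + 1 * \<xi> \<in> {a..x0 + (l - c) * s2} \<longleftrightarrow> \<xi> \<in> {0..x0 + l * s2}"
    "\<xi> \<in> {0..x0 + l * s2} \<Longrightarrow>
      h (- c * s2 + 1 * \<xi> + c * \<omega> (- c * s2 + 1 * \<xi>)) (\<omega> (- c * s2 + 1 * \<xi>)) = h \<xi> s2" for \<xi>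
  proof -
    show "- c * s2 + 1 * \<xi> \<in> {a..x0 + (l - c) * s2} \<longleftrightarrow> \<xi> \<in> {0..x0 + l * s2}"
      by (auto simp: a_def algebra_simps)
    assume "\<xi> \<in> {0..x0 + l * s2}"
    then have "s2 \<le> (x0 - (- c * s2 + 1 * \<xi>)) / (c - l)" by (subst iff_\<omega>) simp
    then have "\<omega> (- c * s2 + 1 * \<xi>) = s2" by (simp add: \<omega>_def)
    then show "h (- c * s2 + 1 * \<xi> + c * \<omega> (- c * s2 + 1 * \<xi>)) (\<omega> (- c * s2 + 1 * \<xi>)) = h \<xi> s2" by simp
  qed
  have right: "x0 + (l - c) * s \<in> {x0 + (l - c) * s2..b} \<longleftrightarrow> s \<in> {s1..s2}"
    "s \<in> {s1..s2} \<Longrightarrow> h (x0 + (l - c) * s + c * \<omega> (x0 + (l - c) * s)) (\<omega> (x0 + (l - c) * s)) = h (x0 + l * s) s" for s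
  proof -
    show "x0 + (l - c) * s \<in> {x0 + (l - c) * s2..b} \<longleftrightarrow> s \<in> {s1..s2}"
      using cl by (auto simp: b_def)
    assume "s \<in> {s1..s2}"
    moreover have "(x0 - (x0 + (l - c) * s)) / (c - l) = s" using cl by (simp add: field_simps)
    ultimately have w: "\<omega> (x0 + (l - c) * s) = s" by (simp add: \<omega>_def)
    show "h (x0 + (l - c) * s + c * \<omega> (x0 + (l - c) * s)) (\<omega> (x0 + (l - c) * s)) = h (x0 + l * s) s"
      unfolding w by (simp add: algebra_simps)
  qed
  have left': "\<forall>s\<in>{s1..s2}. h (0 + - c * s + c * \<alpha> (0 + - c * s)) (\<alpha> (0 + - c * s)) = h 0 s"
    using left(2) by blast
  have bottom': "\<forall>s\<in>{0..x0 + l * s1}. h (- c * s1 + 1 * s + c * \<alpha> (- c * s1 + 1 * s)) (\<alpha> (- c * s1 + 1 * s)) = h s s1"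
    using bottom(2) by blast
  have top': "\<forall>s\<in>{0..x0 + l * s2}. h (- c * s2 + 1 * s + c * \<omega> (- c * s2 + 1 * s)) (\<omega> (- c * s2 + 1 * s)) = h s s2"
    using top(2) by blast
  have right': "\<forall>s\<in>{s1..s2}. h (x0 + (l - c) * s + c * \<omega> (x0 + (l - c) * s)) (\<omega> (x0 + (l - c) * s)) = h (x0 + l * s) s"
    using right(2) by blast
  have nz: "- c \<noteq> 0" "(1::real) \<noteq> 0" "l - c \<noteq> 0" using cl by auto
  note L = set_integral_affine_interval[where f = "\<lambda>y. h (y + c * \<alpha> y) (\<alpha> y)" and g = "\<lambda>s. h 0 s", OF nz(1) left(1) left']
  note B = set_integral_affine_interval[where f = "\<lambda>y. h (y + c * \<alpha> y) (\<alpha> y)" and g = "\<lambda>\<xi>. h \<xi> s1", OF nz(2) bottom(1) bottom']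
  note T = set_integral_affine_interval[where f = "\<lambda>y. h (y + c * \<omega> y) (\<omega> y)" and g = "\<lambda>\<xi>. h \<xi> s2", OF nz(2) top(1) top']
  note R = set_integral_affine_interval[where f = "\<lambda>y. h (y + c * \<omega> y) (\<omega> y)" and g = "\<lambda>s. h (x0 + l * s) s", OF nz(3) right(1) right']
  have sub: "set_integrable lborel {a..- c * s1} (\<lambda>y. h (y + c * \<alpha> y) (\<alpha> y))"
    "set_integrable lborel {- c * s1..b} (\<lambda>y. h (y + c * \<alpha> y) (\<alpha> y))"
    "set_integrable lborel {a..x0 + (l - c) * s2} (\<lambda>y. h (y + c * \<omega> y) (\<omega> y))"
    "set_integrable lborel {x0 + (l - c) * s2..b} (\<lambda>y. h (y + c * \<omega> y) (\<omega> y))"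
    using o by (auto intro: set_integrable_subset[OF div(1)] set_integrable_subset[OF div(2)])
  show "set_integrable lborel {0..x0 + l * s1} (\<lambda>\<xi>. h \<xi> s1)" "set_integrable lborel {0..x0 + l * s2} (\<lambda>\<xi>. h \<xi> s2)"
    "set_integrable lborel {s1..s2} (\<lambda>s. h 0 s)" "set_integrable lborel {s1..s2} (\<lambda>s. h (x0 + l * s) s)"
    using sub L(2) B(2) T(2) R(2) by blast+
  have "\<bar>- c\<bar> = c" "\<bar>l - c\<bar> = c - l" "\<bar>1::real\<bar> = 1" using cl by auto
  note L' = L(1)[unfolded this(1)] and R' = R(1)[unfolded this(2)] and B' = B(1)[unfolded this(3) mult_1]
    and T' = T(1)[unfolded this(3) mult_1]
  show "(LINT \<xi>:{0..x0 + l * s2}|lborel. h \<xi> s2) - (LINT \<xi>:{0..x0 + l * s1}|lborel. h \<xi> s1) =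
      (LINT p:trapezoid x0 l s1 s2|lborel. G (fst p) (snd p)) + c * (LINT s:{s1..s2}|lborel. h 0 s)
      - (c - l) * (LINT s:{s1..s2}|lborel. h (x0 + l * s) s)"
    using div(4) set_integral_split[OF div(1) o(1,2)] set_integral_split[OF div(2) o(3,4)] L' R' B' T'
    by linarith
qed

text \<open>Now the lines are parallel to the slanted side, which therefore carries no flux: they
  all enter at the bottom and leave through \<open>\<xi> = 0\<close> or the top.\<close>

lemma divergence_trapezoid_left:
  fixes c x0 s1 s2 C C' :: real and h G :: "real \<Rightarrow> real \<Rightarrow> real"
  assumes cl: "c < 0" and s: "s1 < s2" "0 \<le> x0 + c * s2"
    and D: "deriv_along c 1 (trapezoid x0 c s1 s2) h G"
    and h: "(\<lambda>p. h (fst p) (snd p)) \<in> borel_measurable borel"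
    and G: "(\<lambda>p. G (fst p) (snd p)) \<in> borel_measurable borel"
    and bh: "AE p in lborel. p \<in> trapezoid x0 c s1 s2 \<longrightarrow> \<bar>h (fst p) (snd p)\<bar> \<le> C"
    and bG: "AE p in lborel. p \<in> trapezoid x0 c s1 s2 \<longrightarrow> \<bar>G (fst p) (snd p)\<bar> \<le> C'"
  shows "set_integrable lborel {s1..s2} (\<lambda>s. h 0 s)"
    and "set_integrable lborel (trapezoid x0 c s1 s2) (\<lambda>p. G (fst p) (snd p))"
    and "(LINT \<xi>:{0..x0 + c * s2}|lborel. h \<xi> s2) - (LINT \<xi>:{0..x0 + c * s1}|lborel. h \<xi> s1) =
      (LINT p:trapezoid x0 c s1 s2|lborel. G (fst p) (snd p)) + c * (LINT s:{s1..s2}|lborel. h 0 s)"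
proof -
  define \<alpha> where "\<alpha> = (\<lambda>y::real. s1)"
  define \<omega> where "\<omega> = (\<lambda>y. min s2 (- y / c))"
  define a where "a = - c * s1"
  define b where "b = x0"
  have iff_\<omega>: "s \<le> - y / c \<longleftrightarrow> 0 \<le> y + c * s" for y s using cl by (auto simp: field_simps)
  have 1: "\<alpha> y < \<omega> y" if y: "a < y" "y < b" for y
    using y cl s by (auto simp: a_def \<alpha>_def \<omega>_def field_simps)
  have 2: "(y + c * s, s) \<in> trapezoid x0 c s1 s2 \<longleftrightarrow> \<alpha> y \<le> s \<and> s \<le> \<omega> y" if "a < y" "y < b" for y s
    using iff_\<omega>[of s y] that by (auto simp: trapezoid_def \<alpha>_def \<omega>_def b_def)
  have 3: "a \<le> y \<and> y \<le> b" if "(y + c * s, s) \<in> trapezoid x0 c s1 s2" for y s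
  proof -
    from that have "s1 \<le> s" "0 \<le> y + c * s" "y + c * s \<le> x0 + c * s" by (auto simp: trapezoid_def)
    moreover from this have "c * s \<le> c * s1" using cl by auto
    ultimately show ?thesis by (simp add: a_def b_def)
  qed
  have m: "\<alpha> \<in> borel_measurable borel" "\<omega> \<in> borel_measurable borel"
    unfolding \<alpha>_def \<omega>_def by measurable
  have b1: "\<forall>y\<in>{a<..<b}. \<alpha> y < \<omega> y"
    and b2: "\<forall>y\<in>{a<..<b}. \<forall>s. (y + c * s, s) \<in> trapezoid x0 c s1 s2 \<longleftrightarrow> \<alpha> y \<le> s \<and> s \<le> \<omega> y"
    and b3: "\<forall>y s. (y + c * s, s) \<in> trapezoid x0 c s1 s2 \<longrightarrow> y \<in> {a..b}"
    using 1 2 3 by auto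
  note div = divergence_along[OF D h G trapezoid_props(1,3) bh bG b1 b2 b3 m]
  show iG: "set_integrable lborel (trapezoid x0 c s1 s2) (\<lambda>p. G (fst p) (snd p))" by (rule div(3))
  have c2: "c * s2 < c * s1" using cl s by simp
  have o: "a \<le> - c * s2" "- c * s2 \<le> b" using c2 s by (auto simp: a_def b_def)
  have left: "0 + - c * s \<in> {a..- c * s2} \<longleftrightarrow> s \<in> {s1..s2}"
    "s \<in> {s1..s2} \<Longrightarrow> h (0 + - c * s + c * \<omega> (0 + - c * s)) (\<omega> (0 + - c * s)) = h 0 s" for s
    using cl by (auto simp: a_def \<omega>_def min_def)
  have bottom: "- c * s1 + 1 * \<xi> \<in> {a..b} \<longleftrightarrow> \<xi> \<in> {0..x0 + c * s1}"
    "\<xi> \<in> {0..x0 + c * s1} \<Longrightarrow>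
      h (- c * s1 + 1 * \<xi> + c * \<alpha> (- c * s1 + 1 * \<xi>)) (\<alpha> (- c * s1 + 1 * \<xi>)) = h \<xi> s1" for \<xi>
    by (auto simp: a_def b_def \<alpha>_def)
  have top: "- c * s2 + 1 * \<xi> \<in> {- c * s2..b} \<longleftrightarrow> \<xi> \<in> {0..x0 + c * s2}"
    "\<xi> \<in> {0..x0 + c * s2} \<Longrightarrow>
      h (- c * s2 + 1 * \<xi> + c * \<omega> (- c * s2 + 1 * \<xi>)) (\<omega> (- c * s2 + 1 * \<xi>)) = h \<xi> s2" for \<xi>
  proof -
    show "- c * s2 + 1 * \<xi> \<in> {- c * s2..b} \<longleftrightarrow> \<xi> \<in> {0..x0 + c * s2}"
      by (auto simp: b_def)
    assume "\<xi> \<in> {0..x0 + c * s2}"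
    then have "s2 \<le> - (- c * s2 + 1 * \<xi>) / c" by (subst iff_\<omega>) simp
    then have "\<omega> (- c * s2 + 1 * \<xi>) = s2" unfolding \<omega>_def by (rule min_absorb1)
    then show "h (- c * s2 + 1 * \<xi> + c * \<omega> (- c * s2 + 1 * \<xi>)) (\<omega> (- c * s2 + 1 * \<xi>)) = h \<xi> s2" by simp
  qed
  have left': "\<forall>s\<in>{s1..s2}. h (0 + - c * s + c * \<omega> (0 + - c * s)) (\<omega> (0 + - c * s)) = h 0 s"
    using left(2) by blast
  have bottom': "\<forall>s\<in>{0..x0 + c * s1}. h (- c * s1 + 1 * s + c * \<alpha> (- c * s1 + 1 * s)) (\<alpha> (- c * s1 + 1 * s)) = h s s1"
    using bottom(2) by blast
  have top': "\<forall>s\<in>{0..x0 + c * s2}. h (- c * s2 + 1 * s + c * \<omega> (- c * s2 + 1 * s)) (\<omega> (- c * s2 + 1 * s)) = h s s2"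
    using top(2) by blast
  have nz: "- c \<noteq> 0" "(1::real) \<noteq> 0" using cl by auto
  note L = set_integral_affine_interval[where f = "\<lambda>y. h (y + c * \<omega> y) (\<omega> y)" and g = "\<lambda>s. h 0 s", OF nz(1) left(1) left']
  note B = set_integral_affine_interval[where f = "\<lambda>y. h (y + c * \<alpha> y) (\<alpha> y)" and g = "\<lambda>\<xi>. h \<xi> s1", OF nz(2) bottom(1) bottom']
  note T = set_integral_affine_interval[where f = "\<lambda>y. h (y + c * \<omega> y) (\<omega> y)" and g = "\<lambda>\<xi>. h \<xi> s2", OF nz(2) top(1) top']
  show "set_integrable lborel {s1..s2} (\<lambda>s. h 0 s)"
    using set_integrable_subset[OF div(2), of "{a..- c * s2}"] o L(2) by auto
  have "\<bar>- c\<bar> = - c" "\<bar>1::real\<bar> = 1" using cl by auto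
  note L' = L(1)[unfolded this(1)] and B' = B(1)[unfolded this(2) mult_1] and T' = T(1)[unfolded this(2) mult_1]
  show "(LINT \<xi>:{0..x0 + c * s2}|lborel. h \<xi> s2) - (LINT \<xi>:{0..x0 + c * s1}|lborel. h \<xi> s1) =
      (LINT p:trapezoid x0 c s1 s2|lborel. G (fst p) (snd p)) + c * (LINT s:{s1..s2}|lborel. h 0 s)"
    using div(4) set_integral_split[OF div(2) o] L' B' T' by linarith
qed

text \<open>Under \<open>x = x0 + a * s\<close> a line of direction \<open>(b, 1)\<close> in the
  \<open>(\<xi>, s)\<close>-plane becomes one of direction \<open>(a, b)\<close> in the
  \<open>(x, \<xi>)\<close>-plane. This gives a kernel and its state component a common
  direction.\<close>

lemma deriv_along_slice:
  fixes a b x0 :: real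
  assumes D0: "deriv_along a b D0 f g" and "b \<noteq> 0" "a \<noteq> 0"
    and sub: "\<And>\<xi> s. (\<xi>, s) \<in> D \<Longrightarrow> (x0 + a * s, \<xi>) \<in> D0"
  shows "deriv_along b 1 D (\<lambda>\<xi> s. f (x0 + a * s) \<xi>) (\<lambda>\<xi> s. g (x0 + a * s) \<xi>)"
proof -
  have "- (a / b) \<noteq> 0" using assms by simp
  from AE_lborel_affine[OF D0[unfolded deriv_along_def] this, of x0]
  show ?thesis unfolding deriv_along_def
  proof eventually_elim
    case (elim y)
    show ?case
    proof (intro allI impI)
      fix r s
      assume *: "r \<le> s \<and> (y + b * r, 1 * r) \<in> D \<and> (y + b * s, 1 * s) \<in> D"
      \<comment> \<open>The line \<open>(x0 + a * s, y + b * s)\<close> has second coordinate zero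
        at \<open>s = - k\<close>, and \<open>deriv_along\<close> counts its parameter from
        there.\<close>
      define k where "k = y / b"
      have pt: "x0 + - (a / b) * y + a * (\<sigma> + k) = x0 + a * \<sigma>" "b * (\<sigma> + k) = y + b * \<sigma>" for \<sigma>
        using \<open>b \<noteq> 0\<close> by (simp_all add: k_def field_simps)
      have "r + k \<le> s + k" "(x0 + - (a / b) * y + a * (r + k), b * (r + k)) \<in> D0"
        "(x0 + - (a / b) * y + a * (s + k), b * (s + k)) \<in> D0"
        using * sub unfolding pt by auto
      then have e: "set_integrable lborel {r + k..s + k} (\<lambda>\<sigma>. g (x0 + - (a / b) * y + a * \<sigma>) (b * \<sigma>))"
        "f (x0 + - (a / b) * y + a * (s + k)) (b * (s + k)) - f (x0 + - (a / b) * y + a * (r + k)) (b * (r + k)) =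
         (LINT \<sigma>:{r + k..s + k}|lborel. g (x0 + - (a / b) * y + a * \<sigma>) (b * \<sigma>))"
        using elim by blast+
      have pt': "x0 + - (a / b) * y + a * (k + 1 * \<sigma>) = x0 + a * \<sigma>" "b * (k + 1 * \<sigma>) = y + b * \<sigma>" for \<sigma>
        using pt[of \<sigma>] by (simp_all add: add.commute)
      have 1: "(1::real) \<noteq> 0" by simp
      have 2: "k + 1 * \<sigma> \<in> {r + k..s + k} \<longleftrightarrow> \<sigma> \<in> {r..s}" for \<sigma> by auto
      note A = set_integral_affine_interval[OF 1 2,
          of "\<lambda>\<sigma>. g (x0 + - (a / b) * y + a * \<sigma>) (b * \<sigma>)" "\<lambda>\<sigma>. g (x0 + a * \<sigma>) (y + b * \<sigma>)", unfolded pt', OF ballI[OF refl]]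
      show "set_integrable lborel {r..s} (\<lambda>\<sigma>. g (x0 + a * (1 * \<sigma>)) (y + b * \<sigma>)) \<and>
          f (x0 + a * (1 * s)) (y + b * s) - f (x0 + a * (1 * r)) (y + b * r) =
          (LINT \<sigma>:{r..s}|lborel. g (x0 + a * (1 * \<sigma>)) (y + b * \<sigma>))"
        using e A unfolding pt by simp
    qed
  qed
qed

section \<open>The backstepping transformation\<close>

text \<open>The passage from the plane of the trapezoid to that of the kernels pulls null sets back
  to null sets, because \<open>l \<noteq> 0\<close> makes it an affine bijection. It transfers the
  essential bounds of the kernels.\<close>

lemma AE_affine_swap:
  fixes x0 l :: real and Q :: "real \<Rightarrow> real \<Rightarrow> bool"
  assumes "AE p in lborel. Q (fst p) (snd p)" "l \<noteq> 0"
  shows "AE p in lborel. Q (x0 + l * snd p) (fst p)"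
proof -
  obtain N where N: "{p. \<not> Q (fst p) (snd p)} \<subseteq> N" "N \<in> null_sets lborel"
    using assms by (auto simp: eventually_ae_filter)
  have Nb: "N \<in> sets borel" using N(2) by auto
  have "AE p in lborel. p \<notin> N" using N(2) by (rule AE_not_in)
  then have "AE p in lborel. (fst p, snd p) \<notin> N" by simp
  from AE_lborel_affine[OF AE_product_sections(1)[where Q = "\<lambda>a b. (a, b) \<notin> N", OF this] \<open>l \<noteq> 0\<close>, of x0]
  have *: "AE s in lborel. AE \<xi> in lborel. (x0 + l * s, \<xi>) \<notin> N" .
  have "(\<lambda>p. (x0 + l * snd p, fst p)) \<in> borel \<rightarrow>\<^sub>M (borel :: (real \<times> real) measure)"
    unfolding borel_prod[symmetric] by measurable
  from measurable_sets[OF this sets.compl_sets[OF Nb]]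
  have m: "{p \<in> space (lborel \<Otimes>\<^sub>M lborel). (x0 + l * snd p, fst p) \<notin> N} \<in> sets (lborel \<Otimes>\<^sub>M lborel)"
    unfolding lborel_prod by (simp add: vimage_def)
  have "AE \<xi> in lborel. AE s in lborel. (x0 + l * s, \<xi>) \<notin> N"
    using lborel_pair.AE_commute[of "\<lambda>\<xi> s. (x0 + l * s, \<xi>) \<notin> N"] m * by simp
  then have "AE p in lborel \<Otimes>\<^sub>M lborel. (x0 + l * snd p, fst p) \<notin> N"
    by (intro lborel_pair.AE_pair_measure[OF m]) simp
  then have "AE p in lborel. (x0 + l * snd p, fst p) \<notin> N" by (simp only: lborel_prod)
  then show ?thesis
  proof eventually_elim
    case (elim p)
    then show ?case using subsetD[OF N(1), of "(x0 + l * snd p, fst p)"] by auto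
  qed
qed

section \<open>Essential boundedness and the abstract backstepping system\<close>

definition ess_bounded :: "(real \<times> real) set \<Rightarrow> (real \<times> real \<Rightarrow> real) \<Rightarrow> bool" where
  "ess_bounded D f \<longleftrightarrow> (\<exists>C. AE p in lborel. p \<in> D \<longrightarrow> \<bar>f p\<bar> \<le> C)"

lemma ess_bounded_add:
  assumes "ess_bounded D f" "ess_bounded D g"
  shows "ess_bounded D (\<lambda>p. f p + g p)"
proof -
  from assms obtain A B where "AE p in lborel. p \<in> D \<longrightarrow> \<bar>f p\<bar> \<le> A" "AE p in lborel. p \<in> D \<longrightarrow> \<bar>g p\<bar> \<le> B"
    unfolding ess_bounded_def by blast
  then have "AE p in lborel. p \<in> D \<longrightarrow> \<bar>f p + g p\<bar> \<le> A + B"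
    by eventually_elim (auto intro: abs_triangle_ineq order_trans add_mono)
  then show ?thesis unfolding ess_bounded_def by blast
qed

lemma ess_bounded_mult:
  assumes "ess_bounded D f" "ess_bounded D g"
  shows "ess_bounded D (\<lambda>p. f p * g p)"
proof -
  from assms obtain A B where "AE p in lborel. p \<in> D \<longrightarrow> \<bar>f p\<bar> \<le> A" "AE p in lborel. p \<in> D \<longrightarrow> \<bar>g p\<bar> \<le> B"
    unfolding ess_bounded_def by blast
  then have "AE p in lborel. p \<in> D \<longrightarrow> \<bar>f p * g p\<bar> \<le> A * B"
  proof eventually_elim
    case (elim p)
    show ?case
    proof
      assume "p \<in> D"
      with elim have "\<bar>f p\<bar> \<le> A" "\<bar>g p\<bar> \<le> B" by auto
      then show "\<bar>f p * g p\<bar> \<le> A * B" unfolding abs_mult by (intro mult_mono) auto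
    qed
  qed
  then show ?thesis unfolding ess_bounded_def by blast
qed

lemma ess_bounded_uminus: "ess_bounded D f \<Longrightarrow> ess_bounded D (\<lambda>p. - f p)"
  by (simp add: ess_bounded_def)

lemma ess_bounded_zero: "ess_bounded D (\<lambda>p. 0)"
  unfolding ess_bounded_def by (intro exI[of _ 0]) simp

lemma ess_bounded_sum:
  assumes "\<And>i. i \<in> A \<Longrightarrow> ess_bounded D (f i)" 
  shows "ess_bounded D (\<lambda>p. \<Sum>i\<in>A. f i p)"
  using assms
proof (induction A rule: infinite_finite_induct)
  case (insert i A)
  have "ess_bounded D (\<lambda>p. f i p + (\<Sum>i\<in>A. f i p))" using insert by (intro ess_bounded_add) auto
  then show ?case using insert by simp
qed (simp_all add: ess_bounded_zero)

lemma ess_bounded_subset: "ess_bounded D f \<Longrightarrow> D' \<subseteq> D \<Longrightarrow> ess_bounded D' f"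
  unfolding ess_bounded_def by (elim exE, rule exI, elim eventually_mono) blast

lemma ess_bounded_cong:
  assumes "\<And>p. p \<in> D \<Longrightarrow> f p = g p" "ess_bounded D f"
  shows "ess_bounded D g"
  using assms by (simp add: ess_bounded_def cong: imp_cong)

lemmas ess_bounded_intros = ess_bounded_add ess_bounded_mult ess_bounded_uminus ess_bounded_sum

lemma set_integral_trivial: "(LINT x:{a::real}|lborel. f x) = (0::real)"
  unfolding set_lebesgue_integral_def
  by (rule integral_eq_zero_AE) (use AE_lborel_singleton[of a] in \<open>auto elim!: eventually_mono\<close>)

text \<open>
  In the paper's notation \<open>c\<close> is \<open>\<Lambda>\<^sup>+\<close>, \<open>l\<close> is \<open>\<lambda>\<^sub>4\<close>, \<open>v\<close> is \<open>v\<^sub>2\<close> and \<open>q\<close> is \<open>Q\<^sub>0\<close> with overline; \<open>Spp\<close>, \<open>Spm\<close>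
  and \<open>Smp\<close> are \<open>\<Sigma>\<^sup>+\<^sup>+\<close>, \<open>\<Sigma>\<^sup>+\<^sup>-\<close> and \<open>\<Sigma>\<^sup>-\<^sup>+\<close>.
\<close>

locale backstepping =
  fixes len l v :: real and c q :: "'n::finite \<Rightarrow> real"
    and Spp :: "'n \<Rightarrow> 'n \<Rightarrow> real \<Rightarrow> real" and Spm Smp :: "'n \<Rightarrow> real \<Rightarrow> real"
    and w :: "'n \<Rightarrow> real \<Rightarrow> real \<Rightarrow> real" and u :: "real \<Rightarrow> real \<Rightarrow> real"
    and K :: "'n \<Rightarrow> real \<Rightarrow> real \<Rightarrow> real" and L :: "real \<Rightarrow> real \<Rightarrow> real"
    and strip tri :: "(real \<times> real) set"
  assumes len: "0 < len" and l: "l < 0" and v: "0 < v" and vc: "\<And>j. v \<le> c j"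
    and strip_def: "strip = {0..len} \<times> {0..}"
    and tri_def: "tri = {(x, \<xi>). 0 \<le> \<xi> \<and> \<xi> \<le> x \<and> x \<le> len}"
    and coeff_cont: "\<And>j k. continuous_on UNIV (Spp j k)" "\<And>j. continuous_on UNIV (Spm j)"
      "\<And>j. continuous_on UNIV (Smp j)"
    and meas: "\<And>j. (\<lambda>p. w j (fst p) (snd p)) \<in> borel_measurable borel"
      "(\<lambda>p. u (fst p) (snd p)) \<in> borel_measurable borel"
      "\<And>j. (\<lambda>p. K j (fst p) (snd p)) \<in> borel_measurable borel"
      "(\<lambda>p. L (fst p) (snd p)) \<in> borel_measurable borel"
    and state_bounded: "\<And>T j. ess_bounded ({0..len} \<times> {0..T}) (\<lambda>p. w j (fst p) (snd p))"
      "\<And>T. ess_bounded ({0..len} \<times> {0..T}) (\<lambda>p. u (fst p) (snd p))"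
    and kernel_bounded: "\<And>j. ess_bounded tri (\<lambda>p. K j (fst p) (snd p))" "ess_bounded tri (\<lambda>p. L (fst p) (snd p))"
    and w_eq: "\<And>j. deriv_along (c j) 1 strip (w j) (\<lambda>x t. (\<Sum>k\<in>UNIV. Spp j k x * w k x t) + Spm j x * u x t)"
    and u_eq: "deriv_along l 1 strip u (\<lambda>x t. \<Sum>k\<in>UNIV. Smp k x * w k x t)"
    and K_eq: "\<And>j. deriv_along l (c j) tri (K j)
        (\<lambda>x \<xi>. - ((\<Sum>k\<in>UNIV. K k x \<xi> * Spp k j \<xi>) + L x \<xi> * Smp j \<xi>))"
    and K_diag: "AE x in lborel. x \<in> {0..len} \<longrightarrow> (\<forall>j. (c j - l) * K j x x + Smp j x = 0)"
    and L_def: "\<And>x \<xi>. (x, \<xi>) \<in> tri \<Longrightarrow> L x \<xi> = - (1 / l) * (\<Sum>j\<in>UNIV. K j (x - \<xi>) 0 * c j * q j)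
        + (LINT \<nu>:{0..- \<xi> / l}|lborel. \<Sum>j\<in>UNIV. K j (l * \<nu> + x) (l * \<nu> + \<xi>) * Spm j (l * \<nu> + \<xi>))"
    and inlet: "AE t in lborel. 0 \<le> t \<longrightarrow> (\<forall>j. w j 0 t = q j * u 0 t)"
    and outlet: "AE t in lborel. 0 \<le> t \<longrightarrow> u len t =
        (LINT \<xi>:{0..len}|lborel. \<Sum>j\<in>UNIV. K j len \<xi> * w j \<xi> t) + (LINT \<xi>:{0..len}|lborel. L len \<xi> * u \<xi> t)"
begin

definition F :: "real \<Rightarrow> real \<Rightarrow> real" where
  "F x t = (LINT \<xi>:{0..x}|lborel. \<Sum>j\<in>UNIV. K j x \<xi> * w j \<xi> t) + (LINT \<xi>:{0..x}|lborel. L x \<xi> * u \<xi> t)"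

lemma c_pos: "0 < c j"
  using v vc[of j] by linarith

lemma coeff_meas [measurable]: "Spp j k \<in> borel_measurable borel" "Spm j \<in> borel_measurable borel"
  "Smp j \<in> borel_measurable borel"
  using coeff_cont by (auto intro: borel_measurable_continuous_onI)

lemma meas_comp:
  assumes [measurable]: "a \<in> borel_measurable M" "b \<in> borel_measurable M"
  shows "(\<lambda>x. w j (a x) (b x)) \<in> borel_measurable M" "(\<lambda>x. u (a x) (b x)) \<in> borel_measurable M"
    "(\<lambda>x. K j (a x) (b x)) \<in> borel_measurable M" "(\<lambda>x. L (a x) (b x)) \<in> borel_measurable M"
proof -
  have p: "(\<lambda>x. (a x, b x)) \<in> M \<rightarrow>\<^sub>M (borel :: (real \<times> real) measure)"
    unfolding borel_prod[symmetric] by measurable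
  show "(\<lambda>x. w j (a x) (b x)) \<in> borel_measurable M" "(\<lambda>x. u (a x) (b x)) \<in> borel_measurable M"
    "(\<lambda>x. K j (a x) (b x)) \<in> borel_measurable M" "(\<lambda>x. L (a x) (b x)) \<in> borel_measurable M"
    using measurable_compose[OF p meas(1)] measurable_compose[OF p meas(2)]
      measurable_compose[OF p meas(3)] measurable_compose[OF p meas(4)] by simp_all
qed

lemma strip_convex: "convex strip"
  unfolding strip_def by (intro convex_Times convex_real_interval)

lemma coeff_bound:
  "\<exists>B\<ge>0. \<forall>j k. \<forall>x\<in>{0..len}. \<bar>Spp j k x\<bar> \<le> B \<and> \<bar>Spm j x\<bar> \<le> B \<and> \<bar>Smp j x\<bar> \<le> B"
proof -
  define f where "f = (\<lambda>x. (\<Sum>j\<in>UNIV. \<Sum>k\<in>UNIV. \<bar>Spp j k x\<bar>) + (\<Sum>j\<in>UNIV. \<bar>Spm j x\<bar>) + (\<Sum>j\<in>UNIV. \<bar>Smp j x\<bar>))"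
  have "continuous_on {0..len} f"
    unfolding f_def by (intro continuous_intros continuous_on_subset[OF coeff_cont(1)]
        continuous_on_subset[OF coeff_cont(2)] continuous_on_subset[OF coeff_cont(3)]) auto
  then have "bounded (f ` {0..len})" by (intro compact_imp_bounded compact_continuous_image) auto
  then obtain B where B: "\<forall>y\<in>f ` {0..len}. norm y \<le> B" unfolding bounded_iff by blast
  have fB: "f x \<le> max B 0" if "x \<in> {0..len}" for x
  proof -
    have "norm (f x) \<le> B" using B that by blast
    then show ?thesis by simp
  qed
  have *: "\<bar>Spp j k x\<bar> \<le> max B 0 \<and> \<bar>Spm j x\<bar> \<le> max B 0 \<and> \<bar>Smp j x\<bar> \<le> max B 0" if "x \<in> {0..len}" for j k x
  proof -
    have "\<bar>Spp j k x\<bar> \<le> (\<Sum>k\<in>UNIV. \<bar>Spp j k x\<bar>)" by (rule member_le_sum) auto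
    also have "\<dots> \<le> (\<Sum>j\<in>UNIV. \<Sum>k\<in>UNIV. \<bar>Spp j k x\<bar>)"
      by (rule member_le_sum[of j UNIV "\<lambda>j. \<Sum>k\<in>UNIV. \<bar>Spp j k x\<bar>"]) (auto intro: sum_nonneg)
    finally have 1: "\<bar>Spp j k x\<bar> \<le> (\<Sum>j\<in>UNIV. \<Sum>k\<in>UNIV. \<bar>Spp j k x\<bar>)" .
    have 2: "\<bar>Spm j x\<bar> \<le> (\<Sum>j\<in>UNIV. \<bar>Spm j x\<bar>)" by (rule member_le_sum) auto
    have 3: "\<bar>Smp j x\<bar> \<le> (\<Sum>j\<in>UNIV. \<bar>Smp j x\<bar>)" by (rule member_le_sum) auto
    show ?thesis using 1 2 3 fB[OF that] unfolding f_def by linarith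
  qed
  show ?thesis
  proof (intro exI[of _ "max B 0"] conjI allI ballI)
    show "0 \<le> max B 0" by simp
  qed (use * in blast)+
qed

lemma coeff_ess_bounded:
  assumes "\<And>p. p \<in> D \<Longrightarrow> fst p \<in> {0..len}"
  shows "ess_bounded D (\<lambda>p. Spp j k (fst p))" "ess_bounded D (\<lambda>p. Spm j (fst p))" "ess_bounded D (\<lambda>p. Smp j (fst p))"
proof -
  obtain B where "0 \<le> B" and B: "\<forall>j k. \<forall>x\<in>{0..len}. \<bar>Spp j k x\<bar> \<le> B \<and> \<bar>Spm j x\<bar> \<le> B \<and> \<bar>Smp j x\<bar> \<le> B"
    using coeff_bound by blast
  have "AE p in lborel. p \<in> D \<longrightarrow> \<bar>Spp j k (fst p)\<bar> \<le> B" "AE p in lborel. p \<in> D \<longrightarrow> \<bar>Spm j (fst p)\<bar> \<le> B"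
    "AE p in lborel. p \<in> D \<longrightarrow> \<bar>Smp j (fst p)\<bar> \<le> B"
    by (rule AE_I2; use B assms in blast)+
  then show "ess_bounded D (\<lambda>p. Spp j k (fst p))" "ess_bounded D (\<lambda>p. Spm j (fst p))" "ess_bounded D (\<lambda>p. Smp j (fst p))"
    unfolding ess_bounded_def by blast+
qed

text \<open>At \<open>\<xi> = 0\<close> the integral in \<open>L_def\<close> is over a single point.
  The identity is what cancels the flux through the inlet: once \<open>w j = q j * u\<close> there,
  that flux is \<open>u\<close> times the difference of the two sides.\<close>

lemma L_inlet: "x \<in> {0..len} \<Longrightarrow> l * L x 0 = - (\<Sum>j\<in>UNIV. K j x 0 * c j * q j)"
  using L_def[of x 0] l by (simp add: tri_def set_integral_trivial field_simps)

text \<open>\<open>L_def\<close> is already the integrated form of this equation. On a diagonal,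
  \<open>x - \<xi>\<close> is constant, so the inlet term is a constant \<open>A\<close>, and only
  the lower limit of the remaining integral moves.\<close>

lemma L_eq: "deriv_along l l tri L (\<lambda>x \<xi>. - (\<Sum>j\<in>UNIV. K j x \<xi> * Spm j \<xi>))"
proof -
  define \<Phi> where "\<Phi> = (\<lambda>x \<xi>. \<Sum>j\<in>UNIV. K j x \<xi> * Spm j \<xi>)"
  have "ess_bounded tri (\<lambda>p. \<Sum>j\<in>UNIV. K j (fst p) (snd p) * Spm j (snd p))"
  proof (intro ess_bounded_intros kernel_bounded)
    obtain B where "0 \<le> B" and B: "\<forall>j k. \<forall>x\<in>{0..len}. \<bar>Spp j k x\<bar> \<le> B \<and> \<bar>Spm j x\<bar> \<le> B \<and> \<bar>Smp j x\<bar> \<le> B"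
      using coeff_bound by blast
    have "AE p in lborel. p \<in> tri \<longrightarrow> \<bar>Spm j (snd p)\<bar> \<le> B" for j
    proof (rule AE_I2, rule impI)
      fix p assume "p \<in> tri"
      then have "snd p \<in> {0..len}" by (auto simp: tri_def)
      then show "\<bar>Spm j (snd p)\<bar> \<le> B" using B by blast
    qed
    then show "ess_bounded tri (\<lambda>p. Spm j (snd p))" for j
      unfolding ess_bounded_def by blast
  qed
  then obtain C where "AE p in lborel. (fst p, snd p) \<in> tri \<longrightarrow> \<bar>\<Phi> (fst p) (snd p)\<bar> \<le> C"
    unfolding ess_bounded_def \<Phi>_def by auto
  from AE_lines[where Q = "\<lambda>x \<xi>. (x, \<xi>) \<in> tri \<longrightarrow> \<bar>\<Phi> x \<xi>\<bar> \<le> C", OF this less_imp_neq[OF l], of l]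
  have "AE y in lborel. AE r in lborel. (y + l * r, l * r) \<in> tri \<longrightarrow> \<bar>\<Phi> (y + l * r) (l * r)\<bar> \<le> C" .
  then show ?thesis
    unfolding deriv_along_def
  proof eventually_elim
    case (elim y)
    have [measurable]: "(\<lambda>\<sigma>. \<Phi> (y + l * \<sigma>) (l * \<sigma>)) \<in> borel_measurable borel"
      unfolding \<Phi>_def by (intro borel_measurable_sum borel_measurable_times meas_comp) measurable
    define A where "A = - (1 / l) * (\<Sum>j\<in>UNIV. K j y 0 * c j * q j)"
    \<comment> \<open>Substitution \<open>\<rho> = r + \<nu>\<close>. The parameters are nonpositive
      because \<open>l < 0\<close> and \<open>0 \<le> \<xi> = l * r\<close>; the diagonal meets
      \<open>\<xi> = 0\<close> at parameter 0.\<close>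
    have Lr: "L (y + l * r) (l * r) = A + (LINT \<rho>:{r..0}|lborel. \<Phi> (y + l * \<rho>) (l * \<rho>))"
      if "(y + l * r, l * r) \<in> tri" for r
    proof -
      have 1: "(1::real) \<noteq> 0" by simp
      have 2: "- r + 1 * \<rho> \<in> {0..- r} \<longleftrightarrow> \<rho> \<in> {r..0}" for \<rho> by auto
      have 3: "\<forall>\<rho>\<in>{r..0}. \<Phi> (l * (- r + 1 * \<rho>) + (y + l * r)) (l * (- r + 1 * \<rho>) + l * r) = \<Phi> (y + l * \<rho>) (l * \<rho>)"
        by (simp add: algebra_simps)
      have "(LINT \<nu>:{0..- r}|lborel. \<Phi> (l * \<nu> + (y + l * r)) (l * \<nu> + l * r)) =
          (LINT \<rho>:{r..0}|lborel. \<Phi> (y + l * \<rho>) (l * \<rho>))"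
        using set_integral_affine_interval(1)[where f = "\<lambda>\<nu>. \<Phi> (l * \<nu> + (y + l * r)) (l * \<nu> + l * r)", OF 1 2 3] by simp
      then show ?thesis using L_def[OF that] l by (simp add: A_def \<Phi>_def)
    qed
    show ?case
    proof (intro allI impI)
      fix r s
      assume *: "r \<le> s \<and> (y + l * r, l * r) \<in> tri \<and> (y + l * s, l * s) \<in> tri"
      then have y: "0 \<le> y" "y + l * r \<le> len" "s \<le> 0" "r \<le> s"
        using l by (auto simp: tri_def zero_le_mult_iff)
      have in_tri: "(y + l * \<sigma>, l * \<sigma>) \<in> tri" if "\<sigma> \<in> {r..0}" for \<sigma>
      proof -
        have "l * \<sigma> \<le> l * r" "0 \<le> l * \<sigma>" using that l by (auto simp: zero_le_mult_iff)
        then show ?thesis using y by (auto simp: tri_def)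
      qed
      have i: "set_integrable lborel {r..0} (\<lambda>\<sigma>. \<Phi> (y + l * \<sigma>) (l * \<sigma>))"
      proof (rule set_integrable_AE_bounded[where C = C])
        show "AE \<sigma> in lborel. \<sigma> \<in> {r..0} \<longrightarrow> \<bar>\<Phi> (y + l * \<sigma>) (l * \<sigma>)\<bar> \<le> C"
          using elim by eventually_elim (use in_tri in auto)
      qed auto
      have i': "set_integrable lborel {r..s} (\<lambda>\<sigma>. \<Phi> (y + l * \<sigma>) (l * \<sigma>))"
        using y by (intro set_integrable_subset[OF i]) auto
      have "L (y + l * s) (l * s) - L (y + l * r) (l * r) = - (LINT \<sigma>:{r..s}|lborel. \<Phi> (y + l * \<sigma>) (l * \<sigma>))"
        using set_integral_split[OF i y(4,3)] Lr[of r] Lr[of s] * by simp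
      then show "set_integrable lborel {r..s} (\<lambda>\<sigma>. - (\<Sum>j\<in>UNIV. K j (y + l * \<sigma>) (l * \<sigma>) * Spm j (l * \<sigma>))) \<and>
          L (y + l * s) (l * s) - L (y + l * r) (l * r) =
          (LINT \<sigma>:{r..s}|lborel. - (\<Sum>j\<in>UNIV. K j (y + l * \<sigma>) (l * \<sigma>) * Spm j (l * \<sigma>)))"
        using i' by (simp add: \<Phi>_def set_integrable_def set_lebesgue_integral_def)
    qed
  qed
qed

end

section \<open>The backstepping integral along a line of speed \<open>l\<close>\<close>

context backstepping
begin

context
  fixes x0 s1 s2 :: real
  assumes s: "0 \<le> s1" "s1 < s2" and x0: "x0 + l * s1 \<le> len" "0 \<le> x0 + l * s2"
begin

definition "D = trapezoid x0 l s1 s2"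

text \<open>The pairs \<open>h\<close>, \<open>G\<close> and \<open>hu\<close>, \<open>Gu\<close>
  are integrands of \<open>F\<close> on the moving line and what the product rule makes of them:
  \<open>G\<close> combines \<open>K_eq\<close> with \<open>w_eq\<close>, and \<open>Gu\<close>
  combines \<open>L_eq\<close> with \<open>u_eq\<close>.\<close>

definition "h j \<xi> s = K j (x0 + l * s) \<xi> * w j \<xi> s"

definition "G j \<xi> s =
  - ((\<Sum>k\<in>UNIV. K k (x0 + l * s) \<xi> * Spp k j \<xi>) + L (x0 + l * s) \<xi> * Smp j \<xi>) * w j \<xi> s
  + K j (x0 + l * s) \<xi> * ((\<Sum>k\<in>UNIV. Spp j k \<xi> * w k \<xi> s) + Spm j \<xi> * u \<xi> s)"

definition "hu \<xi> s = L (x0 + l * s) \<xi> * u \<xi> s"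

definition "Gu \<xi> s = - (\<Sum>j\<in>UNIV. K j (x0 + l * s) \<xi> * Spm j \<xi>) * u \<xi> s
  + L (x0 + l * s) \<xi> * (\<Sum>k\<in>UNIV. Smp k \<xi> * w k \<xi> s)"

lemma D_in_tri: "(\<xi>, s) \<in> D \<Longrightarrow> (x0 + l * s, \<xi>) \<in> tri"
  and D_in_strip: "(\<xi>, s) \<in> D \<Longrightarrow> (\<xi>, s) \<in> {0..len} \<times> {0..s2}"
proof -
  assume "(\<xi>, s) \<in> D"
  then have *: "s1 \<le> s" "s \<le> s2" "0 \<le> \<xi>" "\<xi> \<le> x0 + l * s" by (auto simp: D_def trapezoid_def)
  moreover have "l * s \<le> l * s1" using l * by simp
  ultimately show "(x0 + l * s, \<xi>) \<in> tri" "(\<xi>, s) \<in> {0..len} \<times> {0..s2}"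
    using s x0 by (auto simp: tri_def)
qed

lemma D_in_strip': "D \<subseteq> strip"
  using D_in_strip by (force simp: strip_def)

lemma convex_D: "convex D" unfolding D_def by (rule trapezoid_props)

lemma h_eq: "deriv_along (c j) 1 D (h j) (G j)"
proof -
  have "deriv_along (c j) 1 D (\<lambda>\<xi> s. K j (x0 + l * s) \<xi>)
    (\<lambda>\<xi> s. - ((\<Sum>k\<in>UNIV. K k (x0 + l * s) \<xi> * Spp k j \<xi>) + L (x0 + l * s) \<xi> * Smp j \<xi>))"
    using c_pos[of j] l by (intro deriv_along_slice[OF K_eq] D_in_tri) auto
  from deriv_along_mult[OF this deriv_along_subset[OF w_eq D_in_strip'] convex_D]
  show ?thesis unfolding h_def G_def .
qed

lemma hu_eq: "deriv_along l 1 D hu Gu"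
proof -
  have "deriv_along l 1 D (\<lambda>\<xi> s. L (x0 + l * s) \<xi>) (\<lambda>\<xi> s. - (\<Sum>j\<in>UNIV. K j (x0 + l * s) \<xi> * Spm j \<xi>))"
    using l by (intro deriv_along_slice[OF L_eq] D_in_tri) auto
  from deriv_along_mult[OF this deriv_along_subset[OF u_eq D_in_strip'] convex_D]
  show ?thesis unfolding hu_def Gu_def .
qed

lemma state_bounded_D: "ess_bounded D (\<lambda>p. w j (fst p) (snd p))" "ess_bounded D (\<lambda>p. u (fst p) (snd p))"
  using D_in_strip by (auto intro!: ess_bounded_subset[OF state_bounded(1)[of s2]] ess_bounded_subset[OF state_bounded(2)[of s2]])

lemma kernel_bounded_D: "ess_bounded D (\<lambda>p. K j (x0 + l * snd p) (fst p))" "ess_bounded D (\<lambda>p. L (x0 + l * snd p) (fst p))"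
proof -
  have *: "ess_bounded D (\<lambda>p. M (x0 + l * snd p) (fst p))" if M: "ess_bounded tri (\<lambda>p. M (fst p) (snd p))" for M
  proof -
    obtain C where "AE p in lborel. (fst p, snd p) \<in> tri \<longrightarrow> \<bar>M (fst p) (snd p)\<bar> \<le> C"
      using M by (auto simp: ess_bounded_def)
    from AE_affine_swap[where Q = "\<lambda>a b. (a, b) \<in> tri \<longrightarrow> \<bar>M a b\<bar> \<le> C", OF this less_imp_neq[OF l], of x0]
    have "AE p in lborel. p \<in> D \<longrightarrow> \<bar>M (x0 + l * snd p) (fst p)\<bar> \<le> C"
      by eventually_elim (use D_in_tri in auto)
    then show ?thesis unfolding ess_bounded_def by blast
  qed
  show "ess_bounded D (\<lambda>p. K j (x0 + l * snd p) (fst p))" "ess_bounded D (\<lambda>p. L (x0 + l * snd p) (fst p))"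
    by (intro * kernel_bounded)+
qed

lemma coeff_bounded_D:
  "ess_bounded D (\<lambda>p. Spp j k (fst p))" "ess_bounded D (\<lambda>p. Spm j (fst p))" "ess_bounded D (\<lambda>p. Smp j (fst p))"
proof -
  have *: "fst p \<in> {0..len}" if "p \<in> D" for p using D_in_strip[of "fst p" "snd p"] that by auto
  show "ess_bounded D (\<lambda>p. Spp j k (fst p))" "ess_bounded D (\<lambda>p. Spm j (fst p))" "ess_bounded D (\<lambda>p. Smp j (fst p))"
    using coeff_ess_bounded[of D, OF *] by blast+
qed

lemmas bounded_D = state_bounded_D kernel_bounded_D coeff_bounded_D

lemma bounds_h: "ess_bounded D (\<lambda>p. h j (fst p) (snd p))" "ess_bounded D (\<lambda>p. G j (fst p) (snd p))"
  "ess_bounded D (\<lambda>p. hu (fst p) (snd p))" "ess_bounded D (\<lambda>p. Gu (fst p) (snd p))"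
  unfolding h_def G_def hu_def Gu_def by (intro ess_bounded_intros bounded_D)+

lemma meas_h: "(\<lambda>p. h j (fst p) (snd p)) \<in> borel_measurable borel" "(\<lambda>p. G j (fst p) (snd p)) \<in> borel_measurable borel"
  "(\<lambda>p. hu (fst p) (snd p)) \<in> borel_measurable borel" "(\<lambda>p. Gu (fst p) (snd p)) \<in> borel_measurable borel"
proof -
  have [measurable]: "(fst :: real \<times> real \<Rightarrow> real) \<in> borel_measurable borel" "(snd :: real \<times> real \<Rightarrow> real) \<in> borel_measurable borel"
    unfolding borel_prod[symmetric] by measurable
  have [measurable]: "(\<lambda>p. x0 + l * snd p) \<in> borel_measurable (borel :: (real \<times> real) measure)" by measurable
  note [measurable] = meas meas_comp[of "\<lambda>p. x0 + l * snd p" "borel :: (real \<times> real) measure" fst]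
  show "(\<lambda>p. h j (fst p) (snd p)) \<in> borel_measurable borel" "(\<lambda>p. G j (fst p) (snd p)) \<in> borel_measurable borel"
    "(\<lambda>p. hu (fst p) (snd p)) \<in> borel_measurable borel" "(\<lambda>p. Gu (fst p) (snd p)) \<in> borel_measurable borel"
    unfolding h_def G_def hu_def Gu_def by measurable
qed

text \<open>The kernel equations are precisely the vanishing of this divergence.\<close>

lemma G_sum: "(\<Sum>j\<in>UNIV. G j \<xi> s) + Gu \<xi> s = 0"
proof -
  let ?K = "\<lambda>j. K j (x0 + l * s) \<xi>" and ?L = "L (x0 + l * s) \<xi>"
  have "(\<Sum>j\<in>UNIV. G j \<xi> s) = - (\<Sum>j\<in>UNIV. \<Sum>k\<in>UNIV. ?K k * Spp k j \<xi> * w j \<xi> s) - ?L * (\<Sum>j\<in>UNIV. Smp j \<xi> * w j \<xi> s)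
     + (\<Sum>j\<in>UNIV. \<Sum>k\<in>UNIV. ?K j * Spp j k \<xi> * w k \<xi> s) + (\<Sum>j\<in>UNIV. ?K j * Spm j \<xi>) * u \<xi> s"
    unfolding G_def
    by (simp add: sum.distrib sum_subtractf sum_distrib_left sum_distrib_right sum_negf algebra_simps)
  also have "(\<Sum>j\<in>UNIV. \<Sum>k\<in>UNIV. ?K k * Spp k j \<xi> * w j \<xi> s) = (\<Sum>j\<in>UNIV. \<Sum>k\<in>UNIV. ?K j * Spp j k \<xi> * w k \<xi> s)"
    by (rule sum.swap)
  finally show ?thesis unfolding Gu_def by simp
qed

text \<open>The divergence identities of all \<open>h j\<close> and of \<open>hu\<close> are added.
  Top and bottom form the increment of \<open>F\<close>; the side \<open>\<xi> = 0\<close> drops out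
  by \<open>inlet\<close> and \<open>L_inlet\<close>; on the slanted side \<open>K_diag\<close>
  turns the kernel into \<open>Smp\<close>. What remains is the increment of \<open>u\<close> along
  the same line.\<close>

lemma F_increment:
  "F (x0 + l * s2) s2 - F (x0 + l * s1) s1 = (LINT s:{s1..s2}|lborel. \<Sum>k\<in>UNIV. Smp k (x0 + l * s) * w k (x0 + l * s) s)"
proof -
  have "\<forall>j. \<exists>C. AE p in lborel. p \<in> D \<longrightarrow> \<bar>h j (fst p) (snd p)\<bar> \<le> C" using bounds_h(1) by (auto simp: ess_bounded_def)
  from choice[OF this] obtain Ch where "\<forall>j. AE p in lborel. p \<in> D \<longrightarrow> \<bar>h j (fst p) (snd p)\<bar> \<le> Ch j" ..
  then have Ch: "AE p in lborel. p \<in> D \<longrightarrow> \<bar>h j (fst p) (snd p)\<bar> \<le> Ch j" for j ..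
  have "\<forall>j. \<exists>C. AE p in lborel. p \<in> D \<longrightarrow> \<bar>G j (fst p) (snd p)\<bar> \<le> C" using bounds_h(2) by (auto simp: ess_bounded_def)
  from choice[OF this] obtain CG where "\<forall>j. AE p in lborel. p \<in> D \<longrightarrow> \<bar>G j (fst p) (snd p)\<bar> \<le> CG j" ..
  then have CG: "AE p in lborel. p \<in> D \<longrightarrow> \<bar>G j (fst p) (snd p)\<bar> \<le> CG j" for j ..
  obtain Chu where Chu: "AE p in lborel. p \<in> D \<longrightarrow> \<bar>hu (fst p) (snd p)\<bar> \<le> Chu"
    using bounds_h(3) by (auto simp: ess_bounded_def)
  obtain CGu where CGu: "AE p in lborel. p \<in> D \<longrightarrow> \<bar>Gu (fst p) (snd p)\<bar> \<le> CGu"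
    using bounds_h(4) by (auto simp: ess_bounded_def)
  note R = divergence_trapezoid_right[OF c_pos l s(2) x0(2) h_eq[unfolded D_def] meas_h(1,2) Ch[unfolded D_def] CG[unfolded D_def],
      folded D_def]
  note U = divergence_trapezoid_left[OF l s(2) x0(2) hu_eq[unfolded D_def] meas_h(3,4) Chu[unfolded D_def] CGu[unfolded D_def],
      folded D_def]
  have set_sum: "(LINT x:A|lborel. \<Sum>j\<in>UNIV. f j x) = (\<Sum>j\<in>UNIV. LINT x:A|lborel. f j x)"
    if "\<And>j. set_integrable lborel A (f j)" for f :: "'n \<Rightarrow> 'a::euclidean_space \<Rightarrow> real" and A
    using that unfolding set_lebesgue_integral_def set_integrable_def scaleR_sum_right
    by (rule Bochner_Integration.integral_sum)
  have integrable_sum: "set_integrable lborel A (\<lambda>x. \<Sum>j\<in>UNIV. f j x)"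
    if "\<And>j. set_integrable lborel A (f j)" for f :: "'n \<Rightarrow> 'a::euclidean_space \<Rightarrow> real" and A
    using that unfolding set_integrable_def scaleR_sum_right by (rule Bochner_Integration.integrable_sum)
  have F1: "F (x0 + l * s1) s1 = (\<Sum>j\<in>UNIV. LINT \<xi>:{0..x0 + l * s1}|lborel. h j \<xi> s1) + (LINT \<xi>:{0..x0 + l * s1}|lborel. hu \<xi> s1)"
    unfolding F_def set_sum[OF R(1), symmetric] by (simp add: h_def hu_def)
  have F2: "F (x0 + l * s2) s2 = (\<Sum>j\<in>UNIV. LINT \<xi>:{0..x0 + l * s2}|lborel. h j \<xi> s2) + (LINT \<xi>:{0..x0 + l * s2}|lborel. hu \<xi> s2)"
    unfolding F_def set_sum[OF R(2), symmetric] by (simp add: h_def hu_def)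
  have "(\<Sum>j\<in>UNIV. LINT p:D|lborel. G j (fst p) (snd p)) + (LINT p:D|lborel. Gu (fst p) (snd p)) =
      (LINT p:D|lborel. (\<Sum>j\<in>UNIV. G j (fst p) (snd p)) + Gu (fst p) (snd p))"
  proof (subst set_integral_add(2))
    show "set_integrable lborel D (\<lambda>p. \<Sum>j\<in>UNIV. G j (fst p) (snd p))"
      by (rule integrable_sum[OF R(5)])
  qed (use U(2) set_sum[OF R(5)] in auto)
  then have inner: "(\<Sum>j\<in>UNIV. LINT p:D|lborel. G j (fst p) (snd p)) + (LINT p:D|lborel. Gu (fst p) (snd p)) = 0"
    by (simp add: G_sum)
  have i0: "set_integrable lborel {s1..s2} (\<lambda>s. \<Sum>j\<in>UNIV. c j * h j 0 s)"
    using R(3) by (intro integrable_sum) simp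
  have "(\<Sum>j\<in>UNIV. c j * (LINT s:{s1..s2}|lborel. h j 0 s)) + l * (LINT s:{s1..s2}|lborel. hu 0 s) =
      (LINT s:{s1..s2}|lborel. (\<Sum>j\<in>UNIV. c j * h j 0 s) + l * hu 0 s)"
  proof (subst set_integral_add(2)[OF i0])
    show "set_integrable lborel {s1..s2} (\<lambda>s. l * hu 0 s)" using U(1) by simp
  qed (use R(3) in \<open>simp add: set_sum\<close>)
  also have "\<dots> = 0"
    unfolding set_lebesgue_integral_def
  proof (rule integral_eq_zero_AE)
    show "AE s in lborel. indicator {s1..s2} s *\<^sub>R ((\<Sum>j\<in>UNIV. c j * h j 0 s) + l * hu 0 s) = 0"
      using inlet
    proof eventually_elim
      case (elim t)
      show ?case
      proof (cases "t \<in> {s1..s2}")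
        case True
        then have "l * s2 \<le> l * t" "l * t \<le> l * s1" using l by auto
        then have x: "x0 + l * t \<in> {0..len}" using x0 by auto
        have "w j 0 t = q j * u 0 t" for j using elim True s by auto
        \<comment> \<open>By the inlet condition \<open>u 0 t\<close> factors out of the total flux,
          with the coefficient that \<open>L_inlet\<close> makes zero.\<close>
        then have "(\<Sum>j\<in>UNIV. c j * h j 0 t) + l * hu 0 t = ((\<Sum>j\<in>UNIV. K j (x0 + l * t) 0 * c j * q j) + l * L (x0 + l * t) 0) * u 0 t"
          by (simp add: h_def hu_def sum_distrib_right sum_distrib_left algebra_simps)
        then show ?thesis using L_inlet[OF x] by simp
      qed simp
    qed
  qed
  finally have left: "(\<Sum>j\<in>UNIV. c j * (LINT s:{s1..s2}|lborel. h j 0 s)) + l * (LINT s:{s1..s2}|lborel. hu 0 s) = 0" .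
  have "(\<Sum>j\<in>UNIV. (l - c j) * (LINT s:{s1..s2}|lborel. h j (x0 + l * s) s)) =
      (LINT s:{s1..s2}|lborel. \<Sum>j\<in>UNIV. (l - c j) * h j (x0 + l * s) s)"
    using R(4) by (simp add: set_sum del: mult_minus_left)
  also have "\<dots> = (LINT s:{s1..s2}|lborel. \<Sum>k\<in>UNIV. Smp k (x0 + l * s) * w k (x0 + l * s) s)"
    unfolding set_lebesgue_integral_def
  proof (rule integral_cong_AE)
    \<comment> \<open>The diagonal condition holds for almost every position; since
      \<open>l \<noteq> 0\<close> it holds at almost every time on the moving line.\<close>
    have "AE s in lborel. x0 + l * s \<in> {0..len} \<longrightarrow> (\<forall>j. (c j - l) * K j (x0 + l * s) (x0 + l * s) + Smp j (x0 + l * s) = 0)"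
      using AE_lborel_affine[OF K_diag less_imp_neq[OF l], of x0] by simp
    then show "AE s in lborel. indicator {s1..s2} s *\<^sub>R (\<Sum>j\<in>UNIV. (l - c j) * h j (x0 + l * s) s) =
        indicator {s1..s2} s *\<^sub>R (\<Sum>k\<in>UNIV. Smp k (x0 + l * s) * w k (x0 + l * s) s)"
    proof eventually_elim
      case (elim t)
      show ?case
      proof (cases "t \<in> {s1..s2}")
        case True
        then have "l * s2 \<le> l * t" "l * t \<le> l * s1" using l by auto
        then have x: "x0 + l * t \<in> {0..len}" using x0 by auto
        then have "(l - c j) * K j (x0 + l * t) (x0 + l * t) = Smp j (x0 + l * t)" for j
          using elim by (auto simp: algebra_simps)
        then show ?thesis by (simp add: h_def mult.assoc[symmetric] del: mult_minus_left)
      qed simp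
    qed
    show "(\<lambda>s. indicator {s1..s2} s *\<^sub>R (\<Sum>k\<in>UNIV. Smp k (x0 + l * s) * w k (x0 + l * s) s)) \<in> borel_measurable lborel"
      by (intro borel_measurable_scaleR borel_measurable_sum borel_measurable_times meas_comp) measurable
    show "(\<lambda>s. indicator {s1..s2} s *\<^sub>R (\<Sum>j\<in>UNIV. (l - c j) * h j (x0 + l * s) s)) \<in> borel_measurable lborel"
      unfolding h_def by (intro borel_measurable_scaleR borel_measurable_sum borel_measurable_times meas_comp) measurable
  qed
  finally have right: "(\<Sum>j\<in>UNIV. (l - c j) * (LINT s:{s1..s2}|lborel. h j (x0 + l * s) s)) =
    (LINT s:{s1..s2}|lborel. \<Sum>k\<in>UNIV. Smp k (x0 + l * s) * w k (x0 + l * s) s)" .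
  have R6: "(LINT \<xi>:{0..x0 + l * s2}|lborel. h j \<xi> s2) - (LINT \<xi>:{0..x0 + l * s1}|lborel. h j \<xi> s1) =
      (LINT p:D|lborel. G j (fst p) (snd p)) + c j * (LINT s:{s1..s2}|lborel. h j 0 s)
      + (l - c j) * (LINT s:{s1..s2}|lborel. h j (x0 + l * s) s)" for j
    unfolding R(6) by (simp add: left_diff_distrib)
  have "F (x0 + l * s2) s2 - F (x0 + l * s1) s1 =
      (\<Sum>j\<in>UNIV. (LINT \<xi>:{0..x0 + l * s2}|lborel. h j \<xi> s2) - (LINT \<xi>:{0..x0 + l * s1}|lborel. h j \<xi> s1))
      + ((LINT \<xi>:{0..x0 + l * s2}|lborel. hu \<xi> s2) - (LINT \<xi>:{0..x0 + l * s1}|lborel. hu \<xi> s1))"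
    unfolding F1 F2 by (simp add: sum_subtractf)
  also have "\<dots> = (\<Sum>j\<in>UNIV. LINT p:D|lborel. G j (fst p) (snd p)) + (\<Sum>j\<in>UNIV. c j * (LINT s:{s1..s2}|lborel. h j 0 s))
       + (\<Sum>j\<in>UNIV. (l - c j) * (LINT s:{s1..s2}|lborel. h j (x0 + l * s) s))
       + (LINT p:D|lborel. Gu (fst p) (snd p)) + l * (LINT s:{s1..s2}|lborel. hu 0 s)"
    unfolding R6 U(3) by (simp add: sum.distrib)
  also have "\<dots> = (LINT s:{s1..s2}|lborel. \<Sum>k\<in>UNIV. Smp k (x0 + l * s) * w k (x0 + l * s) s)"
    using inner left right by linarith
  finally show ?thesis .
qed

end

text \<open>Along the characteristics that start at the outlet the target variable \<open>u - F\<close> is constant, hence zero.\<close>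

lemma u_eq_F:
  "AE y in lborel. len \<le> y \<longrightarrow> (\<forall>t. (y + l * t, t) \<in> strip \<longrightarrow> u (y + l * t) t = F (y + l * t) t)"
proof -
  have "- (1 / l) \<noteq> 0" using l by simp
  \<comment> \<open>The line with intercept \<open>y\<close> is at the outlet at time
    \<open>(len - y) / l\<close>. As this is affine in \<open>y\<close>, a condition at almost every
    outlet time holds on almost every line.\<close>
  from AE_lborel_affine[OF outlet this, of "len / l"] u_eq[unfolded deriv_along_def]
  show ?thesis
  proof eventually_elim
    case (elim y)
    show ?case
    proof (intro impI allI)
      fix t
      assume y: "len \<le> y" and t: "(y + l * t, t) \<in> strip"
      define s0 where "s0 = (len - y) / l"
      have s0: "len / l + - (1 / l) * y = s0" "y + l * s0 = len" using l by (simp_all add: s0_def field_simps)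
      have s0_pos: "0 \<le> s0" using y l by (simp add: s0_def divide_nonpos_neg)
      have s0t: "s0 \<le> t"
      proof -
        have "y + l * t \<le> y + l * s0" using t s0 by (auto simp: strip_def)
        then show ?thesis using l by simp
      qed
      have out: "u len s0 = F len s0" using elim(1) s0 s0_pos by (simp add: F_def)
      show "u (y + l * t) t = F (y + l * t) t"
      \<comment> \<open>\<open>F_increment\<close> requires a trapezoid of positive height.\<close>
      proof (cases "s0 = t")
        case True
        then show ?thesis using out s0 by simp
      next
        case False
        have "(y + l * s0, 1 * s0) \<in> strip" using s0 s0_pos len by (simp add: strip_def)
        then have "u (y + l * t) t - u (y + l * s0) s0 =
            (LINT \<sigma>:{s0..t}|lborel. \<Sum>k\<in>UNIV. Smp k (y + l * \<sigma>) * w k (y + l * \<sigma>) \<sigma>)"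
          using elim(2)[rule_format, of s0 t] s0t t by simp
        moreover have "F (y + l * t) t - F (y + l * s0) s0 =
            (LINT \<sigma>:{s0..t}|lborel. \<Sum>k\<in>UNIV. Smp k (y + l * \<sigma>) * w k (y + l * \<sigma>) \<sigma>)"
          using False s0t s0 s0_pos t by (intro F_increment) (auto simp: strip_def)
        ultimately show ?thesis using out s0 by simp
      qed
    qed
  qed
qed

text \<open>The travel time of \<open>u\<close> from the outlet to the inlet.\<close>

definition t0 :: real where "t0 = len / - l"

lemma t0_pos: "0 < t0"
  using len l by (simp add: t0_def divide_pos_neg)

text \<open>The characteristic of \<open>u\<close> through \<open>(0, t)\<close> has intercept
  \<open>- l * t\<close>, which is at least \<open>len\<close> exactly when
  \<open>t0 \<le> t\<close>. There \<open>u\<close> equals \<open>F 0 t\<close>, an integral over a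
  single point, and the inlet condition passes the zero on to \<open>w\<close>.\<close>

lemma inlet_zero: "AE t in lborel. t0 \<le> t \<longrightarrow> u 0 t = 0 \<and> (\<forall>j. w j 0 t = 0)"
proof -
  have "- l \<noteq> 0" using l by simp
  from AE_lborel_affine[OF u_eq_F this, of 0] inlet
  show ?thesis
  proof eventually_elim
    case (elim t)
    show ?case
    proof
      assume t: "t0 \<le> t"
      then have "len \<le> - l * t" using l by (simp add: t0_def field_simps)
      moreover have "(0, t) \<in> strip" using t t0_pos len by (simp add: strip_def)
      ultimately have "u 0 t = F 0 t" using elim(1) by (auto dest!: spec[of _ t])
      also have "\<dots> = 0" by (simp add: F_def set_integral_trivial)
      finally show "u 0 t = 0 \<and> (\<forall>j. w j 0 t = 0)" using elim(2) t t0_pos by simp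
    qed
  qed
qed

end

section \<open>Integrals with an exponential weight\<close>

lemma nn_integral_exp_tail:
  fixes M \<xi> :: real
  assumes "0 < M"
  shows "(\<integral>\<^sup>+x. ennreal (exp (- M * x)) * indicator {\<xi>..} x \<partial>lborel) = ennreal (exp (- M * \<xi>) / M)"
proof -
  have "(\<integral>\<^sup>+x. ennreal (exp (- M * x)) * indicator {\<xi>..} x \<partial>lborel) = ennreal (0 - (- exp (- M * \<xi>) / M))"
  proof (rule nn_integral_FTC_atLeast)
    show "((\<lambda>x. - exp (- M * x) / M) has_real_derivative exp (- M * x)) (at x)" for x
      using assms by (auto intro!: derivative_eq_intros simp: field_simps)
    have "((\<lambda>x. - exp (- M * x) / M) \<longlongrightarrow> - 0 / M) at_top"
      using assms
      by (intro tendsto_intros filterlim_compose[OF exp_at_bot] filterlim_tendsto_neg_mult_at_bot[OF tendsto_const _ filterlim_ident]) auto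
    then show "((\<lambda>x. - exp (- M * x) / M) \<longlongrightarrow> 0) at_top" by simp
  qed auto
  then show ?thesis by simp
qed

text \<open>The exponential weight makes the Volterra operator \<open>f \<mapsto> \<integral>\<^bsub>-\<infinity>\<^esub>\<^bsup>x\<^esup> f\<close> a contraction for large \<open>M\<close>.\<close>

lemma nn_integral_weighted_Volterra:
  fixes M :: real and f :: "real \<Rightarrow> ennreal"
  assumes "0 < M" and [measurable]: "f \<in> borel_measurable borel"
  shows "(\<integral>\<^sup>+x. ennreal (exp (- M * x)) * (\<integral>\<^sup>+\<xi>. f \<xi> * indicator {..x} \<xi> \<partial>lborel) \<partial>lborel) =
    ennreal (1 / M) * (\<integral>\<^sup>+\<xi>. ennreal (exp (- M * \<xi>)) * f \<xi> \<partial>lborel)"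
proof -
  have [measurable]: "{p. snd p \<le> fst p} \<in> sets ((borel :: real measure) \<Otimes>\<^sub>M (borel :: real measure))"
    unfolding borel_prod by (intro borel_closed closed_Collect_le continuous_intros)
  have ind: "indicator {..x} \<xi> = (indicator {p. snd p \<le> fst p} (x, \<xi>) :: ennreal)" for x \<xi> :: real
    by (auto simp: indicator_def)
  have ind': "indicator {..x} \<xi> = (indicator {\<xi>..} x :: ennreal)" for x \<xi> :: real
    by (auto simp: indicator_def)
  have "(\<integral>\<^sup>+x. ennreal (exp (- M * x)) * (\<integral>\<^sup>+\<xi>. f \<xi> * indicator {..x} \<xi> \<partial>lborel) \<partial>lborel) =
      (\<integral>\<^sup>+x. \<integral>\<^sup>+\<xi>. ennreal (exp (- M * x)) * (f \<xi> * indicator {..x} \<xi>) \<partial>lborel \<partial>lborel)"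
    by (intro nn_integral_cong nn_integral_cmult[symmetric]) auto
  also have "\<dots> = (\<integral>\<^sup>+\<xi>. \<integral>\<^sup>+x. ennreal (exp (- M * x)) * (f \<xi> * indicator {..x} \<xi>) \<partial>lborel \<partial>lborel)"
    unfolding ind by (rule lborel_pair.Fubini'[symmetric]) measurable
  also have "\<dots> = (\<integral>\<^sup>+\<xi>. f \<xi> * (\<integral>\<^sup>+x. ennreal (exp (- M * x)) * indicator {\<xi>..} x \<partial>lborel) \<partial>lborel)"
    unfolding ind' by (subst nn_integral_cmult[symmetric]) (auto simp: mult_ac)
  also have "\<dots> = (\<integral>\<^sup>+\<xi>. ennreal (1 / M) * (ennreal (exp (- M * \<xi>)) * f \<xi>) \<partial>lborel)"
    unfolding nn_integral_exp_tail[OF \<open>0 < M\<close>]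
  proof (intro nn_integral_cong)
    fix \<xi> :: real
    have "ennreal (exp (- M * \<xi>) / M) = ennreal (1 / M) * ennreal (exp (- M * \<xi>))"
      using \<open>0 < M\<close> by (subst ennreal_mult[symmetric]) auto
    then show "f \<xi> * ennreal (exp (- M * \<xi>) / M) = ennreal (1 / M) * (ennreal (exp (- M * \<xi>)) * f \<xi>)"
      by (simp add: mult_ac)
  qed
  also have "\<dots> = ennreal (1 / M) * (\<integral>\<^sup>+\<xi>. ennreal (exp (- M * \<xi>)) * f \<xi> \<partial>lborel)"
    by (rule nn_integral_cmult) measurable
  finally show ?thesis .
qed

text \<open>If \<open>f\<close> is not integrable, its Bochner integral is 0 by convention. Hence
  the estimates below can do without integrability side conditions.\<close>

lemma ennreal_abs_integral_le: "ennreal \<bar>LINT x|M. f x\<bar> \<le> (\<integral>\<^sup>+x. ennreal \<bar>f x\<bar> \<partial>M)"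
proof (cases "integrable M f")
  case True
  then show ?thesis using integral_norm_bound_ennreal[of M f] by simp
next
  case False
  then show ?thesis by (simp add: not_integrable_integral_eq)
qed

section \<open>Volterra inequalities after the inlet has become quiet\<close>

context backstepping
begin

context
  fixes T :: real
begin

text \<open>The lower edge starts at \<open>(0, t0)\<close> and has the slope \<open>1 / v\<close>
  of the slowest component of \<open>w\<close>. Two kinds of dependence stay inside: backwards along
  characteristics of \<open>w\<close> down to the inlet, and leftwards at fixed time, as needed for
  \<open>F\<close>. The cut at \<open>T\<close> makes the set bounded.\<close>

definition "R = {(x, t). 0 \<le> x \<and> x \<le> len \<and> t0 + x / v \<le> t \<and> t \<le> T}"

definition "magn x t = (\<Sum>j\<in>UNIV. \<bar>w j x t\<bar>) + \<bar>u x t\<bar>"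

text \<open>With \<open>ennreal\<close> values and zero outside \<open>R\<close>, the integrals
  below may run over whole half-lines.\<close>

definition "W x t = ennreal (magn x t) * indicator R (x, t)"

lemma magn_nonneg: "0 \<le> magn x t"
  by (auto simp: magn_def intro: add_nonneg_nonneg sum_nonneg)

lemma R_closed: "closed R"
proof -
  have eq: "R = {p. 0 \<le> fst p} \<inter> {p. fst p \<le> len} \<inter> {p. t0 + fst p / v \<le> snd p} \<inter> {p. snd p \<le> T}"
    by (auto simp: R_def)
  show ?thesis unfolding eq using v by (intro closed_Int closed_Collect_le continuous_intros) auto
qed

lemma R_sets [measurable]: "R \<in> sets borel" "R \<in> sets (borel \<Otimes>\<^sub>M borel)"
  unfolding borel_prod using R_closed by (rule borel_closed)+

lemma magn_meas [measurable]:
  assumes [measurable]: "a \<in> borel_measurable M" "b \<in> borel_measurable M"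
  shows "(\<lambda>x. magn (a x) (b x)) \<in> borel_measurable M"
proof -
  note [measurable] = meas_comp[OF assms]
  show ?thesis unfolding magn_def by measurable
qed

lemma W_meas [measurable]:
  assumes [measurable]: "a \<in> borel_measurable M" "b \<in> borel_measurable M"
  shows "(\<lambda>x. W (a x) (b x)) \<in> borel_measurable M"
  unfolding W_def by measurable

lemma R_subset: "R \<subseteq> {0..len} \<times> {0..T}" "R \<subseteq> strip"
proof -
  have "0 \<le> t" if "(x, t) \<in> R" for x t
  proof -
    have "0 \<le> x / v" using that v by (auto simp: R_def)
    then show ?thesis using that t0_pos by (auto simp: R_def)
  qed
  then show "R \<subseteq> {0..len} \<times> {0..T}" "R \<subseteq> strip" by (auto simp: R_def strip_def)
qed

lemma w_rate_bound:
  assumes "0 \<le> B" "\<forall>j k. \<forall>x\<in>{0..len}. \<bar>Spp j k x\<bar> \<le> B \<and> \<bar>Spm j x\<bar> \<le> B \<and> \<bar>Smp j x\<bar> \<le> B" "x \<in> {0..len}"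
  shows "\<bar>(\<Sum>k\<in>UNIV. Spp j k x * w k x t) + Spm j x * u x t\<bar> \<le> B * magn x t"
proof -
  have "\<bar>(\<Sum>k\<in>UNIV. Spp j k x * w k x t) + Spm j x * u x t\<bar> \<le> (\<Sum>k\<in>UNIV. \<bar>Spp j k x * w k x t\<bar>) + \<bar>Spm j x * u x t\<bar>"
    using abs_triangle_ineq[of "\<Sum>k\<in>UNIV. Spp j k x * w k x t" "Spm j x * u x t"] sum_abs[of "\<lambda>k. Spp j k x * w k x t" UNIV]
    by linarith
  also have "\<dots> \<le> (\<Sum>k\<in>UNIV. B * \<bar>w k x t\<bar>) + B * \<bar>u x t\<bar>"
    unfolding abs_mult using assms by (intro add_mono sum_mono mult_right_mono) auto
  finally show ?thesis by (simp add: magn_def sum_distrib_left distrib_left)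
qed

text \<open>This is where \<open>v\<close> has to be a lower bound of the speeds.\<close>

lemma R_backwards:
  assumes "(y + c j * r, r) \<in> R" "- y / c j \<le> \<sigma>" "\<sigma> \<le> r"
  shows "(y + c j * \<sigma>, \<sigma>) \<in> R"
proof -
  note R = assms(1)[unfolded R_def, simplified]
  have "0 \<le> y + c j * \<sigma>" using assms(2) c_pos[of j] by (simp add: field_simps)
  moreover have "c j * \<sigma> \<le> c j * r" using assms(3) c_pos[of j] by simp
  moreover have "t0 + (y + c j * \<sigma>) / v \<le> \<sigma>"
  proof -
    have "(r - \<sigma>) * v \<le> (r - \<sigma>) * c j" using vc[of j] assms(3) by (intro mult_left_mono) auto
    then have "r - \<sigma> \<le> (r - \<sigma>) * c j / v" using v by (simp only: pos_le_divide_eq)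
    also have "\<dots> = (y + c j * r) / v - (y + c j * \<sigma>) / v"
      unfolding diff_divide_distrib[symmetric] by (simp add: algebra_simps)
    finally show ?thesis using R by linarith
  qed
  ultimately show ?thesis using R assms(3) by (auto simp: R_def)
qed

text \<open>\<open>R_backwards\<close> keeps the characteristic in \<open>R\<close> down to the
  inlet, so its entry time \<open>r0\<close> is at least \<open>t0\<close>, and
  \<open>inlet_zero\<close> makes \<open>w j\<close> start from zero there. What it picks up
  afterwards is bounded by \<open>w_rate_bound\<close>.\<close>

lemma w_bound:
  assumes B: "0 \<le> B" "\<forall>j k. \<forall>x\<in>{0..len}. \<bar>Spp j k x\<bar> \<le> B \<and> \<bar>Spm j x\<bar> \<le> B \<and> \<bar>Smp j x\<bar> \<le> B"
  shows "AE y in lborel. \<forall>r. ennreal \<bar>w j (y + c j * r) r\<bar> * indicator R (y + c j * r, r) \<le>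
    ennreal B * (\<integral>\<^sup>+\<sigma>. W (y + c j * \<sigma>) \<sigma> * indicator {..r} \<sigma> \<partial>lborel)"
proof -
  have "- (1 / c j) \<noteq> 0" using c_pos[of j] by simp
  from AE_lborel_affine[OF inlet_zero this, of 0] w_eq[of j, unfolded deriv_along_def]
  show ?thesis
  proof eventually_elim
    case (elim y)
    show ?case
    proof
      fix r
      show "ennreal \<bar>w j (y + c j * r) r\<bar> * indicator R (y + c j * r, r) \<le>
        ennreal B * (\<integral>\<^sup>+\<sigma>. W (y + c j * \<sigma>) \<sigma> * indicator {..r} \<sigma> \<partial>lborel)"
      proof (cases "(y + c j * r, r) \<in> R")
        case True
        define r0 where "r0 = - y / c j"
        have r0: "y + c j * r0 = 0" using c_pos[of j] by (simp add: r0_def)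
        have r0r: "r0 \<le> r" using True c_pos[of j] by (auto simp: r0_def R_def field_simps)
        have inR: "(y + c j * \<sigma>, \<sigma>) \<in> R" if "r0 \<le> \<sigma>" "\<sigma> \<le> r" for \<sigma>
          using R_backwards[OF True] that by (simp add: r0_def)
        have "t0 \<le> r0" using inR[of r0] r0r r0 by (simp add: R_def)
        then have w0: "w j 0 r0 = 0" using elim(1) by (simp add: r0_def)
        define g where "g \<sigma> = (\<Sum>k\<in>UNIV. Spp j k (y + c j * \<sigma>) * w k (y + c j * \<sigma>) \<sigma>) + Spm j (y + c j * \<sigma>) * u (y + c j * \<sigma>) \<sigma>" for \<sigma>
        have "w j (y + c j * r) r = (LINT \<sigma>:{r0..r}|lborel. g \<sigma>)"
          using elim(2)[rule_format, of r0 r] inR[of r0] inR[of r] r0r R_subset(2) w0 r0 by (auto simp: g_def)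
        then have "ennreal \<bar>w j (y + c j * r) r\<bar> \<le> (\<integral>\<^sup>+\<sigma>. ennreal \<bar>indicator {r0..r} \<sigma> *\<^sub>R g \<sigma>\<bar> \<partial>lborel)"
          using ennreal_abs_integral_le unfolding set_lebesgue_integral_def by simp
        also have "\<dots> \<le> (\<integral>\<^sup>+\<sigma>. ennreal B * (W (y + c j * \<sigma>) \<sigma> * indicator {..r} \<sigma>) \<partial>lborel)"
        proof (rule nn_integral_mono)
          fix \<sigma>
          show "ennreal \<bar>indicator {r0..r} \<sigma> *\<^sub>R g \<sigma>\<bar> \<le> ennreal B * (W (y + c j * \<sigma>) \<sigma> * indicator {..r} \<sigma>)"
          proof (cases "\<sigma> \<in> {r0..r}")
            case s: True
            then have R: "(y + c j * \<sigma>, \<sigma>) \<in> R" using inR by auto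
            then have "\<bar>g \<sigma>\<bar> \<le> B * magn (y + c j * \<sigma>) \<sigma>"
              unfolding g_def by (intro w_rate_bound[OF B]) (auto simp: R_def)
            then have "ennreal \<bar>g \<sigma>\<bar> \<le> ennreal B * ennreal (magn (y + c j * \<sigma>) \<sigma>)"
              using B(1) magn_nonneg by (simp add: ennreal_mult[symmetric] ennreal_leI)
            then show ?thesis using s R by (simp add: W_def)
          qed simp
        qed
        also have "\<dots> = ennreal B * (\<integral>\<^sup>+\<sigma>. W (y + c j * \<sigma>) \<sigma> * indicator {..r} \<sigma> \<partial>lborel)"
          by (rule nn_integral_cmult) measurable
        finally show ?thesis using True by simp
      qed simp
    qed
  qed
qed

text \<open>On \<open>R\<close> the identity \<open>u_eq_F\<close> applies, and bounded kernels make
  \<open>F\<close> a Volterra integral in the position. The whole segment from the inlet to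
  \<open>(x, t)\<close> lies in \<open>R\<close>, so \<open>W\<close> sees the full state on
  it.\<close>

lemma u_bound:
  obtains C where "0 \<le> C"
    "AE p in lborel. ennreal \<bar>u (fst p) (snd p)\<bar> * indicator R p \<le>
      ennreal C * (\<integral>\<^sup>+\<xi>. W \<xi> (snd p) * indicator {..fst p} \<xi> \<partial>lborel)"
proof -
  have "\<forall>j. \<exists>C. AE p in lborel. p \<in> tri \<longrightarrow> \<bar>K j (fst p) (snd p)\<bar> \<le> C"
    using kernel_bounded(1) unfolding ess_bounded_def by blast
  from choice[OF this] obtain CK where "\<forall>j. AE p in lborel. p \<in> tri \<longrightarrow> \<bar>K j (fst p) (snd p)\<bar> \<le> CK j" ..
  then have CK: "AE p in lborel. \<forall>j\<in>UNIV. p \<in> tri \<longrightarrow> \<bar>K j (fst p) (snd p)\<bar> \<le> CK j"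
    by (intro AE_finite_allI) auto
  obtain CL where CL: "AE p in lborel. p \<in> tri \<longrightarrow> \<bar>L (fst p) (snd p)\<bar> \<le> CL"
    using kernel_bounded(2) unfolding ess_bounded_def by blast
  define C where "C = (\<Sum>j\<in>UNIV. \<bar>CK j\<bar>) + \<bar>CL\<bar>"
  have C: "0 \<le> C" by (auto simp: C_def intro: add_nonneg_nonneg sum_nonneg)
  have CKC: "CK j \<le> C" for j
    using member_le_sum[of j UNIV "\<lambda>j. \<bar>CK j\<bar>"] unfolding C_def by auto
  have "0 \<le> (\<Sum>j\<in>UNIV. \<bar>CK j\<bar>)" by (simp add: sum_nonneg)
  then have CLC: "CL \<le> C" unfolding C_def by linarith
  have "AE p in lborel. (fst p, snd p) \<in> tri \<longrightarrow> (\<forall>j. \<bar>K j (fst p) (snd p)\<bar> \<le> C) \<and> \<bar>L (fst p) (snd p)\<bar> \<le> C"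
    using CK CL
  proof eventually_elim
    case (elim p)
    then show ?case using CKC CLC by (auto intro: order_trans)
  qed
  from AE_product_sections(1)[where Q = "\<lambda>x \<xi>. (x, \<xi>) \<in> tri \<longrightarrow> (\<forall>j. \<bar>K j x \<xi>\<bar> \<le> C) \<and> \<bar>L x \<xi>\<bar> \<le> C", OF this]
  have "AE x in lborel. AE \<xi> in lborel. (x, \<xi>) \<in> tri \<longrightarrow> (\<forall>j. \<bar>K j x \<xi>\<bar> \<le> C) \<and> \<bar>L x \<xi>\<bar> \<le> C" .
  \<comment> \<open>The kernel bound is a condition on the position \<open>x\<close> alone, the
    identity \<open>u = F\<close> one on the intercept \<open>x - l * t\<close>.\<close>
  from AE_line_plane[OF this, of 0] AE_line_plane[OF u_eq_F, of "- l"]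
  have "AE p in lborel. ennreal \<bar>u (fst p) (snd p)\<bar> * indicator R p \<le>
      ennreal C * (\<integral>\<^sup>+\<xi>. W \<xi> (snd p) * indicator {..fst p} \<xi> \<partial>lborel)"
  proof eventually_elim
    case (elim p)
    obtain x t where p: "p = (x, t)" by (cases p)
    show ?case
    proof (cases "p \<in> R")
      case True
      then have xt: "0 \<le> x" "x \<le> len" "t0 + x / v \<le> t" "t \<le> T" by (auto simp: p R_def)
      have "t0 \<le> t" using xt v by (smt (verit) divide_nonneg_pos)
      then have "len \<le> x + - l * t" using l xt by (simp add: t0_def field_simps)
      then have "u x t = F x t" using elim(2) True R_subset(2) by (auto simp: p dest!: spec[of _ t])
      also have "\<bar>F x t\<bar> \<le> \<bar>LINT \<xi>:{0..x}|lborel. \<Sum>j\<in>UNIV. K j x \<xi> * w j \<xi> t\<bar> + \<bar>LINT \<xi>:{0..x}|lborel. L x \<xi> * u \<xi> t\<bar>"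
        unfolding F_def by (rule abs_triangle_ineq)
      finally have "ennreal \<bar>u x t\<bar> \<le> ennreal \<bar>LINT \<xi>:{0..x}|lborel. \<Sum>j\<in>UNIV. K j x \<xi> * w j \<xi> t\<bar>
          + ennreal \<bar>LINT \<xi>:{0..x}|lborel. L x \<xi> * u \<xi> t\<bar>"
        by (simp add: ennreal_plus[symmetric] ennreal_leI del: ennreal_plus)
      also have "\<dots> \<le> (\<integral>\<^sup>+\<xi>. ennreal \<bar>indicator {0..x} \<xi> *\<^sub>R (\<Sum>j\<in>UNIV. K j x \<xi> * w j \<xi> t)\<bar> \<partial>lborel)
          + (\<integral>\<^sup>+\<xi>. ennreal \<bar>indicator {0..x} \<xi> *\<^sub>R (L x \<xi> * u \<xi> t)\<bar> \<partial>lborel)"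
        unfolding set_lebesgue_integral_def by (intro add_mono ennreal_abs_integral_le)
      also have "\<dots> = (\<integral>\<^sup>+\<xi>. ennreal \<bar>indicator {0..x} \<xi> *\<^sub>R (\<Sum>j\<in>UNIV. K j x \<xi> * w j \<xi> t)\<bar>
          + ennreal \<bar>indicator {0..x} \<xi> *\<^sub>R (L x \<xi> * u \<xi> t)\<bar> \<partial>lborel)"
      proof (rule nn_integral_add[symmetric])
        have [measurable]: "(\<lambda>\<xi>. K j x \<xi>) \<in> borel_measurable borel" "(\<lambda>\<xi>. w j \<xi> t) \<in> borel_measurable borel"
          "(\<lambda>\<xi>. L x \<xi>) \<in> borel_measurable borel" "(\<lambda>\<xi>. u \<xi> t) \<in> borel_measurable borel" for j
          by (intro meas_comp; measurable)+
        show "(\<lambda>\<xi>. ennreal \<bar>indicator {0..x} \<xi> *\<^sub>R (\<Sum>j\<in>UNIV. K j x \<xi> * w j \<xi> t)\<bar>) \<in> borel_measurable lborel"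
          "(\<lambda>\<xi>. ennreal \<bar>indicator {0..x} \<xi> *\<^sub>R (L x \<xi> * u \<xi> t)\<bar>) \<in> borel_measurable lborel"
          by measurable
      qed
      also have "\<dots> \<le> (\<integral>\<^sup>+\<xi>. ennreal C * (W \<xi> t * indicator {..x} \<xi>) \<partial>lborel)"
      proof (rule nn_integral_mono_AE)
        have "AE \<xi> in lborel. (x, \<xi>) \<in> tri \<longrightarrow> (\<forall>j. \<bar>K j x \<xi>\<bar> \<le> C) \<and> \<bar>L x \<xi>\<bar> \<le> C"
          using elim(1) by (simp add: p)
        then show "AE \<xi> in lborel. ennreal \<bar>indicator {0..x} \<xi> *\<^sub>R (\<Sum>j\<in>UNIV. K j x \<xi> * w j \<xi> t)\<bar>
            + ennreal \<bar>indicator {0..x} \<xi> *\<^sub>R (L x \<xi> * u \<xi> t)\<bar> \<le> ennreal C * (W \<xi> t * indicator {..x} \<xi>)"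
        proof eventually_elim
          case (elim \<xi>)
          show ?case
          proof (cases "\<xi> \<in> {0..x}")
            case \<xi>: True
            then have tri: "(x, \<xi>) \<in> tri" using xt by (simp add: tri_def)
            have "\<xi> / v \<le> x / v" using \<xi> v by (simp add: divide_right_mono)
            then have R: "(\<xi>, t) \<in> R" using \<xi> xt by (simp add: R_def)
            have "\<bar>\<Sum>j\<in>UNIV. K j x \<xi> * w j \<xi> t\<bar> \<le> (\<Sum>j\<in>UNIV. \<bar>K j x \<xi> * w j \<xi> t\<bar>)" by (rule sum_abs)
            also have "\<dots> \<le> (\<Sum>j\<in>UNIV. C * \<bar>w j \<xi> t\<bar>)"
              unfolding abs_mult using elim tri by (intro sum_mono mult_right_mono) auto
            finally have 1: "\<bar>\<Sum>j\<in>UNIV. K j x \<xi> * w j \<xi> t\<bar> \<le> C * (\<Sum>j\<in>UNIV. \<bar>w j \<xi> t\<bar>)" by (simp add: sum_distrib_left)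
            have 2: "\<bar>L x \<xi> * u \<xi> t\<bar> \<le> C * \<bar>u \<xi> t\<bar>"
              unfolding abs_mult using elim tri by (intro mult_right_mono) auto
            have "\<bar>\<Sum>j\<in>UNIV. K j x \<xi> * w j \<xi> t\<bar> + \<bar>L x \<xi> * u \<xi> t\<bar> \<le> C * magn \<xi> t"
              using 1 2 by (simp add: magn_def distrib_left)
            then have "ennreal \<bar>\<Sum>j\<in>UNIV. K j x \<xi> * w j \<xi> t\<bar> + ennreal \<bar>L x \<xi> * u \<xi> t\<bar> \<le> ennreal C * ennreal (magn \<xi> t)"
              using C magn_nonneg by (simp add: ennreal_mult[symmetric] ennreal_plus[symmetric] ennreal_leI del: ennreal_plus)
            then show ?thesis using \<xi> R by (simp add: W_def)
          qed simp
        qed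
      qed
      also have "\<dots> = ennreal C * (\<integral>\<^sup>+\<xi>. W \<xi> t * indicator {..x} \<xi> \<partial>lborel)"
        by (rule nn_integral_cmult) measurable
      finally show ?thesis using True by (simp add: p)
    qed simp
  qed
  with C show thesis by (rule that)
qed

end

end

section \<open>Contraction in the weighted norm\<close>

lemma nn_integral_plane:
  fixes f :: "real \<Rightarrow> real \<Rightarrow> ennreal"
  assumes "(\<lambda>p. f (fst p) (snd p)) \<in> borel_measurable borel"
  shows "(\<integral>\<^sup>+p. f (fst p) (snd p) \<partial>lborel) = (\<integral>\<^sup>+t. \<integral>\<^sup>+x. f x t \<partial>lborel \<partial>lborel)"
proof -
  have "(\<lambda>p. f (fst p) (snd p)) \<in> borel_measurable (lborel \<Otimes>\<^sub>M lborel)"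
    using assms by (simp only: lborel_prod measurable_lborel2)
  from lborel_pair.nn_integral_snd[OF this] show ?thesis
    unfolding lborel_prod by simp
qed

lemma fst_snd_borel [measurable]:
  "(fst :: real \<times> real \<Rightarrow> real) \<in> borel_measurable borel" "(snd :: real \<times> real \<Rightarrow> real) \<in> borel_measurable borel"
  unfolding borel_prod[symmetric] by measurable

context backstepping
begin

context
  fixes T :: real
begin

lemma R_pred [measurable]:
  assumes [measurable]: "a \<in> borel_measurable M" "b \<in> borel_measurable M"
  shows "(\<lambda>x. indicator (R T) (a x, b x) :: ennreal) \<in> borel_measurable M"
  using R_sets[of T] by measurable

text \<open>A weighted \<open>L1\<close> norm of the state over \<open>R T\<close>. An
  \<open>L1\<close> norm allows each component to be integrated in its own characteristic
  coordinates.\<close>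

definition "N M = (\<integral>\<^sup>+p. ennreal (exp (- M * fst p)) * W T (fst p) (snd p) \<partial>lborel)"

text \<open>On the line with intercept \<open>y\<close> the position is \<open>y + c j * r\<close>,
  so the weight factors into \<open>exp (- M * y)\<close> and \<open>exp (- (M * c j) * r)\<close>.
  The Volterra estimate in \<open>r\<close> with exponent \<open>M * c j\<close> then yields the
  constant \<open>B / (M * c j)\<close>, and shearing back restores \<open>N M\<close>.\<close>

lemma w_weighted_bound:
  assumes M: "0 < M" and B: "0 \<le> B" "\<forall>j k. \<forall>x\<in>{0..len}. \<bar>Spp j k x\<bar> \<le> B \<and> \<bar>Spm j x\<bar> \<le> B \<and> \<bar>Smp j x\<bar> \<le> B"
  shows "(\<integral>\<^sup>+p. ennreal (exp (- M * fst p)) * (ennreal \<bar>w j (fst p) (snd p)\<bar> * indicator (R T) (fst p, snd p)) \<partial>lborel)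
    \<le> ennreal (B / (M * c j)) * N M"
proof -
  define f where "f x r = ennreal (exp (- M * x)) * (ennreal \<bar>w j x r\<bar> * indicator (R T) (x, r))" for x r
  have [measurable]: "(\<lambda>p. w j (fst p) (snd p)) \<in> borel_measurable borel" by (rule meas)
  have f: "case_prod f \<in> borel_measurable borel" unfolding f_def case_prod_unfold by measurable
  have W: "(\<lambda>(x, r). ennreal (exp (- M * x)) * W T x r) \<in> borel_measurable borel"
    unfolding case_prod_unfold by measurable
  have Mc: "0 < M * c j" using M c_pos[of j] by simp
  have "(\<integral>\<^sup>+p. f (fst p) (snd p) \<partial>lborel) = (\<integral>\<^sup>+y. \<integral>\<^sup>+r. f (y + c j * r) r \<partial>lborel \<partial>lborel)"
    by (rule nn_integral_shear[symmetric, OF f])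
  also have "\<dots> \<le> (\<integral>\<^sup>+y. \<integral>\<^sup>+r. ennreal (exp (- (M * c j) * r)) *
      (\<integral>\<^sup>+\<sigma>. ennreal (exp (- M * y) * B) * W T (y + c j * \<sigma>) \<sigma> * indicator {..r} \<sigma> \<partial>lborel) \<partial>lborel \<partial>lborel)"
  proof (rule nn_integral_mono_AE)
    show "AE y in lborel. (\<integral>\<^sup>+r. f (y + c j * r) r \<partial>lborel) \<le> (\<integral>\<^sup>+r. ennreal (exp (- (M * c j) * r)) *
      (\<integral>\<^sup>+\<sigma>. ennreal (exp (- M * y) * B) * W T (y + c j * \<sigma>) \<sigma> * indicator {..r} \<sigma> \<partial>lborel) \<partial>lborel)"
      using w_bound[OF B, of j T]
    proof eventually_elim
      case (elim y)
      show ?case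
      proof (rule nn_integral_mono)
        fix r
        have "f (y + c j * r) r \<le> ennreal (exp (- M * (y + c j * r))) *
            (ennreal B * (\<integral>\<^sup>+\<sigma>. W T (y + c j * \<sigma>) \<sigma> * indicator {..r} \<sigma> \<partial>lborel))"
          unfolding f_def using elim by (intro mult_left_mono) auto
        also have "ennreal (exp (- M * (y + c j * r))) = ennreal (exp (- (M * c j) * r)) * ennreal (exp (- M * y))"
          by (simp add: ennreal_mult[symmetric] exp_add[symmetric] algebra_simps)
        also have "ennreal (exp (- (M * c j) * r)) * ennreal (exp (- M * y)) *
            (ennreal B * (\<integral>\<^sup>+\<sigma>. W T (y + c j * \<sigma>) \<sigma> * indicator {..r} \<sigma> \<partial>lborel)) =
            ennreal (exp (- (M * c j) * r)) * (ennreal (exp (- M * y) * B) * (\<integral>\<^sup>+\<sigma>. W T (y + c j * \<sigma>) \<sigma> * indicator {..r} \<sigma> \<partial>lborel))"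
          using B by (simp add: ennreal_mult mult.assoc)
        also have "ennreal (exp (- M * y) * B) * (\<integral>\<^sup>+\<sigma>. W T (y + c j * \<sigma>) \<sigma> * indicator {..r} \<sigma> \<partial>lborel) =
            (\<integral>\<^sup>+\<sigma>. ennreal (exp (- M * y) * B) * (W T (y + c j * \<sigma>) \<sigma> * indicator {..r} \<sigma>) \<partial>lborel)"
          by (rule nn_integral_cmult[symmetric]) measurable
        finally show "f (y + c j * r) r \<le> ennreal (exp (- (M * c j) * r)) *
          (\<integral>\<^sup>+\<sigma>. ennreal (exp (- M * y) * B) * W T (y + c j * \<sigma>) \<sigma> * indicator {..r} \<sigma> \<partial>lborel)"
          by (simp add: mult.assoc)
      qed
    qed
  qed
  also have "\<dots> = (\<integral>\<^sup>+y. ennreal (1 / (M * c j)) *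
      (\<integral>\<^sup>+\<sigma>. ennreal (exp (- (M * c j) * \<sigma>)) * (ennreal (exp (- M * y) * B) * W T (y + c j * \<sigma>) \<sigma>) \<partial>lborel) \<partial>lborel)"
    by (intro nn_integral_cong nn_integral_weighted_Volterra Mc) measurable
  also have "\<dots> = (\<integral>\<^sup>+y. ennreal (B / (M * c j)) * (\<integral>\<^sup>+\<sigma>. ennreal (exp (- M * (y + c j * \<sigma>))) * W T (y + c j * \<sigma>) \<sigma> \<partial>lborel) \<partial>lborel)"
  proof (rule nn_integral_cong)
    fix y
    have "(\<integral>\<^sup>+\<sigma>. ennreal (exp (- (M * c j) * \<sigma>)) * (ennreal (exp (- M * y) * B) * W T (y + c j * \<sigma>) \<sigma>) \<partial>lborel) =
        (\<integral>\<^sup>+\<sigma>. ennreal B * (ennreal (exp (- M * (y + c j * \<sigma>))) * W T (y + c j * \<sigma>) \<sigma>) \<partial>lborel)"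
    proof (rule nn_integral_cong)
      fix \<sigma>
      have "ennreal (exp (- (M * c j) * \<sigma>)) * ennreal (exp (- M * y) * B) = ennreal B * ennreal (exp (- M * (y + c j * \<sigma>)))"
        using B by (simp add: ennreal_mult[symmetric] exp_add[symmetric] algebra_simps)
      then show "ennreal (exp (- (M * c j) * \<sigma>)) * (ennreal (exp (- M * y) * B) * W T (y + c j * \<sigma>) \<sigma>) =
          ennreal B * (ennreal (exp (- M * (y + c j * \<sigma>))) * W T (y + c j * \<sigma>) \<sigma>)"
        by (simp add: mult.assoc[symmetric])
    qed
    also have "\<dots> = ennreal B * (\<integral>\<^sup>+\<sigma>. ennreal (exp (- M * (y + c j * \<sigma>))) * W T (y + c j * \<sigma>) \<sigma> \<partial>lborel)"
      by (rule nn_integral_cmult) measurable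
    finally have "ennreal (1 / (M * c j)) * (\<integral>\<^sup>+\<sigma>. ennreal (exp (- (M * c j) * \<sigma>)) * (ennreal (exp (- M * y) * B) * W T (y + c j * \<sigma>) \<sigma>) \<partial>lborel) =
        ennreal (1 / (M * c j)) * ennreal B * (\<integral>\<^sup>+\<sigma>. ennreal (exp (- M * (y + c j * \<sigma>))) * W T (y + c j * \<sigma>) \<sigma> \<partial>lborel)"
      by (simp add: mult.assoc)
    also have "ennreal (1 / (M * c j)) * ennreal B = ennreal (B / (M * c j))"
      using Mc B by (subst ennreal_mult[symmetric]) auto
    finally show "ennreal (1 / (M * c j)) * (\<integral>\<^sup>+\<sigma>. ennreal (exp (- (M * c j) * \<sigma>)) * (ennreal (exp (- M * y) * B) * W T (y + c j * \<sigma>) \<sigma>) \<partial>lborel) =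
        ennreal (B / (M * c j)) * (\<integral>\<^sup>+\<sigma>. ennreal (exp (- M * (y + c j * \<sigma>))) * W T (y + c j * \<sigma>) \<sigma> \<partial>lborel)" .
  qed
  also have "\<dots> = ennreal (B / (M * c j)) * (\<integral>\<^sup>+y. \<integral>\<^sup>+\<sigma>. ennreal (exp (- M * (y + c j * \<sigma>))) * W T (y + c j * \<sigma>) \<sigma> \<partial>lborel \<partial>lborel)"
    by (rule nn_integral_cmult) measurable
  also have "\<dots> = ennreal (B / (M * c j)) * N M"
    unfolding N_def using nn_integral_shear[OF W, of "c j"] by simp
  finally show ?thesis unfolding f_def .
qed

text \<open>Here no shear is necessary: at almost every fixed time the inequality for
  \<open>u\<close> is itself of Volterra type in \<open>x\<close>, which gains
  \<open>1 / M\<close>.\<close>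

lemma u_weighted_bound:
  assumes M: "0 < M" and C: "AE p in lborel. ennreal \<bar>u (fst p) (snd p)\<bar> * indicator (R T) p \<le>
      ennreal C * (\<integral>\<^sup>+\<xi>. W T \<xi> (snd p) * indicator {..fst p} \<xi> \<partial>lborel)" "0 \<le> C"
  shows "(\<integral>\<^sup>+p. ennreal (exp (- M * fst p)) * (ennreal \<bar>u (fst p) (snd p)\<bar> * indicator (R T) (fst p, snd p)) \<partial>lborel)
    \<le> ennreal (C / M) * N M"
proof -
  define f where "f x r = ennreal (exp (- M * x)) * (ennreal \<bar>u x r\<bar> * indicator (R T) (x, r))" for x r
  have [measurable]: "(\<lambda>p. u (fst p) (snd p)) \<in> borel_measurable borel" by (rule meas)
  have f: "(\<lambda>p. f (fst p) (snd p)) \<in> borel_measurable borel" unfolding f_def by measurable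
  have W: "(\<lambda>p. ennreal (exp (- M * fst p)) * W T (fst p) (snd p)) \<in> borel_measurable borel" by measurable
  have "AE p in lborel. ennreal \<bar>u (fst p) (snd p)\<bar> * indicator (R T) (fst p, snd p) \<le>
      ennreal C * (\<integral>\<^sup>+\<xi>. W T \<xi> (snd p) * indicator {..fst p} \<xi> \<partial>lborel)" using C(1) by simp
  from AE_product_sections(2)[where Q = "\<lambda>x t. ennreal \<bar>u x t\<bar> * indicator (R T) (x, t) \<le>
      ennreal C * (\<integral>\<^sup>+\<xi>. W T \<xi> t * indicator {..x} \<xi> \<partial>lborel)", OF this]
  have ae: "AE t in lborel. AE x in lborel. ennreal \<bar>u x t\<bar> * indicator (R T) (x, t) \<le>
      ennreal C * (\<integral>\<^sup>+\<xi>. W T \<xi> t * indicator {..x} \<xi> \<partial>lborel)" .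
  have "(\<integral>\<^sup>+p. f (fst p) (snd p) \<partial>lborel) = (\<integral>\<^sup>+t. \<integral>\<^sup>+x. f x t \<partial>lborel \<partial>lborel)"
    by (rule nn_integral_plane[OF f])
  also have "\<dots> \<le> (\<integral>\<^sup>+t. \<integral>\<^sup>+x. ennreal (exp (- M * x)) * (\<integral>\<^sup>+\<xi>. ennreal C * W T \<xi> t * indicator {..x} \<xi> \<partial>lborel) \<partial>lborel \<partial>lborel)"
  proof (rule nn_integral_mono_AE)
    show "AE t in lborel. (\<integral>\<^sup>+x. f x t \<partial>lborel) \<le>
        (\<integral>\<^sup>+x. ennreal (exp (- M * x)) * (\<integral>\<^sup>+\<xi>. ennreal C * W T \<xi> t * indicator {..x} \<xi> \<partial>lborel) \<partial>lborel)"
      using ae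
    proof eventually_elim
      case (elim t)
      show ?case
      proof (rule nn_integral_mono_AE)
        show "AE x in lborel. f x t \<le> ennreal (exp (- M * x)) * (\<integral>\<^sup>+\<xi>. ennreal C * W T \<xi> t * indicator {..x} \<xi> \<partial>lborel)"
          using elim
        proof eventually_elim
          case (elim x)
          have "f x t \<le> ennreal (exp (- M * x)) * (ennreal C * (\<integral>\<^sup>+\<xi>. W T \<xi> t * indicator {..x} \<xi> \<partial>lborel))"
            unfolding f_def using elim by (intro mult_left_mono) auto
          also have "ennreal C * (\<integral>\<^sup>+\<xi>. W T \<xi> t * indicator {..x} \<xi> \<partial>lborel) = (\<integral>\<^sup>+\<xi>. ennreal C * (W T \<xi> t * indicator {..x} \<xi>) \<partial>lborel)"
            by (rule nn_integral_cmult[symmetric]) measurable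
          finally show ?case by (simp add: mult.assoc)
        qed
      qed
    qed
  qed
  also have "\<dots> = (\<integral>\<^sup>+t. ennreal (1 / M) * (\<integral>\<^sup>+\<xi>. ennreal (exp (- M * \<xi>)) * (ennreal C * W T \<xi> t) \<partial>lborel) \<partial>lborel)"
    by (intro nn_integral_cong nn_integral_weighted_Volterra M) measurable
  also have "\<dots> = (\<integral>\<^sup>+t. ennreal (C / M) * (\<integral>\<^sup>+\<xi>. ennreal (exp (- M * \<xi>)) * W T \<xi> t \<partial>lborel) \<partial>lborel)"
  proof (rule nn_integral_cong)
    fix t
    have "(\<integral>\<^sup>+\<xi>. ennreal (exp (- M * \<xi>)) * (ennreal C * W T \<xi> t) \<partial>lborel) = (\<integral>\<^sup>+\<xi>. ennreal C * (ennreal (exp (- M * \<xi>)) * W T \<xi> t) \<partial>lborel)"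
      by (simp add: mult_ac)
    also have "\<dots> = ennreal C * (\<integral>\<^sup>+\<xi>. ennreal (exp (- M * \<xi>)) * W T \<xi> t \<partial>lborel)"
      by (rule nn_integral_cmult) measurable
    finally have "ennreal (1 / M) * (\<integral>\<^sup>+\<xi>. ennreal (exp (- M * \<xi>)) * (ennreal C * W T \<xi> t) \<partial>lborel) =
        ennreal (1 / M) * ennreal C * (\<integral>\<^sup>+\<xi>. ennreal (exp (- M * \<xi>)) * W T \<xi> t \<partial>lborel)"
      by (simp add: mult.assoc)
    also have "ennreal (1 / M) * ennreal C = ennreal (C / M)" using M C by (subst ennreal_mult[symmetric]) auto
    finally show "ennreal (1 / M) * (\<integral>\<^sup>+\<xi>. ennreal (exp (- M * \<xi>)) * (ennreal C * W T \<xi> t) \<partial>lborel) =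
        ennreal (C / M) * (\<integral>\<^sup>+\<xi>. ennreal (exp (- M * \<xi>)) * W T \<xi> t \<partial>lborel)" .
  qed
  also have "\<dots> = ennreal (C / M) * (\<integral>\<^sup>+t. \<integral>\<^sup>+\<xi>. ennreal (exp (- M * \<xi>)) * W T \<xi> t \<partial>lborel \<partial>lborel)"
    by (rule nn_integral_cmult) measurable
  also have "\<dots> = ennreal (C / M) * N M"
    unfolding N_def using nn_integral_plane[where f = "\<lambda>x t. ennreal (exp (- M * x)) * W T x t", OF W] by simp
  finally show ?thesis unfolding f_def .
qed

text \<open>Finiteness is what permits the conclusion \<open>N M = 0\<close> from
  \<open>N M \<le> ennreal (S / M) * N M\<close>. It rests on the boundedness of \<open>R T\<close>
  and of the state.\<close>

lemma N_finite:
  assumes "0 < M"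
  shows "N M < \<infinity>"
proof -
  have "ess_bounded (R T) (\<lambda>p. w j (fst p) (snd p))" "ess_bounded (R T) (\<lambda>p. u (fst p) (snd p))" for j
    using ess_bounded_subset[OF state_bounded(1) R_subset(1)] ess_bounded_subset[OF state_bounded(2) R_subset(1)] by auto
  then have "ess_bounded (R T) (\<lambda>p. (\<Sum>j\<in>UNIV. \<bar>w j (fst p) (snd p)\<bar>) + \<bar>u (fst p) (snd p)\<bar>)"
    by (intro ess_bounded_add ess_bounded_sum) (simp_all add: ess_bounded_def)
  then obtain C where C: "AE p in lborel. p \<in> R T \<longrightarrow> \<bar>magn (fst p) (snd p)\<bar> \<le> C"
    unfolding magn_def ess_bounded_def by blast
  have "N M \<le> (\<integral>\<^sup>+p. ennreal C * indicator (R T) p \<partial>lborel)"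
    unfolding N_def
  proof (rule nn_integral_mono_AE)
    show "AE p in lborel. ennreal (exp (- M * fst p)) * W T (fst p) (snd p) \<le> ennreal C * indicator (R T) p"
      using C
    proof eventually_elim
      case (elim p)
      show ?case
      proof (cases "p \<in> R T")
        case True
        then have "0 \<le> fst p" using R_subset(1) by fastforce
        then have "exp (- M * fst p) \<le> 1" using assms by simp
        moreover have "magn (fst p) (snd p) \<le> C" using elim True by simp
        ultimately have "exp (- M * fst p) * magn (fst p) (snd p) \<le> 1 * C"
          using magn_nonneg by (intro mult_mono) auto
        then show ?thesis using True magn_nonneg by (simp add: W_def ennreal_mult[symmetric] ennreal_leI)
      qed (simp add: W_def)
    qed
  qed
  also have "\<dots> = ennreal C * emeasure lborel (R T)"
    using R_sets(1)[of T] by (subst nn_integral_cmult_indicator) auto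
  also have "\<dots> < \<infinity>"
  proof -
    have "bounded ({0..len} \<times> {0..T})" by (intro bounded_Times bounded_closed_interval)
    then have "bounded (R T)" using R_subset(1) by (rule bounded_subset)
    then have "emeasure lborel (R T) < \<infinity>" by (rule emeasure_bounded_finite)
    then show ?thesis by (simp add: ennreal_mult_less_top)
  qed
  finally show ?thesis .
qed

lemma R_zero: "AE p in lborel. p \<in> R T \<longrightarrow> u (fst p) (snd p) = 0 \<and> (\<forall>j. w j (fst p) (snd p) = 0)"
proof -
  obtain B where B: "0 \<le> B" "\<forall>j k. \<forall>x\<in>{0..len}. \<bar>Spp j k x\<bar> \<le> B \<and> \<bar>Spm j x\<bar> \<le> B \<and> \<bar>Smp j x\<bar> \<le> B"
    using coeff_bound by blast
  obtain C where C: "0 \<le> C" "AE p in lborel. ennreal \<bar>u (fst p) (snd p)\<bar> * indicator (R T) p \<le>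
      ennreal C * (\<integral>\<^sup>+\<xi>. W T \<xi> (snd p) * indicator {..fst p} \<xi> \<partial>lborel)"
    by (rule u_bound)
  define S where "S = (\<Sum>j\<in>UNIV. B / c j) + C"
  \<comment> \<open>\<open>S\<close> collects the constants of all component estimates. The choice
    gives \<open>S / M < 1 / 2\<close> and stays positive when \<open>S = 0\<close>.\<close>
  define M where "M = 2 * S + 1"
  have S: "0 \<le> S" unfolding S_def using B C c_pos by (intro add_nonneg_nonneg sum_nonneg divide_nonneg_pos) auto
  then have M: "0 < M" by (simp add: M_def)
  have [measurable]: "(\<lambda>p. u (fst p) (snd p)) \<in> borel_measurable borel" "(\<lambda>p. w j (fst p) (snd p)) \<in> borel_measurable borel" for j
    by (rule meas)+
  have meas_w: "(\<lambda>p. ennreal (exp (- M * fst p)) * (ennreal \<bar>w j (fst p) (snd p)\<bar> * indicator (R T) (fst p, snd p))) \<in> borel_measurable lborel" for j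
    by measurable
  have meas_u: "(\<lambda>p. ennreal (exp (- M * fst p)) * (ennreal \<bar>u (fst p) (snd p)\<bar> * indicator (R T) (fst p, snd p))) \<in> borel_measurable lborel"
    by measurable
  have "N M = (\<integral>\<^sup>+p. (\<Sum>j\<in>UNIV. ennreal (exp (- M * fst p)) * (ennreal \<bar>w j (fst p) (snd p)\<bar> * indicator (R T) (fst p, snd p)))
      + ennreal (exp (- M * fst p)) * (ennreal \<bar>u (fst p) (snd p)\<bar> * indicator (R T) (fst p, snd p)) \<partial>lborel)"
    unfolding N_def
  proof (rule nn_integral_cong)
    fix p :: "real \<times> real"
    have "ennreal (magn (fst p) (snd p)) = (\<Sum>j\<in>UNIV. ennreal \<bar>w j (fst p) (snd p)\<bar>) + ennreal \<bar>u (fst p) (snd p)\<bar>"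
      unfolding magn_def by (subst ennreal_plus) (auto simp: sum_nonneg sum_ennreal)
    then show "ennreal (exp (- M * fst p)) * W T (fst p) (snd p) =
      (\<Sum>j\<in>UNIV. ennreal (exp (- M * fst p)) * (ennreal \<bar>w j (fst p) (snd p)\<bar> * indicator (R T) (fst p, snd p)))
      + ennreal (exp (- M * fst p)) * (ennreal \<bar>u (fst p) (snd p)\<bar> * indicator (R T) (fst p, snd p))"
      by (simp only: W_def distrib_left distrib_right sum_distrib_left sum_distrib_right)
  qed
  also have "\<dots> = (\<Sum>j\<in>UNIV. \<integral>\<^sup>+p. ennreal (exp (- M * fst p)) * (ennreal \<bar>w j (fst p) (snd p)\<bar> * indicator (R T) (fst p, snd p)) \<partial>lborel)
      + (\<integral>\<^sup>+p. ennreal (exp (- M * fst p)) * (ennreal \<bar>u (fst p) (snd p)\<bar> * indicator (R T) (fst p, snd p)) \<partial>lborel)"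
    using meas_w meas_u by (simp only: nn_integral_add nn_integral_sum borel_measurable_sum)
  also have "\<dots> \<le> (\<Sum>j\<in>UNIV. ennreal (B / (M * c j)) * N M) + ennreal (C / M) * N M"
    by (intro add_mono sum_mono w_weighted_bound[OF M B] u_weighted_bound[OF M C(2,1)])
  also have "\<dots> = ennreal (S / M) * N M"
  proof -
    have "S / M = (\<Sum>j\<in>UNIV. B / (M * c j)) + C / M"
      by (simp add: S_def add_divide_distrib sum_divide_distrib mult.commute)
    also have "ennreal \<dots> = (\<Sum>j\<in>UNIV. ennreal (B / (M * c j))) + ennreal (C / M)"
      using B C M c_pos by (subst ennreal_plus) (auto intro!: sum_nonneg divide_nonneg_pos mult_pos_pos simp: sum_ennreal less_imp_le)
    finally show ?thesis by (simp add: distrib_right sum_distrib_right)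
  qed
  finally have le: "N M \<le> ennreal (S / M) * N M" .
  have "N M = 0"
  proof -
    obtain n where n: "0 \<le> n" "N M = ennreal n" using N_finite[OF M] by (cases "N M") auto
    have "ennreal (S / M * n) = ennreal (S / M) * ennreal n" using n S M by (intro ennreal_mult) auto
    then have "ennreal n \<le> ennreal (S / M * n)" using le n by metis
    then have "n \<le> S / M * n" using n S M by (subst (asm) ennreal_le_iff) auto
    then have "n * M \<le> S * n" using M by (simp add: field_simps)
    then have "n * (S + 1) \<le> 0" by (simp add: M_def algebra_simps)
    then have "n = 0" using n S by (smt (verit) mult_pos_pos)
    then show ?thesis using n by simp
  qed
  moreover have "(\<lambda>p. ennreal (exp (- M * fst p)) * W T (fst p) (snd p)) \<in> borel_measurable borel" by measurable
  ultimately have "AE p in lborel. ennreal (exp (- M * fst p)) * W T (fst p) (snd p) = 0"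
    unfolding N_def by (simp only: nn_integral_0_iff_AE measurable_lborel2)
  then show ?thesis
  proof eventually_elim
    case (elim p)
    show ?case
    proof
      assume p: "p \<in> R T"
      then have "magn (fst p) (snd p) \<le> 0" using elim by (simp add: W_def ennreal_eq_0_iff)
      then have 0: "(\<Sum>j\<in>UNIV. \<bar>w j (fst p) (snd p)\<bar>) + \<bar>u (fst p) (snd p)\<bar> \<le> 0" unfolding magn_def .
      have "\<bar>w j (fst p) (snd p)\<bar> \<le> 0" for j
      proof -
        have "\<bar>w j (fst p) (snd p)\<bar> \<le> (\<Sum>j\<in>UNIV. \<bar>w j (fst p) (snd p)\<bar>)" by (rule member_le_sum) auto
        then show ?thesis using 0 by linarith
      qed
      moreover have "0 \<le> (\<Sum>j\<in>UNIV. \<bar>w j (fst p) (snd p)\<bar>)" by (simp add: sum_nonneg)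
      then have "\<bar>u (fst p) (snd p)\<bar> \<le> 0" using 0 by linarith
      ultimately show "u (fst p) (snd p) = 0 \<and> (\<forall>j. w j (fst p) (snd p) = 0)" by simp
    qed
  qed
qed

end

text \<open>Vanishing almost everywhere in the plane says nothing about one time slice by itself.
  But almost every point of the slice is the start of a short characteristic on
  \<open>{t..t + \<epsilon>}\<close> inside \<open>R (t + 1)\<close>, and
  \<open>deriv_along_bound\<close> with bound 0 forces zero on all of it, including its start. The
  horizon \<open>t + 1\<close> leaves room for this.\<close>

lemma slice_zero:
  assumes t: "len / v + len / - l \<le> t" and D: "deriv_along a 1 strip f g"
    and f: "AE p in lborel. p \<in> R (t + 1) \<longrightarrow> f (fst p) (snd p) = 0"
  shows "AE x in lborel. x \<in> {0..len} \<longrightarrow> f x t = 0"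
proof -
  have "AE p in lborel. p \<in> R (t + 1) \<longrightarrow> \<bar>f (fst p) (snd p)\<bar> \<le> 0" using f by eventually_elim auto
  from deriv_along_bound[OF D _ R_subset(2) this]
  have *: "AE y in lborel. \<forall>r s. r < s \<and> (\<forall>\<sigma>\<in>{r..s}. (y + a * \<sigma>, \<sigma>) \<in> R (t + 1)) \<longrightarrow>
      (\<forall>\<sigma>\<in>{r..s}. \<bar>f (y + a * \<sigma>) \<sigma>\<bar> \<le> 0)" by simp
  have "(1::real) \<noteq> 0" by simp
  from AE_lborel_affine[OF * this, of "- a * t"] AE_lborel_singleton[of 0] AE_lborel_singleton[of len]
  show ?thesis
  proof eventually_elim
    case (elim x)
    show ?case
    proof
      assume "x \<in> {0..len}"
      with elim have x: "0 < x" "x < len" by auto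
      \<comment> \<open>Within time \<open>\<epsilon>\<close> a line of speed \<open>a\<close> moves
        less than the distance from \<open>x\<close> to either end of the road; the summand 1 avoids
        division by zero.\<close>
      define \<epsilon> where "\<epsilon> = min 1 (min x (len - x) / (\<bar>a\<bar> + 1))"
      have \<epsilon>: "0 < \<epsilon>" "\<epsilon> \<le> 1" using x by (auto simp: \<epsilon>_def)
      have "\<epsilon> \<le> min x (len - x) / (\<bar>a\<bar> + 1)" by (simp add: \<epsilon>_def)
      then have a\<epsilon>: "\<epsilon> * (\<bar>a\<bar> + 1) \<le> min x (len - x)" by (subst (asm) pos_le_divide_eq) auto
      have "(- a * t + 1 * x + a * \<sigma>, \<sigma>) \<in> R (t + 1)" if "\<sigma> \<in> {t..t + \<epsilon>}" for \<sigma>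
      proof -
        have "\<bar>a * (\<sigma> - t)\<bar> \<le> \<bar>a\<bar> * \<epsilon>" unfolding abs_mult using that by (intro mult_left_mono) auto
        also have "\<dots> \<le> min x (len - x)" using a\<epsilon> \<epsilon> by (simp add: algebra_simps)
        finally have "\<bar>a * (\<sigma> - t)\<bar> \<le> min x (len - x)" .
        moreover have "- a * t + 1 * x + a * \<sigma> = x + a * (\<sigma> - t)" by (simp add: algebra_simps)
        ultimately have b: "0 \<le> - a * t + 1 * x + a * \<sigma>" "- a * t + 1 * x + a * \<sigma> \<le> len" by linarith+
        then have "(- a * t + 1 * x + a * \<sigma>) / v \<le> len / v" using v by (intro divide_right_mono) auto
        then have "t0 + (- a * t + 1 * x + a * \<sigma>) / v \<le> \<sigma>" using t that unfolding t0_def by auto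
        then show ?thesis using b that \<epsilon> by (auto simp: R_def)
      qed
      then have "\<forall>\<sigma>\<in>{t..t + \<epsilon>}. \<bar>f (- a * t + 1 * x + a * \<sigma>) \<sigma>\<bar> \<le> 0"
        using elim(1)[rule_format, of t "t + \<epsilon>"] \<epsilon> by auto
      then have "\<bar>f (- a * t + 1 * x + a * t) t\<bar> \<le> 0" by (rule bspec) (use \<epsilon> in auto)
      then show "f x t = 0" by simp
    qed
  qed
qed

lemma finite_time_zero:
  assumes "len / v + len / - l \<le> t"
  shows "AE x in lborel. x \<in> {0..len} \<longrightarrow> u x t = 0" "AE x in lborel. x \<in> {0..len} \<longrightarrow> w j x t = 0"
proof -
  have "AE p in lborel. p \<in> R (t + 1) \<longrightarrow> u (fst p) (snd p) = 0" "AE p in lborel. p \<in> R (t + 1) \<longrightarrow> w j (fst p) (snd p) = 0"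
    using R_zero[of "t + 1"] by (auto elim!: eventually_mono)
  then show "AE x in lborel. x \<in> {0..len} \<longrightarrow> u x t = 0" "AE x in lborel. x \<in> {0..len} \<longrightarrow> w j x t = 0"
    using slice_zero[OF assms u_eq] slice_zero[OF assms w_eq] by auto
qed

end

section \<open>The Aw-Rascle model\<close>

lemma vector_4 [simp]:
  "(vector [a, b, c, d] :: ('a::zero)^4) $ 1 = a"
  "(vector [a, b, c, d] :: ('a::zero)^4) $ 2 = b"
  "(vector [a, b, c, d] :: ('a::zero)^4) $ 3 = c"
  "(vector [a, b, c, d] :: ('a::zero)^4) $ 4 = d"
  unfolding vector_def by simp_all

lemma matrix_inv_mult:
  assumes "invertible (A :: real^'n^'n)"
  shows "matrix_inv A ** A = mat 1" "A ** matrix_inv A = mat 1"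
proof -
  have "\<exists>B. A ** B = mat 1 \<and> B ** A = mat 1" using assms unfolding invertible_def .
  then have "A ** matrix_inv A = mat 1 \<and> matrix_inv A ** A = mat 1" unfolding matrix_inv_def by (rule someI_ex)
  then show "matrix_inv A ** A = mat 1" "A ** matrix_inv A = mat 1" by blast+
qed

text \<open>The occupancy is affine in the density of class \<open>i\<close> with slope
  \<open>area P $ i / width P\<close>, and the pressure is an increasing power of the occupancy. The
  sign serves to order the characteristic speeds.\<close>

lemma beta_diag_pos:
  assumes "valid_params P"
  shows "0 < beta P i i"
proof -
  note p = assms[unfolded valid_params_def]
  define W where "W = width P"
  define m where "m = AOmax P $ i"
  define g where "g = expo P $ i"
  \<comment> \<open>The contribution of the other class, constant while the density of class
    \<open>i\<close> varies. Its sign helps to keep the base of the power positive, where the power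
    is differentiable.\<close>
  define s where "s = (\<Sum>k\<in>UNIV - {i}. area P $ k * rho_eq P $ k)"
  define A where "A = area P $ i"
  define r0 where "r0 = rho_eq P $ i"
  have pos: "0 < W" "0 < m" "0 < A" "0 < r0" "1 < g" "0 < vfree P $ i"
    using p by (auto simp: W_def m_def A_def r0_def g_def)
  have s: "0 \<le> s" unfolding s_def using p by (intro sum_nonneg mult_nonneg_nonneg) (auto simp: less_imp_le)
  have AO: "AO P (\<chi> k. if k = i then r else rho_eq P $ k) = (A * r + s) / W" for r
  proof -
    have "area P $ 1 * (\<chi> k. if k = i then r else rho_eq P $ k) $ 1 + area P $ 2 * (\<chi> k. if k = i then r else rho_eq P $ k) $ 2
        = (\<Sum>k\<in>UNIV. area P $ k * (if k = i then r else rho_eq P $ k))"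
      by (simp add: sum_2)
    also have "\<dots> = A * r + s"
      by (subst sum.remove[of _ i]) (auto simp: A_def s_def intro!: sum.cong)
    finally show ?thesis by (simp add: AO_def W_def)
  qed
  have pos_arg: "0 < (A * r0 + s) / W / m" using pos s by (intro divide_pos_pos add_pos_nonneg mult_pos_pos)
  have "((\<lambda>r. vfree P $ i * ((A * r + s) / W / m) powr g) has_real_derivative
      vfree P $ i * (g * ((A * r0 + s) / W / m) powr (g - 1) * (A / W / m))) (at r0)"
  proof -
    have d: "((\<lambda>r. (A * r + s) / W / m) has_real_derivative A / W / m) (at r0)"
      using pos by (auto intro!: derivative_eq_intros)
    from DERIV_cmult[OF DERIV_fun_powr[OF d pos_arg, of g], of "vfree P $ i"]
    show ?thesis by simp
  qed
  then have "beta P i i = vfree P $ i * (g * ((A * r0 + s) / W / m) powr (g - 1) * (A / W / m))"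
    unfolding beta_def pressure_def AO r0_def[symmetric] m_def[symmetric] g_def[symmetric] by (rule DERIV_imp_deriv)
  moreover have "0 < ((A * r0 + s) / W / m) powr (g - 1)" using pos_arg unfolding powr_gt_zero by linarith
  ultimately show ?thesis using pos by (auto intro!: mult_pos_pos divide_pos_pos)
qed

text \<open>The claim amounts to \<open>a + b - d \<le> Delta P\<close>, and the squares of the two
  sides differ by \<open>4 * b * d\<close>, which is positive. With
  \<open>v_eq P $ 2 < v_eq P $ 1\<close> it makes \<open>v_eq P $ 2\<close> the slowest of the three
  positive speeds.\<close>

lemma lam_order:
  assumes "valid_params P" "congested P"
  shows "v_eq P $ 2 \<le> lam P $ 3"
proof -
  define a where "a = beta P 1 1 * rho_eq P $ 1"
  define b where "b = beta P 2 2 * rho_eq P $ 2"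
  define d where "d = v_eq P $ 1 - v_eq P $ 2"
  have d: "0 < d" using assms(2) by (simp add: congested_def d_def)
  have "0 < a" "0 < b" using beta_diag_pos[OF assms(1)] assms(1) by (auto simp: a_def b_def valid_params_def)
  have "(a + b - d)\<^sup>2 \<le> (b - a + d)\<^sup>2 + 4 * a * b"
  proof -
    have "(b - a + d)\<^sup>2 + 4 * a * b - (a + b - d)\<^sup>2 = 4 * b * d" by (simp add: power2_eq_square algebra_simps)
    moreover have "0 \<le> 4 * b * d" using \<open>0 < b\<close> d by simp
    ultimately show ?thesis by linarith
  qed
  then have "a + b - d \<le> sqrt ((b - a + d)\<^sup>2 + 4 * a * b)" by (rule real_le_rsqrt)
  also have "\<dots> = Delta P" by (simp add: Delta_def a_def b_def d_def algebra_simps)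
  finally show ?thesis by (simp add: lam_def Let_def vector_4 a_def b_def d_def)
qed

lemma Jt_inverse: "matrix_inv (Jt P) ** Jt P = mat 1"
proof -
  define N :: "real^4^4" where "N = vector
    [vector [1, 0, 0, 0], vector [- beta P 1 1, 1, - beta P 1 2, 0], vector [0, 0, 1, 0], vector [- beta P 2 1, 0, - beta P 2 2, 1]]"
  have "N ** Jt P = mat 1" "Jt P ** N = mat 1"
    by (simp_all add: N_def Jt_def vec_eq_iff forall_4 matrix_matrix_mult_def sum_4 vector_4 mat_def)
  then have "invertible (Jt P)" unfolding invertible_def by blast
  then show ?thesis by (rule matrix_inv_mult(1))
qed

section \<open>Characteristic coordinates and boundary conditions\<close>

lemma row_vector_matrix_mult: "row i X v* Y = row i (X ** (Y :: real^'n^'n))"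
  by (simp add: vec_eq_iff row_def vector_matrix_mult_def matrix_matrix_mult_def mult.commute)

lemma inner_row: "row i X \<bullet> z = (X *v (z :: real^'n)) $ i"
  by (simp add: inner_vec_def row_def matrix_vector_mult_def)

lemma row_diag: "row i (diag d ** X) = d $ i *\<^sub>R row i (X :: real^'n^'n)"
  by (simp add: vec_eq_iff row_def diag_def matrix_matrix_mult_def if_distrib if_distribR cong: if_cong)

text \<open>Translates a position among the three components moving to the right into the index of
  its eigenvalue in \<open>lam\<close>. With it the matrices of the target coordinates have uniform
  entries, and sums over all four coordinates split as in \<open>sum_4_idx\<close>.\<close>

definition idx :: "3 \<Rightarrow> 4" where "idx j = (if j = 1 then 2 else if j = 2 then 3 else 1)"

lemma idx_simps [simp]: "idx 1 = 2" "idx 2 = 3" "idx 3 = 1"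
  by (simp_all add: idx_def)

lemma Lam_plus_idx: "Lam_plus P $ j $ j = lam P $ idx j"
proof -
  have "\<forall>j. Lam_plus P $ j $ j = lam P $ idx j"
    unfolding forall_3 by (simp add: Lam_plus_def diag_def lam_def Let_def vector_3 vector_4)
  then show ?thesis by blast
qed

lemma Sig_idx:
  "Sig_pp P V x $ j $ k = (if j = k then 0 else coupling P V x (idx j) (idx k))"
  "Sig_pm P V x $ j = coupling P V x (idx j) 4"
  "Sig_mp P V x $ j = coupling P V x 4 (idx j)"
proof -
  have "\<forall>j k. Sig_pp P V x $ j $ k = (if j = k then 0 else coupling P V x (idx j) (idx k))"
    "\<forall>j. Sig_pm P V x $ j = coupling P V x (idx j) 4" "\<forall>j. Sig_mp P V x $ j = coupling P V x 4 (idx j)"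
    unfolding forall_3 by (simp_all add: Sig_pp_def Sig_pm_def Sig_mp_def Let_def vector_3)
  then show "Sig_pp P V x $ j $ k = (if j = k then 0 else coupling P V x (idx j) (idx k))"
    "Sig_pm P V x $ j = coupling P V x (idx j) 4" "Sig_mp P V x $ j = coupling P V x 4 (idx j)"
    by blast+
qed

lemma sum_4_idx: "(\<Sum>k\<in>UNIV. f (k :: 4)) = (\<Sum>j\<in>UNIV. f (idx j)) + (f 4 :: real)"
  by (simp add: sum_4 sum_3)

lemma idx_inj: "idx j = idx k \<longleftrightarrow> j = k"
proof -
  have "\<forall>j k. idx j = idx k \<longleftrightarrow> j = k" unfolding forall_3 by simp
  then show ?thesis by blast
qed

lemma idx_neq_4: "idx j \<noteq> 4"
proof -
  have "\<forall>j. idx j \<noteq> 4" unfolding forall_3 by simp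
  then show ?thesis by blast
qed

text \<open>The entries of \<open>T_inv P V x *v z\<close>, indexed as in \<open>lam\<close>. The
  exponential is the integrating factor that removes the diagonal reaction term in
  \<open>wt_eq\<close>.\<close>

definition eigen_coord :: "AR_params \<Rightarrow> real^4^4 \<Rightarrow> 4 \<Rightarrow> real \<Rightarrow> real^4 \<Rightarrow> real" where
  "eigen_coord P V i x z = exp (- theta P V i * x) * (matrix_inv V *v z) $ i"

lemma T_inv_coord:
  "(Tu_inv P V x *v z) $ j = eigen_coord P V (idx j) x z"
  "Tl_inv P V x \<bullet> z = eigen_coord P V 4 x z"
proof -
  define D :: "real^4^4" where "D = vector
    [vector [0, exp (- theta P V 2 * x), 0, 0],
     vector [0, 0, exp (- theta P V 3 * x), 0],
     vector [exp (- theta P V 1 * x), 0, 0, 0],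
     vector [0, 0, 0, exp (- theta P V 4 * x)]]"
  have T: "T_inv P V x = D ** matrix_inv V" by (simp add: T_inv_def D_def Let_def)
  have Tz: "T_inv P V x $ i \<bullet> z = (D *v (matrix_inv V *v z)) $ i" for i
    unfolding T matrix_vector_mul_assoc by (simp add: inner_vec_def matrix_vector_mult_def)
  have D: "(D *v y) $ 1 = exp (- theta P V 2 * x) * y $ 2" "(D *v y) $ 2 = exp (- theta P V 3 * x) * y $ 3"
    "(D *v y) $ 3 = exp (- theta P V 1 * x) * y $ 1" "(D *v y) $ 4 = exp (- theta P V 4 * x) * y $ 4" for y
    by (simp_all add: D_def matrix_vector_mult_def sum_4 vector_4)
  have "(Tu_inv P V x *v z) $ j = Tu_inv P V x $ j \<bullet> z" for j
    by (simp add: matrix_vector_mult_def inner_vec_def)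
  then have "\<forall>j. (Tu_inv P V x *v z) $ j = eigen_coord P V (idx j) x z"
    unfolding forall_3 by (simp add: Tu_inv_def vector_3 Tz D eigen_coord_def)
  then show "(Tu_inv P V x *v z) $ j = eigen_coord P V (idx j) x z" by blast
  show "Tl_inv P V x \<bullet> z = eigen_coord P V 4 x z"
    by (simp add: Tl_inv_def Tz D eigen_coord_def)
qed

context
  fixes P :: AR_params and V :: "real^4^4"
  assumes diagonalizes: "diagonalizes P V"
begin

lemma V_inverse: "V *v (matrix_inv V *v z) = z" "matrix_inv V ** V = mat 1" "V ** matrix_inv V = mat 1"
  using diagonalizes unfolding diagonalizes_def
  by (simp_all add: matrix_vector_mul_assoc matrix_inv_mult(1) matrix_inv_mult(2))

text \<open>The rows of \<open>matrix_inv V ** matrix_inv (Jt P)\<close> are the multipliers to be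
  used in \<open>char_solution\<close>: multiplying by \<open>Jt P\<close> leaves a row of
  \<open>matrix_inv V\<close>, hence a left eigenvector of \<open>Jx_tilde P\<close>.\<close>

lemma left_eigenvectors:
  shows "row i (matrix_inv V ** matrix_inv (Jt P)) v* Jt P = row i (matrix_inv V)"
    and "row i (matrix_inv V ** matrix_inv (Jt P)) v* Jx P = lam P $ i *\<^sub>R row i (matrix_inv V)"
    and "- ((row i (matrix_inv V ** matrix_inv (Jt P)) v* Js P) \<bullet> z) = (\<Sum>k\<in>UNIV. Jhat P V $ i $ k * (matrix_inv V *v z) $ k)"
proof -
  show "row i (matrix_inv V ** matrix_inv (Jt P)) v* Jt P = row i (matrix_inv V)"
    by (simp add: row_vector_matrix_mult matrix_mul_assoc[symmetric] Jt_inverse)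
  have "matrix_inv V ** Jx_tilde P = matrix_inv V ** Jx_tilde P ** V ** matrix_inv V"
    by (simp add: matrix_mul_assoc[symmetric] V_inverse)
  also have "\<dots> = diag (lam P) ** matrix_inv V" using diagonalizes by (simp add: diagonalizes_def)
  finally show "row i (matrix_inv V ** matrix_inv (Jt P)) v* Jx P = lam P $ i *\<^sub>R row i (matrix_inv V)"
    by (simp add: row_vector_matrix_mult matrix_mul_assoc[symmetric] Jx_tilde_def row_diag)
  have J: "matrix_inv V ** J_tilde P = Jhat P V ** matrix_inv V"
    unfolding Jhat_def by (simp add: matrix_mul_assoc[symmetric] V_inverse)
  have "- (matrix_inv V ** matrix_inv (Jt P) ** Js P) = matrix_inv V ** J_tilde P"
    unfolding J_tilde_def matrix_mul_assoc[symmetric]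
    by (simp add: vec_eq_iff matrix_matrix_mult_def[of "matrix_inv V"] sum_negf)
  then have "((matrix_inv V ** J_tilde P) *v z) $ i = ((- (matrix_inv V ** matrix_inv (Jt P) ** Js P)) *v z) $ i" by simp
  also have "\<dots> = - ((row i (matrix_inv V ** matrix_inv (Jt P)) v* Js P) \<bullet> z)"
    unfolding row_vector_matrix_mult inner_row by (simp add: matrix_vector_mult_def sum_negf)
  finally have "- ((row i (matrix_inv V ** matrix_inv (Jt P)) v* Js P) \<bullet> z) = ((matrix_inv V ** J_tilde P) *v z) $ i" ..
  also have "\<dots> = (Jhat P V *v (matrix_inv V *v z)) $ i" unfolding J by (simp add: matrix_vector_mul_assoc)
  finally show "- ((row i (matrix_inv V ** matrix_inv (Jt P)) v* Js P) \<bullet> z) = (\<Sum>k\<in>UNIV. Jhat P V $ i $ k * (matrix_inv V *v z) $ k)"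
    by (simp add: matrix_vector_mult_def)
qed

text \<open>In the coordinates \<open>y = matrix_inv V *v z\<close> the three inlet conditions read
  \<open>inlet_matrix P V *v y3 = (- y $ 4) *\<^sub>R b\<close>. Solving for \<open>y3\<close> gives
  \<open>Q0_hat\<close>; the exponentials are 1 at the inlet.\<close>

lemma inlet_coord:
  assumes inv: "invertible (inlet_matrix P V)" and z: "z $ 1 = 0" "z $ 3 = 0" "flow P z = 0"
  shows "eigen_coord P V (idx j) 0 z = Q0_bar P V $ j * eigen_coord P V 4 0 z"
proof -
  define y where "y = matrix_inv V *v z"
  have Vy: "V *v y = z" unfolding y_def by (rule V_inverse)
  have z_eq: "z $ i = (\<Sum>k\<in>UNIV. V $ i $ k * y $ k)" for i
    unfolding Vy[symmetric] by (simp add: matrix_vector_mult_def)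
  define y3 :: "real^3" where "y3 = vector [y $ 1, y $ 2, y $ 3]"
  define b :: "real^3" where "b = vector [V $ 1 $ 4, V $ 3 $ 4, kappa P V 4]"
  have "flow P z = (\<Sum>k\<in>UNIV. kappa P V k * y $ k)"
    unfolding flow_def z_eq kappa_def by (simp add: sum_4 algebra_simps)
  with z have "inlet_matrix P V *v y3 = (- y $ 4) *\<^sub>R b"
    unfolding z_eq by (simp add: vec_eq_iff forall_3 matrix_vector_mult_def inlet_matrix_def y3_def b_def sum_3 sum_4 vector_3 algebra_simps)
  then have "matrix_inv (inlet_matrix P V) *v (inlet_matrix P V *v y3) = (- y $ 4) *\<^sub>R (matrix_inv (inlet_matrix P V) *v b)"
    by (simp only: matrix_vector_mult_scaleR)
  then have "y3 = y $ 4 *\<^sub>R Q0_hat P V"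
    using inv by (simp add: matrix_vector_mul_assoc matrix_inv_mult(1) Q0_hat_def b_def[symmetric])
  then have y: "y $ 1 = y $ 4 * Q0_hat P V $ 1" "y $ 2 = y $ 4 * Q0_hat P V $ 2" "y $ 3 = y $ 4 * Q0_hat P V $ 3"
    by (simp_all add: vec_eq_iff forall_3 y3_def vector_3)
  \<comment> \<open>The permutation in \<open>Q0_bar\<close> is orthogonal, so its transpose
    witnesses invertibility. It sends the order 2, 3, 1 back to 1, 2, 3.\<close>
  define M :: "real^3^3" where "M = vector [vector [0, 0, 1], vector [1, 0, 0], vector [0, 1, 0]]"
  have "M ** transpose M = mat 1" "transpose M ** M = mat 1"
    by (simp_all add: M_def vec_eq_iff forall_3 matrix_matrix_mult_def transpose_def sum_3 vector_3 mat_def)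
  then have "M ** matrix_inv M = mat 1" by (intro matrix_inv_mult(2)) (auto simp: invertible_def)
  then have "M *v Q0_bar P V = Q0_hat P V"
    unfolding Q0_bar_def M_def[symmetric] matrix_vector_mul_assoc by simp
  then have Q: "Q0_hat P V $ 1 = Q0_bar P V $ 3" "Q0_hat P V $ 2 = Q0_bar P V $ 1" "Q0_hat P V $ 3 = Q0_bar P V $ 2"
    by (auto simp: vec_eq_iff forall_3 M_def matrix_vector_mult_def sum_3 vector_3)
  have "\<forall>j. eigen_coord P V (idx j) 0 z = Q0_bar P V $ j * eigen_coord P V 4 0 z"
    unfolding forall_3 by (simp add: eigen_coord_def y_def[symmetric] y Q)
  then show ?thesis by blast
qed

text \<open>The flow is the combination of the \<open>y $ k\<close> with weights
  \<open>kappa P V k\<close>. The \<open>R1_bar\<close> term of the feedback reproduces the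
  contributions of the first three, which cancel, and the prefactor undoes the rescaling of the
  fourth.\<close>

lemma outlet_coord:
  assumes "kappa P V 4 \<noteq> 0" and F: "flow P z = kappa P V 4 * exp (theta P V 4 * len P) * (- (R1_bar P V \<bullet> (Tu_inv P V (len P) *v z)) + a)"
  shows "eigen_coord P V 4 (len P) z = a"
proof -
  define y where "y = matrix_inv V *v z"
  have Vy: "V *v y = z" unfolding y_def by (rule V_inverse)
  have z_eq: "z $ i = (\<Sum>k\<in>UNIV. V $ i $ k * y $ k)" for i
    unfolding Vy[symmetric] by (simp add: matrix_vector_mult_def)
  let ?k = "kappa P V"
  have flow: "flow P z = ?k 1 * y $ 1 + ?k 2 * y $ 2 + ?k 3 * y $ 3 + ?k 4 * y $ 4"
    unfolding flow_def z_eq kappa_def by (simp add: sum_4 algebra_simps)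
  define e where "e i = exp ((theta P V i - theta P V 4) * len P)" for i
  define E where "E = exp (theta P V 4 * len P)"
  \<comment> \<open>The exponentials in \<open>R1_bar\<close> replace the individual rescaling of
    each coordinate by the common factor \<open>1 / E\<close>.\<close>
  have e: "e i * (exp (- theta P V i * len P) * y $ i) = y $ i / E" for i
  proof -
    have "e i * exp (- theta P V i * len P) = inverse E"
      by (simp add: e_def E_def exp_add[symmetric] exp_minus[symmetric] algebra_simps)
    then show ?thesis by (simp add: mult.assoc[symmetric] divide_inverse mult.commute)
  qed
  have "R1_bar P V \<bullet> (Tu_inv P V (len P) *v z) = - (1 / ?k 4) *
      (?k 1 * (e 1 * (exp (- theta P V 1 * len P) * y $ 1)) + ?k 2 * (e 2 * (exp (- theta P V 2 * len P) * y $ 2))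
       + ?k 3 * (e 3 * (exp (- theta P V 3 * len P) * y $ 3)))"
    unfolding inner_vec_def R1_bar_def R1_hat_def Let_def e_def[symmetric]
    by (simp add: sum_3 T_inv_coord eigen_coord_def y_def[symmetric] vector_matrix_mult_def vector_3 algebra_simps)
  also have "\<dots> = - (1 / ?k 4) * ((?k 1 * y $ 1 + ?k 2 * y $ 2 + ?k 3 * y $ 3) / E)"
    unfolding e by (simp add: add_divide_distrib)
  finally have R: "R1_bar P V \<bullet> (Tu_inv P V (len P) *v z) = - (1 / ?k 4) * ((?k 1 * y $ 1 + ?k 2 * y $ 2 + ?k 3 * y $ 3) / E)" .
  have "E > 0" by (simp add: E_def)
  have "?k 4 * y $ 4 = ?k 4 * E * a"
    using F \<open>E > 0\<close> assms(1) unfolding flow R E_def[symmetric] by (simp add: field_simps)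
  then have "y $ 4 = E * a" using assms(1) by simp
  then show ?thesis by (simp add: eigen_coord_def y_def[symmetric] E_def exp_minus field_simps)
qed

end

text \<open>Makes the rescaling factor a legitimate factor for
  \<open>deriv_along_mult\<close>.\<close>

lemma deriv_along_exp: "deriv_along c d D (\<lambda>x t. exp (a * x)) (\<lambda>x t. a * c * exp (a * x))"
  unfolding deriv_along_def
proof (intro AE_I2 allI impI)
  fix y r s
  assume "r \<le> s \<and> (y + c * r, d * r) \<in> D \<and> (y + c * s, d * s) \<in> D"
  then have "r \<le> s" by blast
  have cont: "continuous_on {r..s} (\<lambda>\<sigma>. a * c * exp (a * (y + c * \<sigma>)))" by (intro continuous_intros)
  have "((\<lambda>\<sigma>. exp (a * (y + c * \<sigma>))) has_vector_derivative a * c * exp (a * (y + c * \<sigma>))) (at \<sigma> within {r..s})" for \<sigma>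
    unfolding has_real_derivative_iff_has_vector_derivative[symmetric]
    by (auto intro!: derivative_eq_intros simp: mult_ac)
  from integral_FTC_atLeastAtMost[OF \<open>r \<le> s\<close> this cont]
  have "exp (a * (y + c * s)) - exp (a * (y + c * r)) = (LINT \<sigma>:{r..s}|lborel. a * c * exp (a * (y + c * \<sigma>)))"
    unfolding set_lebesgue_integral_def ..
  then show "set_integrable lborel {r..s} (\<lambda>\<sigma>. a * c * exp (a * (y + c * \<sigma>))) \<and>
      exp (a * (y + c * s)) - exp (a * (y + c * r)) = (LINT \<sigma>:{r..s}|lborel. a * c * exp (a * (y + c * \<sigma>)))"
    using borel_integrable_atLeastAtMost'[OF cont] by blast
qed

lemma continuous_ess_bounded:
  assumes "continuous_on {a..b::real} g"
  shows "ess_bounded ({a..b::real} \<times> S) (\<lambda>p. g (fst p))"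
proof -
  have "bounded (g ` {a..b::real})" using assms by (intro compact_imp_bounded compact_continuous_image) auto
  then obtain B where B: "\<forall>y\<in>g ` {a..b::real}. norm y \<le> B" unfolding bounded_iff by blast
  have "AE p in lborel. p \<in> {a..b::real} \<times> S \<longrightarrow> \<bar>g (fst p)\<bar> \<le> B"
    by (rule AE_I2) (use B in auto)
  then show ?thesis unfolding ess_bounded_def by blast
qed

lemma Linf_ess_bounded_component:
  assumes "Linf_on S (\<lambda>(x, y). f x y :: real^'n)"
  shows "ess_bounded S (\<lambda>p. f (fst p) (snd p) $ k)"
proof -
  obtain C where "AE p in lborel. p \<in> S \<longrightarrow> norm (f (fst p) (snd p)) \<le> C"
    using assms unfolding Linf_on_def case_prod_unfold by blast
  then have "AE p in lborel. p \<in> S \<longrightarrow> \<bar>f (fst p) (snd p) $ k\<bar> \<le> C"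
    by eventually_elim (auto intro: order_trans[OF component_le_norm_cart])
  then show ?thesis unfolding ess_bounded_def by blast
qed

lemma borel_measurable_component [measurable (raw)]:
  fixes f :: "'a \<Rightarrow> real^'n"
  assumes "f \<in> borel_measurable M"
  shows "(\<lambda>x. f x $ k) \<in> borel_measurable M"
  by (rule measurable_compose[OF assms borel_measurable_continuous_onI]) (intro continuous_intros)

lemma tri_domain_convex: "convex (tri_domain P)"
proof (rule convexI)
  fix p q :: "real \<times> real" and a b :: real
  assume "p \<in> tri_domain P" "q \<in> tri_domain P" and ab: "0 \<le> a" "0 \<le> b" "a + b = 1"
  then have p: "0 \<le> snd p" "snd p \<le> fst p" "fst p \<le> len P" and q: "0 \<le> snd q" "snd q \<le> fst q" "fst q \<le> len P"
    by (auto simp: tri_domain_def)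
  have "a * fst p + b * fst q \<le> a * len P + b * len P" using p q ab by (intro add_mono mult_left_mono)
  also have "\<dots> = len P" using ab by (simp add: distrib_right[symmetric])
  finally have "a * fst p + b * fst q \<le> len P" .
  moreover have "0 \<le> a * snd p + b * snd q" using p q ab by simp
  moreover have "a * snd p + b * snd q \<le> a * fst p + b * fst q" using p q ab by (intro add_mono mult_left_mono)
  ultimately show "a *\<^sub>R p + b *\<^sub>R q \<in> tri_domain P"
    by (auto simp: tri_domain_def case_prod_unfold)
qed

section \<open>The closed loop as an instance of \<open>backstepping\<close>\<close>

locale AR_closed_loop =
  fixes P :: AR_params and V :: "real^4^4"
    and K :: "real \<Rightarrow> real \<Rightarrow> real^3" and L11 :: "real \<Rightarrow> real \<Rightarrow> real"
    and z :: "real \<Rightarrow> real \<Rightarrow> real^4" and U :: "real \<Rightarrow> real"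
  assumes valid: "valid_params P" and congested: "congested P"
    and diagonalizes: "diagonalizes P V" and inlet_inv: "invertible (inlet_matrix P V)" and kappa: "kappa P V 4 \<noteq> 0"
    and K: "kernel_solution P V K"
    and L11: "\<And>x \<xi>. (x, \<xi>) \<in> tri_domain P \<Longrightarrow> L11 x \<xi> = kernel_L11 P V K x \<xi>"
    and L11_bounded: "Linf_on (tri_domain P) (\<lambda>(x, \<xi>). L11 x \<xi>)"
    and z: "char_solution (len P) (Jt P) (Jx P) (Js P) z"
    and inlet_1: "AE t in lborel. 0 \<le> t \<longrightarrow> z 0 t $ 1 = 0"
    and inlet_2: "AE t in lborel. 0 \<le> t \<longrightarrow> z 0 t $ 3 = 0"
    and inlet_flow: "AE t in lborel. 0 \<le> t \<longrightarrow> flow P (z 0 t) = 0"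
    and outlet_flow: "AE t in lborel. 0 \<le> t \<longrightarrow> flow P (z (len P) t) = U t"
    and feedback: "AE t in lborel. 0 \<le> t \<longrightarrow> U t = feedback P V K L11 (\<lambda>x. z x t)"
begin

definition "strip = {0..len P} \<times> {0::real..}"

text \<open>States and kernels are extended by zero, which makes them globally Borel measurable.\<close>

definition "z0 x t = (if (x, t) \<in> strip then z x t else 0)"
definition "wt i x t = eigen_coord P V i x (z0 x t)"
definition "K0 j x \<xi> = (if (x, \<xi>) \<in> tri_domain P then K x \<xi> $ j else 0)"
definition "L0 x \<xi> = (if (x, \<xi>) \<in> tri_domain P then L11 x \<xi> else 0)"

lemma len_pos: "0 < len P"
  using valid by (simp add: valid_params_def)

lemma lam_nonzero: "lam P $ i \<noteq> 0"
proof -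
  have "\<forall>i. lam P $ i \<noteq> 0" unfolding forall_4 using congested by (auto simp: congested_def)
  then show ?thesis by blast
qed

lemma strip_convex: "convex strip"
  unfolding strip_def by (intro convex_Times convex_real_interval)

lemma coord_eq:
  "deriv_along (lam P $ i) 1 strip (\<lambda>x t. (matrix_inv V *v z x t) $ i)
    (\<lambda>x t. \<Sum>k\<in>UNIV. Jhat P V $ i $ k * (matrix_inv V *v z x t) $ k)"
proof -
  have eig: "row i (matrix_inv V ** matrix_inv (Jt P)) v* Jx P =
      lam P $ i *\<^sub>R (row i (matrix_inv V ** matrix_inv (Jt P)) v* Jt P)"
    using left_eigenvectors[OF diagonalizes, of i] by simp
  have "\<forall>l c. l v* Jx P = c *\<^sub>R (l v* Jt P) \<longrightarrow>
        deriv_along c 1 strip (\<lambda>x t. (l v* Jt P) \<bullet> z x t) (\<lambda>x t. - ((l v* Js P) \<bullet> z x t))"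
    using z unfolding char_solution_def strip_def by blast
  from this[rule_format, OF eig]
  show ?thesis unfolding left_eigenvectors[OF diagonalizes] by (simp add: inner_row)
qed

text \<open>Differentiating the factor contributes \<open>- theta P V i * lam P $ i\<close>, which
  cancels \<open>Jhat P V $ i $ i\<close>; conjugation by the factors turns the other entries of
  \<open>Jhat\<close> into \<open>coupling\<close>.\<close>

lemma wt_eq:
  "deriv_along (lam P $ i) 1 strip (wt i) (\<lambda>x t. \<Sum>k\<in>UNIV. (if k = i then 0 else coupling P V x i k) * wt k x t)"
proof (rule deriv_along_cong[OF deriv_along_mult[OF deriv_along_exp[of _ _ _ "- theta P V i"] coord_eq[of i] strip_convex] strip_convex])
  fix x t
  assume xt: "(x, t) \<in> strip"
  then show "exp (- theta P V i * x) * (matrix_inv V *v z x t) $ i = wt i x t"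
    by (simp add: wt_def z0_def eigen_coord_def)
  define y where "y k = (matrix_inv V *v z x t) $ k" for k
  define E where "E = exp (- theta P V i * x)"
  have summand: "(if k = i then 0 else coupling P V x i k) * wt k x t = E * (if k = i then 0 else Jhat P V $ i $ k * y k)" for k
  proof -
    have "exp ((theta P V k - theta P V i) * x) * exp (- theta P V k * x) = E"
      by (simp add: E_def exp_add[symmetric] algebra_simps)
    then have "coupling P V x i k * wt k x t = E * (Jhat P V $ i $ k * y k)"
      using xt by (simp add: coupling_def wt_def z0_def eigen_coord_def y_def[symmetric] mult.assoc[symmetric])
    then show ?thesis by simp
  qed
  have th: "theta P V i * lam P $ i = Jhat P V $ i $ i" using lam_nonzero by (simp add: theta_def)
  have "(\<Sum>k\<in>UNIV. Jhat P V $ i $ k * y k) = Jhat P V $ i $ i * y i + (\<Sum>k\<in>UNIV. if k = i then 0 else Jhat P V $ i $ k * y k)"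
    by (subst (1 2) sum.remove[of _ i]) (auto intro!: sum.cong)
  then have "- theta P V i * lam P $ i * E * y i + E * (\<Sum>k\<in>UNIV. Jhat P V $ i $ k * y k) =
      E * (\<Sum>k\<in>UNIV. if k = i then 0 else Jhat P V $ i $ k * y k)"
    using th by (simp add: distrib_left)
  then show "- theta P V i * lam P $ i * exp (- theta P V i * x) * (matrix_inv V *v z x t) $ i +
        exp (- theta P V i * x) * (\<Sum>k\<in>UNIV. Jhat P V $ i $ k * (matrix_inv V *v z x t) $ k) =
        (\<Sum>k\<in>UNIV. (if k = i then 0 else coupling P V x i k) * wt k x t)"
    unfolding y_def[symmetric] E_def[symmetric] summand sum_distrib_left .
qed

lemma w_eq: "deriv_along (lam P $ idx j) 1 strip (wt (idx j))
    (\<lambda>x t. (\<Sum>k\<in>UNIV. Sig_pp P V x $ j $ k * wt (idx k) x t) + Sig_pm P V x $ j * wt 4 x t)"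
proof -
  have "(\<lambda>x t. \<Sum>k\<in>UNIV. (if k = idx j then 0 else coupling P V x (idx j) k) * wt k x t) =
    (\<lambda>x t. (\<Sum>k\<in>UNIV. Sig_pp P V x $ j $ k * wt (idx k) x t) + Sig_pm P V x $ j * wt 4 x t)"
    unfolding sum_4_idx Sig_idx using idx_neq_4[of j] by (auto simp: idx_inj fun_eq_iff intro!: sum.cong)
  then show ?thesis using wt_eq[of "idx j"] by simp
qed

lemma u_eq: "deriv_along (lam P $ 4) 1 strip (wt 4) (\<lambda>x t. \<Sum>k\<in>UNIV. Sig_mp P V x $ k * wt (idx k) x t)"
proof -
  have "(\<lambda>x t. \<Sum>k\<in>UNIV. (if k = 4 then 0 else coupling P V x 4 k) * wt k x t) =
    (\<lambda>x t. \<Sum>k\<in>UNIV. Sig_mp P V x $ k * wt (idx k) x t)"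
    unfolding sum_4_idx Sig_idx by (simp add: idx_neq_4)
  then show ?thesis using wt_eq[of 4] by simp
qed

text \<open>Measurability is given only up to each finite horizon, so \<open>z0\<close> is written
  as a limit of truncations that become constant at every point. \<open>Suc n\<close> keeps the
  horizon positive, as \<open>char_solution\<close> demands.\<close>

lemma z0_meas: "(\<lambda>p. z0 (fst p) (snd p)) \<in> borel_measurable borel"
proof (rule borel_measurable_LIMSEQ_metric)
  fix n :: nat
  have "set_borel_measurable lborel ({0..len P} \<times> {0..real (Suc n)}) (\<lambda>(x, t). z x t)"
    using z of_nat_0_less_iff[of "Suc n", where 'a = real] unfolding char_solution_def Linf_on_def by blast
  then show "(\<lambda>p. indicator ({0..len P} \<times> {0..real (Suc n)}) p *\<^sub>R z (fst p) (snd p)) \<in> borel_measurable borel"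
    unfolding set_borel_measurable_def case_prod_unfold measurable_lborel2 .
next
  fix p :: "real \<times> real"
  have "eventually (\<lambda>n. indicator ({0..len P} \<times> {0..real (Suc n)}) p *\<^sub>R z (fst p) (snd p) = z0 (fst p) (snd p)) sequentially"
    using eventually_ge_at_top[of "nat \<lceil>snd p\<rceil>"]
  proof eventually_elim
    case (elim n)
    then have "snd p \<le> real (Suc n)" by linarith
    then show ?case by (cases p) (auto simp: z0_def strip_def indicator_def)
  qed
  then show "(\<lambda>n. indicator ({0..len P} \<times> {0..real (Suc n)}) p *\<^sub>R z (fst p) (snd p)) \<longlonglongrightarrow> z0 (fst p) (snd p)"
    by (rule tendsto_eventually)
qed

lemma wt_meas: "(\<lambda>p. wt i (fst p) (snd p)) \<in> borel_measurable borel"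
proof -
  note [measurable] = z0_meas
  show ?thesis unfolding wt_def eigen_coord_def matrix_vector_mult_def by simp
qed

lemma wt_bounded: "ess_bounded ({0..len P} \<times> {0..T}) (\<lambda>p. wt i (fst p) (snd p))"
proof -
  \<comment> \<open>\<open>T\<close> may be zero or negative here, while
    \<open>char_solution\<close> speaks of positive horizons.\<close>
  have "Linf_on ({0..len P} \<times> {0..max T 1}) (\<lambda>(x, t). z x t)"
    using z unfolding char_solution_def by auto
  from Linf_ess_bounded_component[OF this]
  have "ess_bounded ({0..len P} \<times> {0..T}) (\<lambda>p. z (fst p) (snd p) $ k)" for k
    by (rule ess_bounded_subset) auto
  then have "ess_bounded ({0..len P} \<times> {0..T}) (\<lambda>p. z0 (fst p) (snd p) $ k)" for k
    by (rule ess_bounded_cong[rotated]) (auto simp: z0_def strip_def)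
  moreover have "ess_bounded ({0..len P} \<times> {0..T}) (\<lambda>p. a)" for a by (auto simp: ess_bounded_def)
  ultimately show ?thesis
    unfolding wt_def eigen_coord_def matrix_vector_mult_def
    by (auto intro!: ess_bounded_mult ess_bounded_sum continuous_ess_bounded continuous_intros)
qed

lemma K0_meas: "(\<lambda>p. K0 j (fst p) (snd p)) \<in> borel_measurable borel"
proof -
  have "set_borel_measurable lborel (tri_domain P) (\<lambda>(x, \<xi>). K x \<xi>)"
    using K unfolding kernel_solution_def Linf_on_def by blast
  then have "(\<lambda>p. indicator (tri_domain P) p *\<^sub>R K (fst p) (snd p)) \<in> borel_measurable borel"
    unfolding set_borel_measurable_def case_prod_unfold measurable_lborel2 .
  from borel_measurable_component[OF this, of j]
  show ?thesis by (rule measurable_cong[THEN iffD1, rotated]) (simp add: K0_def)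
qed

lemma K0_bounded: "ess_bounded (tri_domain P) (\<lambda>p. K0 j (fst p) (snd p))"
proof -
  have "ess_bounded (tri_domain P) (\<lambda>p. K (fst p) (snd p) $ j)"
    using K unfolding kernel_solution_def by (intro Linf_ess_bounded_component) blast
  then show ?thesis by (rule ess_bounded_cong[rotated]) (simp add: K0_def)
qed

lemma L0_meas: "(\<lambda>p. L0 (fst p) (snd p)) \<in> borel_measurable borel"
proof -
  have "(\<lambda>p. indicator (tri_domain P) p *\<^sub>R L11 (fst p) (snd p)) \<in> borel_measurable borel"
    using L11_bounded unfolding Linf_on_def set_borel_measurable_def case_prod_unfold measurable_lborel2 by blast
  then show ?thesis by (rule measurable_cong[THEN iffD1, rotated]) (simp add: L0_def)
qed

lemma L0_bounded: "ess_bounded (tri_domain P) (\<lambda>p. L0 (fst p) (snd p))"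
proof -
  obtain C where "AE p in lborel. p \<in> tri_domain P \<longrightarrow> norm (L11 (fst p) (snd p)) \<le> C"
    using L11_bounded unfolding Linf_on_def case_prod_unfold by blast
  then have "AE p in lborel. p \<in> tri_domain P \<longrightarrow> \<bar>L0 (fst p) (snd p)\<bar> \<le> C"
    by eventually_elim (auto simp: L0_def)
  then show ?thesis unfolding ess_bounded_def by blast
qed

text \<open>The nonlocal terms multiplying \<open>Sig_mp\<close> are together exactly
  \<open>kernel_L11\<close>. Naming them \<open>L0\<close> makes the equation local in the pair of
  kernels.\<close>

lemma K_eq: "deriv_along (lam P $ 4) (lam P $ idx j) (tri_domain P) (K0 j)
    (\<lambda>x \<xi>. - ((\<Sum>k\<in>UNIV. K0 k x \<xi> * Sig_pp P V \<xi> $ k $ j) + L0 x \<xi> * Sig_mp P V \<xi> $ j))"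
proof -
  have D: "deriv_along (lam P $ 4) (Lam_plus P $ j $ j) (tri_domain P) (\<lambda>x \<xi>. K x \<xi> $ j)
        (\<lambda>x \<xi>. - (K x \<xi> v* Sig_pp P V \<xi>
                  - ((1 / lam P $ 4) * ((K (x - \<xi>) 0 v* Lam_plus P) \<bullet> Q0_bar P V)) *\<^sub>R Sig_mp P V \<xi>
                  + (LINT \<nu>:{0..- \<xi> / lam P $ 4}|lborel.
                       K (lam P $ 4 * \<nu> + x) (lam P $ 4 * \<nu> + \<xi>) \<bullet> Sig_pm P V (lam P $ 4 * \<nu> + \<xi>))
                    *\<^sub>R Sig_mp P V \<xi>) $ j)"
    using K unfolding kernel_solution_def by blast
  show ?thesis
    unfolding Lam_plus_idx[symmetric]
  proof (rule deriv_along_cong[OF D tri_domain_convex])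
    fix x \<xi>
    assume tri: "(x, \<xi>) \<in> tri_domain P"
    then show "K x \<xi> $ j = K0 j x \<xi>" by (simp add: K0_def)
    have "(K x \<xi> v* Sig_pp P V \<xi>) $ j = (\<Sum>k\<in>UNIV. K0 k x \<xi> * Sig_pp P V \<xi> $ k $ j)"
      using tri by (simp add: vector_matrix_mult_def K0_def mult.commute)
    then show "- (K x \<xi> v* Sig_pp P V \<xi>
                  - ((1 / lam P $ 4) * ((K (x - \<xi>) 0 v* Lam_plus P) \<bullet> Q0_bar P V)) *\<^sub>R Sig_mp P V \<xi>
                  + (LINT \<nu>:{0..- \<xi> / lam P $ 4}|lborel.
                       K (lam P $ 4 * \<nu> + x) (lam P $ 4 * \<nu> + \<xi>) \<bullet> Sig_pm P V (lam P $ 4 * \<nu> + \<xi>))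
                    *\<^sub>R Sig_mp P V \<xi>) $ j =
        - ((\<Sum>k\<in>UNIV. K0 k x \<xi> * Sig_pp P V \<xi> $ k $ j) + L0 x \<xi> * Sig_mp P V \<xi> $ j)"
      using tri by (simp add: L0_def L11[OF tri] kernel_L11_def algebra_simps)
  qed
qed

lemma mult_Lam_plus: "(k v* Lam_plus P) $ j = k $ j * lam P $ idx j"
proof -
  have "(k v* Lam_plus P) $ j = k $ j * Lam_plus P $ j $ j"
    by (simp add: vector_matrix_mult_def Lam_plus_def diag_def if_distrib if_distribR cong: if_cong)
  then show ?thesis by (simp add: Lam_plus_idx)
qed

lemma K_diag: "AE x in lborel. x \<in> {0..len P} \<longrightarrow> (\<forall>j. (lam P $ idx j - lam P $ 4) * K0 j x x + Sig_mp P V x $ j = 0)"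
proof -
  have "AE x in lborel. x \<in> {0..len P} \<longrightarrow>
        K x x v* Lam_plus P + Lam_minus P *\<^sub>R K x x + Sig_mp P V x = 0"
    using K unfolding kernel_solution_def by blast
  then show ?thesis
  proof eventually_elim
    case (elim x)
    show ?case
    proof (intro impI allI)
      fix j
      assume x: "x \<in> {0..len P}"
      with elim have "(K x x v* Lam_plus P + Lam_minus P *\<^sub>R K x x + Sig_mp P V x) $ j = 0" by simp
      then show "(lam P $ idx j - lam P $ 4) * K0 j x x + Sig_mp P V x $ j = 0"
        using x by (simp add: mult_Lam_plus Lam_minus_def K0_def tri_domain_def algebra_simps)
    qed
  qed
qed

lemma L_eq:
  assumes tri: "(x, \<xi>) \<in> tri_domain P"
  shows "L0 x \<xi> = - (1 / lam P $ 4) * (\<Sum>j\<in>UNIV. K0 j (x - \<xi>) 0 * lam P $ idx j * Q0_bar P V $ j)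
        + (LINT \<nu>:{0..- \<xi> / lam P $ 4}|lborel. \<Sum>j\<in>UNIV. K0 j (lam P $ 4 * \<nu> + x) (lam P $ 4 * \<nu> + \<xi>)
            * Sig_pm P V (lam P $ 4 * \<nu> + \<xi>) $ j)"
proof -
  have l: "lam P $ 4 < 0" using congested by (simp add: congested_def)
  have "(x - \<xi>, 0) \<in> tri_domain P" using tri by (simp add: tri_domain_def)
  then have 1: "(K (x - \<xi>) 0 v* Lam_plus P) \<bullet> Q0_bar P V = (\<Sum>j\<in>UNIV. K0 j (x - \<xi>) 0 * lam P $ idx j * Q0_bar P V $ j)"
    by (simp add: inner_vec_def mult_Lam_plus K0_def)
  have 2: "(LINT \<nu>:{0..- \<xi> / lam P $ 4}|lborel.
          K (lam P $ 4 * \<nu> + x) (lam P $ 4 * \<nu> + \<xi>) \<bullet> Sig_pm P V (lam P $ 4 * \<nu> + \<xi>)) =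
      (LINT \<nu>:{0..- \<xi> / lam P $ 4}|lborel. \<Sum>j\<in>UNIV. K0 j (lam P $ 4 * \<nu> + x) (lam P $ 4 * \<nu> + \<xi>)
            * Sig_pm P V (lam P $ 4 * \<nu> + \<xi>) $ j)"
  proof (rule set_lebesgue_integral_cong)
    show "\<forall>\<nu>. \<nu> \<in> {0..- \<xi> / lam P $ 4} \<longrightarrow>
        K (lam P $ 4 * \<nu> + x) (lam P $ 4 * \<nu> + \<xi>) \<bullet> Sig_pm P V (lam P $ 4 * \<nu> + \<xi>) =
        (\<Sum>j\<in>UNIV. K0 j (lam P $ 4 * \<nu> + x) (lam P $ 4 * \<nu> + \<xi>) * Sig_pm P V (lam P $ 4 * \<nu> + \<xi>) $ j)"
    proof (intro allI impI)
      fix \<nu>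
      assume \<nu>: "\<nu> \<in> {0..- \<xi> / lam P $ 4}"
      \<comment> \<open>For these \<open>\<nu>\<close> the shift \<open>lam P $ 4 * \<nu>\<close>
        lies between \<open>- \<xi>\<close> and 0, so the integration path stays in the triangle and
        \<open>K0\<close> agrees with \<open>K\<close> on it.\<close>
      then have "lam P $ 4 * (- \<xi> / lam P $ 4) \<le> lam P $ 4 * \<nu>" using l by (intro mult_left_mono_neg) auto
      then have "- \<xi> \<le> lam P $ 4 * \<nu>" using l by simp
      moreover have "lam P $ 4 * \<nu> \<le> 0" using \<nu> l by (simp add: mult_nonpos_nonneg)
      ultimately have "(lam P $ 4 * \<nu> + x, lam P $ 4 * \<nu> + \<xi>) \<in> tri_domain P"
        using tri by (simp add: tri_domain_def)
      then show "K (lam P $ 4 * \<nu> + x) (lam P $ 4 * \<nu> + \<xi>) \<bullet> Sig_pm P V (lam P $ 4 * \<nu> + \<xi>) =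
        (\<Sum>j\<in>UNIV. K0 j (lam P $ 4 * \<nu> + x) (lam P $ 4 * \<nu> + \<xi>) * Sig_pm P V (lam P $ 4 * \<nu> + \<xi>) $ j)"
        by (simp add: inner_vec_def K0_def)
    qed
  qed simp
  have "L0 x \<xi> = kernel_L11 P V K x \<xi>" using tri by (simp add: L0_def L11)
  then show ?thesis unfolding kernel_L11_def 1 2 .
qed

lemma inlet: "AE t in lborel. 0 \<le> t \<longrightarrow> (\<forall>j. wt (idx j) 0 t = Q0_bar P V $ j * wt 4 0 t)"
  using inlet_1 inlet_2 inlet_flow
proof eventually_elim
  case (elim t)
  show ?case
  proof (intro impI allI)
    fix j
    assume t: "0 \<le> t"
    then have "z0 0 t = z 0 t" using len_pos by (simp add: z0_def strip_def)
    then show "wt (idx j) 0 t = Q0_bar P V $ j * wt 4 0 t"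
      unfolding wt_def using inlet_coord[OF diagonalizes inlet_inv] elim t by simp
  qed
qed

lemma outlet: "AE t in lborel. 0 \<le> t \<longrightarrow> wt 4 (len P) t =
    (LINT \<xi>:{0..len P}|lborel. \<Sum>j\<in>UNIV. K0 j (len P) \<xi> * wt (idx j) \<xi> t)
    + (LINT \<xi>:{0..len P}|lborel. L0 (len P) \<xi> * wt 4 \<xi> t)"
  using outlet_flow feedback
proof eventually_elim
  case (elim t)
  show ?case
  proof
    assume t: "0 \<le> t"
    have z0: "z0 x t = z x t" if "x \<in> {0..len P}" for x using that t by (simp add: z0_def strip_def)
    have tri: "(len P, \<xi>) \<in> tri_domain P" if "\<xi> \<in> {0..len P}" for \<xi> using that by (simp add: tri_domain_def)
    have 1: "(LINT \<xi>:{0..len P}|lborel. K (len P) \<xi> \<bullet> (Tu_inv P V \<xi> *v z \<xi> t)) =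
        (LINT \<xi>:{0..len P}|lborel. \<Sum>j\<in>UNIV. K0 j (len P) \<xi> * wt (idx j) \<xi> t)"
      by (rule set_lebesgue_integral_cong) (auto simp: inner_vec_def K0_def tri wt_def z0 T_inv_coord)
    have 2: "(LINT \<xi>:{0..len P}|lborel. L11 (len P) \<xi> * (Tl_inv P V \<xi> \<bullet> z \<xi> t)) =
        (LINT \<xi>:{0..len P}|lborel. L0 (len P) \<xi> * wt 4 \<xi> t)"
      by (rule set_lebesgue_integral_cong) (auto simp: L0_def tri wt_def z0 T_inv_coord)
    have zL: "z0 (len P) t = z (len P) t" using len_pos by (intro z0) simp
    have "flow P (z (len P) t) = kappa P V 4 * exp (theta P V 4 * len P) *
        (- (R1_bar P V \<bullet> (Tu_inv P V (len P) *v z (len P) t)) +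
         ((LINT \<xi>:{0..len P}|lborel. \<Sum>j\<in>UNIV. K0 j (len P) \<xi> * wt (idx j) \<xi> t)
          + (LINT \<xi>:{0..len P}|lborel. L0 (len P) \<xi> * wt 4 \<xi> t)))"
      using elim t by (simp add: feedback_def theta_def 1 2 add.assoc)
    from outlet_coord[OF diagonalizes kappa this]
    show "wt 4 (len P) t =
      (LINT \<xi>:{0..len P}|lborel. \<Sum>j\<in>UNIV. K0 j (len P) \<xi> * wt (idx j) \<xi> t)
      + (LINT \<xi>:{0..len P}|lborel. L0 (len P) \<xi> * wt 4 \<xi> t)"
      by (simp add: wt_def zL)
  qed
qed

lemma coupling_continuous: "continuous_on UNIV (\<lambda>x. coupling P V x i k)"
  unfolding coupling_def by (intro continuous_intros)

sublocale backstepping "len P" "lam P $ 4" "v_eq P $ 2" "\<lambda>j. lam P $ idx j" "\<lambda>j. Q0_bar P V $ j"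
  "\<lambda>j k x. Sig_pp P V x $ j $ k" "\<lambda>j x. Sig_pm P V x $ j" "\<lambda>j x. Sig_mp P V x $ j"
  "\<lambda>j. wt (idx j)" "wt 4" K0 L0 strip "tri_domain P"
proof unfold_locales
  \<comment> \<open>In this order the three speeds are \<open>v_eq P $ 2\<close>,
    \<open>lam P $ 3\<close> and \<open>v_eq P $ 1\<close>.\<close>
  have "\<forall>j. v_eq P $ 2 \<le> lam P $ idx j"
    unfolding forall_3 using lam_order[OF valid congested] congested
    by (simp add: congested_def lam_def Let_def)
  then show "v_eq P $ 2 \<le> lam P $ idx j" for j by blast
  show "0 < v_eq P $ 2" "lam P $ 4 < 0" using congested by (auto simp: congested_def)
  show "continuous_on UNIV (\<lambda>x. Sig_pp P V x $ j $ k)" "continuous_on UNIV (\<lambda>x. Sig_pm P V x $ j)"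
    "continuous_on UNIV (\<lambda>x. Sig_mp P V x $ j)" for j k
    unfolding Sig_idx using coupling_continuous by (cases "j = k"; simp)+
qed (fact len_pos strip_def tri_domain_def wt_meas K0_meas L0_meas wt_bounded K0_bounded L0_bounded w_eq u_eq K_eq K_diag
    L_eq inlet outlet)+

lemma closed_loop_zero:
  assumes "len P / v_eq P $ 2 + len P / (- lam P $ 4) \<le> t"
  shows "AE x in lborel. x \<in> {0..len P} \<longrightarrow> z x t = 0"
proof -
  have t: "0 \<le> t"
  proof -
    have "0 \<le> len P / v_eq P $ 2" "0 \<le> len P / (- lam P $ 4)"
      using congested len_pos unfolding congested_def by (intro divide_nonneg_pos; simp)+
    then show ?thesis using assms by linarith
  qed
  have "AE x in lborel. \<forall>j\<in>UNIV. x \<in> {0..len P} \<longrightarrow> wt (idx j) x t = 0"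
    using finite_time_zero(2)[OF assms] by (intro AE_finite_allI) auto
  with finite_time_zero(1)[OF assms] show ?thesis
  proof eventually_elim
    case (elim x)
    show ?case
    proof
      assume x: "x \<in> {0..len P}"
      have "\<forall>i. wt i x t = 0"
        unfolding forall_4 using elim x idx_simps by (metis UNIV_I)
      then have "\<forall>i. (matrix_inv V *v z x t) $ i = 0"
        using x t by (simp add: wt_def eigen_coord_def z0_def strip_def)
      then have "matrix_inv V *v z x t = 0" by (simp add: vec_eq_iff)
      then show "z x t = 0" using V_inverse(1)[OF diagonalizes, of "z x t"] by simp
    qed
  qed
qed

end

theorem theorem1:
  fixes P :: AR_params and V :: "real^4^4"
    and K :: "real \<Rightarrow> real \<Rightarrow> real^3" and L11 :: "real \<Rightarrow> real \<Rightarrow> real"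
    and z :: "real \<Rightarrow> real \<Rightarrow> real^4" and U :: "real \<Rightarrow> real"
  assumes "valid_params P" and "congested P"
    and "diagonalizes P V" and "invertible (inlet_matrix P V)" and "kappa P V 4 \<noteq> 0"
    and "kernel_solution P V K"
    and "\<And>x \<xi>. (x, \<xi>) \<in> tri_domain P \<Longrightarrow> L11 x \<xi> = kernel_L11 P V K x \<xi>"
    and "Linf_on (tri_domain P) (\<lambda>(x, \<xi>). L11 x \<xi>)"
    and "char_solution (len P) (Jt P) (Jx P) (Js P) z"
    and "Linf_on {0..len P} (\<lambda>x. z x 0)"
    and "AE t in lborel. 0 \<le> t \<longrightarrow> z 0 t $ 1 = 0"
    and "AE t in lborel. 0 \<le> t \<longrightarrow> z 0 t $ 3 = 0"
    and "AE t in lborel. 0 \<le> t \<longrightarrow> flow P (z 0 t) = 0"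
    and "AE t in lborel. 0 \<le> t \<longrightarrow> flow P (z (len P) t) = U t"
    and "AE t in lborel. 0 \<le> t \<longrightarrow> U t = feedback P V K L11 (\<lambda>x. z x t)"
  shows "\<forall>t \<ge> len P / v_eq P $ 2 + len P / (- lam P $ 4).
           AE x in lborel. x \<in> {0..len P} \<longrightarrow> z x t = 0"
proof -
  interpret AR_closed_loop P V K L11 z U
    by unfold_locales (fact assms)+
  show ?thesis using closed_loop_zero by blast
qed

end
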